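(* Let $0<\alpha<2$, let $\Omega$ be the open unit disk in $\mathbb{R}^2$, let $k_1,k_2>0$ and $K(x)=\begin{bmatrix}k_1&0\\0&k_2\end{bmatrix}$, let $s_1,s_2>0$, and let $f\in\mathbf{B}^{s_1,s_2}_{\alpha/2}(\Omega)$. Then there exists a unique solution $\widetilde u(x)=\omega^{\alpha/2}u(x)$ of $$-\nabla\cdot(-\Delta)^{\frac{\alpha-2}{2}}K(x)\nabla\widetilde u(x)=f(x),\quad x\in\Omega,\qquad\text{subject to }\widetilde u=0\ \text{on }\partial\Omega,$$ (equality meaning equality of the coefficients of all the basis functions $V_{l,\mu}(x)P_n^{(\frac{\alpha}{2},\,l)}(2r^2-1)$), and $u\in\mathbf{B}^{s_1+\frac{\alpha}{2},\;s_2+\alpha}_{\alpha/2}(\Omega)$.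
   Context: $(r,\varphi)$ are polar coordinates of $x\in\mathbb{R}^2$. $V_{l,1}(x)=r^l\cos(l\varphi)$ ($l\ge0$), $V_{l,-1}(x)=r^l\sin(l\varphi)$ ($l\ge1$). $P_n^{(a,b)}$ are the standard Jacobi polynomials. $\omega^{\gamma}=(1-r^2)^{\gamma}$ on $\Omega$, and $\widetilde u=\omega^{\alpha/2}u$ is extended by $0$ outside $\Omega$; the homogeneous boundary condition is encoded in the form $\widetilde u=\omega^{\alpha/2}u$. For $\beta>-1$, $L^2_{\beta}(\Omega)$ is the weighted space with norm $\|g\|^2_{L^2_\beta(\Omega)}=\int_\Omega(1-r^2)^{\beta}g^2\,dx$. The functions $V_{l,\mu}(x)P_n^{(\beta,\,l)}(2r^2-1)$, with $l,n\ge0$, $\mu\in\{1,-1\}$, $(l,\mu)\ne(0,-1)$, form an orthogonal basis of it; let $h_{l,n}$ be the $L^2_\beta(\Omega)$-norm of the basis function with indices $(l,n,\mu)$ (independent of $\mu$). For $s_1,s_2>0$, $$\mathbf{B}^{s_1,s_2}_\beta(\Omega)=\Big\{v\in L^2_\beta(\Omega):\ \sum_{l,n,\mu}(l^{2s_1}+n^{2s_2})\,v_{l,n,\mu}^2\,h_{l,n}^2<\infty\Big\},$$ where $v_{l,n,\mu}$ are the coefficients of $v$ in this basis. The solution is sought with $u$ of the form $u(x)=\sum_{l\ge1,n\ge0,\mu\in\{1,-1\}}u_{l,n,\mu}V_{l,\mu}(x)P_n^{(\frac{\alpha}{2},\,l)}(2r^2-1)+\sum_{n\ge0}\frac{u_{0,n,1}}{2}V_{0,1}(x)P_n^{(\frac{\alpha}{2},\,0)}(2r^2-1)$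 with real coefficients $u_{l,n,\mu}$. $(-\Delta)^{\frac{\alpha-2}{2}}$ is the Riesz potential operator of order $2-\alpha$ on $\mathbb{R}^2$: $(-\Delta)^{\frac{\alpha-2}{2}}g(x)=\frac{1}{\gamma_2(2-\alpha)}\int_{\mathbb{R}^2}\frac{g(x-y)}{|y|^{\alpha}}\,dy$, $\gamma_2(2-\alpha)=2^{2-\alpha}\pi\,\Gamma(1-\frac{\alpha}{2})/\Gamma(\frac{\alpha}{2})$, applied componentwise to vector fields (gradients in $\Omega$ extended by zero outside $\Omega$). The expansion of $\mathcal{L}(\widetilde u):=-\nabla\cdot(-\Delta)^{\frac{\alpha-2}{2}}K\nabla\widetilde u$ is obtained by applying $\mathcal{L}$ term by term to the expansion of $\widetilde u=\omega^{\alpha/2}u$: for each basis function $\phi$ (with $\beta=\alpha/2$), the restriction of $\mathcal{L}(\omega^{\alpha/2}\phi)$ to $\Omega$ is a finite linear combination of basis functions, and each basis function receives contributions from only finitely many terms, so every coefficient of $\mathcal{L}(\widetilde u)$ is a finite linear combination of the $u_{l,n,\mu}$. *)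

theory Defs
  imports "HOL-Analysis.Analysis"
begin

abbreviation unit_disk :: "(real^2) set" where
  "unit_disk \<equiv> ball 0 1"

definition polar_angle :: "real^2 \<Rightarrow> real" where
  "polar_angle x = Arg (Complex (x $ 1) (x $ 2))"

definition solid_harmonic :: "nat \<Rightarrow> int \<Rightarrow> real^2 \<Rightarrow> real" where
  "solid_harmonic l \<mu> x =
     norm x ^ l * (if \<mu> = 1 then cos (real l * polar_angle x) else sin (real l * polar_angle x))"

text \<open>Standard Jacobi polynomials (orthogonal for the weight \<open>(1 - t) powr a * (1 + t) powr b\<close>
  on \<open>[-1, 1]\<close>, with value \<open>(n + a) gchoose n\<close> at \<open>1\<close>), in the explicit form obtained from
  Rodrigues' formula by the Leibniz rule.\<close>

definition jacobi_poly :: "nat \<Rightarrow> real \<Rightarrow> real \<Rightarrow> real \<Rightarrow> real" where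
  "jacobi_poly n a b t =
     (\<Sum>k\<le>n. ((real n + a) gchoose (n - k)) * ((real n + b) gchoose k)
            * ((t - 1) / 2) ^ k * ((t + 1) / 2) ^ (n - k))"

text \<open>Basis functions are indexed by triples \<open>(l, n, \<mu>)\<close>; the pair \<open>(l, \<mu>) = (0, -1)\<close> would give
  the zero function and is left out.\<close>

definition basis_index :: "(nat \<times> nat \<times> int) set" where
  "basis_index = {(l, n, \<mu>). \<mu> \<in> {1, -1} \<and> (l, \<mu>) \<noteq> (0, -1)}"

definition disk_basis :: "real \<Rightarrow> nat \<times> nat \<times> int \<Rightarrow> real^2 \<Rightarrow> real" where
  "disk_basis \<beta> = (\<lambda>(l, n, \<mu>) x.
     solid_harmonic l \<mu> x * jacobi_poly n \<beta> (real l) (2 * (norm x)\<^sup>2 - 1))"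

definition disk_weight :: "real \<Rightarrow> real^2 \<Rightarrow> real" where
  "disk_weight \<gamma> x = (1 - (norm x)\<^sup>2) powr \<gamma>"


text \<open>Elements of the weighted space are functions, not classes of functions modulo null sets;
  their behaviour outside the disk is irrelevant.\<close>

definition weighted_L2 :: "real \<Rightarrow> (real^2 \<Rightarrow> real) set" where
  "weighted_L2 \<beta> = {g. set_borel_measurable lebesgue unit_disk g \<and>
     set_integrable lebesgue unit_disk (\<lambda>x. disk_weight \<beta> x * (g x)\<^sup>2)}"

definition weighted_norm :: "real \<Rightarrow> (real^2 \<Rightarrow> real) \<Rightarrow> real" where
  "weighted_norm \<beta> g =
     sqrt (set_lebesgue_integral lebesgue unit_disk (\<lambda>x. disk_weight \<beta> x * (g x)\<^sup>2))"

definition basis_coeff :: "real \<Rightarrow> (real^2 \<Rightarrow> real) \<Rightarrow> nat \<times> nat \<times> int \<Rightarrow> real" where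
  "basis_coeff \<beta> v i =
     set_lebesgue_integral lebesgue unit_disk (\<lambda>x. disk_weight \<beta> x * (v x * disk_basis \<beta> i x))
       / (weighted_norm \<beta> (disk_basis \<beta> i))\<^sup>2"

text \<open>The space \<open>B\<close> with superscripts \<open>s1, s2\<close> and subscript \<open>\<beta>\<close>. The weighted norm of a
  basis function does not depend on \<open>\<mu>\<close>; it is \<open>h\<close> with subscripts \<open>l, n\<close>.\<close>

definition B_space :: "real \<Rightarrow> real \<Rightarrow> real \<Rightarrow> (real^2 \<Rightarrow> real) set" where
  "B_space \<beta> s1 s2 = {v \<in> weighted_L2 \<beta>.
     (\<lambda>(l, n, \<mu>). (real l powr (2 * s1) + real n powr (2 * s2))
        * (basis_coeff \<beta> v (l, n, \<mu>))\<^sup>2 * (weighted_norm \<beta> (disk_basis \<beta> (l, n, \<mu>)))\<^sup>2)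
     summable_on basis_index}"

text \<open>\<open>v\<close> is the sum in the weighted space of the series with coefficients \<open>a\<close>.\<close>

definition has_expansion ::
    "real \<Rightarrow> (nat \<times> nat \<times> int \<Rightarrow> real) \<Rightarrow> (real^2 \<Rightarrow> real) \<Rightarrow> bool" where
  "has_expansion \<beta> a v \<longleftrightarrow> v \<in> weighted_L2 \<beta> \<and>
     ((\<lambda>F. weighted_norm \<beta> (\<lambda>x. v x - (\<Sum>i\<in>F. a i * disk_basis \<beta> i x))) \<longlongrightarrow> 0)
       (finite_subsets_at_top basis_index)"

text \<open>The convention by which the coefficients with \<open>l = 0\<close> enter the series of \<open>u\<close> halved.\<close>

definition series_coeff :: "(nat \<times> nat \<times> int \<Rightarrow> real) \<Rightarrow> nat \<times> nat \<times> int \<Rightarrow> real" where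
  "series_coeff c = (\<lambda>(l, n, \<mu>). if l = 0 then c (l, n, \<mu>) / 2 else c (l, n, \<mu>))"


text \<open>The function \<open>u\<close> multiplied by the weight and extended by zero; this form encodes the
  homogeneous boundary condition.\<close>

definition tilde :: "real \<Rightarrow> (real^2 \<Rightarrow> real) \<Rightarrow> real^2 \<Rightarrow> real" where
  "tilde \<alpha> u x = (if x \<in> unit_disk then disk_weight (\<alpha> / 2) x * u x else 0)"

definition partial :: "2 \<Rightarrow> (real^2 \<Rightarrow> real) \<Rightarrow> real^2 \<Rightarrow> real" where
  "partial i g x = deriv (\<lambda>t. g (x + t *\<^sub>R axis i 1)) 0"

definition disk_grad :: "(real^2 \<Rightarrow> real) \<Rightarrow> real^2 \<Rightarrow> real^2" where
  "disk_grad g x = (if x \<in> unit_disk then (\<chi> i. partial i g x) else 0)"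

definition div2 :: "(real^2 \<Rightarrow> real^2) \<Rightarrow> real^2 \<Rightarrow> real" where
  "div2 G x = (\<Sum>i\<in>UNIV. partial i (\<lambda>y. G y $ i) x)"

text \<open>The Riesz potential of order \<open>2 - \<alpha>\<close> on the plane, i.e. the power \<open>(\<alpha> - 2) / 2\<close> of the
  negative Laplacian.\<close>

definition riesz_const :: "real \<Rightarrow> real" where
  "riesz_const \<alpha> = 2 powr (2 - \<alpha>) * pi * Gamma (1 - \<alpha> / 2) / Gamma (\<alpha> / 2)"

definition riesz_potential :: "real \<Rightarrow> (real^2 \<Rightarrow> real) \<Rightarrow> real^2 \<Rightarrow> real" where
  "riesz_potential \<alpha> g x =
     1 / riesz_const \<alpha> * integral\<^sup>L lebesgue (\<lambda>y. g (x - y) / norm y powr \<alpha>)"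

definition frac_diffusion :: "real \<Rightarrow> real^2^2 \<Rightarrow> (real^2 \<Rightarrow> real) \<Rightarrow> real^2 \<Rightarrow> real" where
  "frac_diffusion \<alpha> K w x =
     - div2 (\<lambda>z. \<chi> i. riesz_potential \<alpha> (\<lambda>y. (K *v disk_grad w y) $ i) z) x"

text \<open>Equality of all coefficients of \<open>f\<close> and of the operator applied to \<open>tilde \<alpha> u\<close> term by
  term, where \<open>c\<close> is the (formal) coefficient family of \<open>u\<close>. For each \<open>j\<close> only finitely many
  summands are nonzero, so no convergence condition on \<open>c\<close> is imposed.\<close>

definition solves_coeffs ::
    "real \<Rightarrow> real^2^2 \<Rightarrow> (real^2 \<Rightarrow> real) \<Rightarrow> (nat \<times> nat \<times> int \<Rightarrow> real) \<Rightarrow> bool" where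
  "solves_coeffs \<alpha> K f c \<longleftrightarrow> (\<forall>j\<in>basis_index.
     ((\<lambda>i. series_coeff c i *
         basis_coeff (\<alpha> / 2) (frac_diffusion \<alpha> K (tilde \<alpha> (disk_basis (\<alpha> / 2) i))) j)
       has_sum basis_coeff (\<alpha> / 2) f j) basis_index)"

end

theory Submission
  imports Defs
begin

text \<open>
  Put \<open>s = \<alpha> / 2\<close> and use the complex coordinate \<open>z\<close> on the disk. Up to constants, the basis
  functions are the real and imaginary parts of the polynomials \<open>zernike s a b\<close>, with \<open>a = n + l\<close> and
  \<open>b = n\<close>, in \<open>z\<close> and \<open>cnj z\<close>. Derivatives with respect to \<open>z\<close> and \<open>cnj z\<close> map
  \<open>(1 - \<bar>z\<bar>\<^sup>2) powr s * zernike s a b\<close> to multiples of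
  \<open>(1 - \<bar>z\<bar>\<^sup>2) powr (s - 1) * zernike (s - 1)\<close> with one index raised, and \<open>zernike (s - 1) a b\<close> to multiples
  of \<open>zernike s\<close> with one index lowered. In between, the Riesz potential acts on
  \<open>(1 - \<bar>z\<bar>\<^sup>2) powr (s - 1) * zernike (s - 1) a b\<close> as a scalar: its values on monomials are read off
  from the generating function \<open>1 / \<bar>1 - cnj w * z\<bar>\<^sup>2\<close>, whose potential is computed by a disk
  automorphism, and the Pfaff-Saalschuetz identity sums the result.

  Hence the operator preserves the total degree \<open>l + 2 * n\<close>. On the block of degree \<open>N\<close>, after
  scaling by Gamma quotients, it is the Toeplitz matrix with \<open>1\<close> on the diagonal and
  \<open>(k1 - k2) / (2 * (k1 + k2))\<close>, which is less than \<open>1 / 2\<close> in absolute value, next to it. This gives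
  existence and uniqueness. The estimate in the weighted norms is uniform in \<open>N\<close>, since the weights
  vary slowly along a block, and the Gamma quotients, of order \<open>n powr s\<close> and \<open>(n + l) powr s\<close>, account for
  the gain of regularity.
\<close>

section \<open>Zernike polynomials\<close>

text \<open>The potential is diagonal only after one differentiation: the gradient lowers the
  exponent of the weight to \<open>s - 1\<close>, and this is the weight for which disk polynomials
  are eigenfunctions. The generating function carries the exponent 2 because the conformal factors
  of Jacobian, weight, kernel and generating function then cancel under an automorphism. In
  derivatives with respect to \<open>z\<close> and \<open>cnj z\<close>, the form \<open>k1\<close>,
  \<open>k2\<close> becomes \<open>2 * (k1 + k2)\<close> times the mixed second derivative plus
  \<open>k1 - k2\<close> times the two pure ones. The pure ones move \<open>(a, b)\<close> to
  \<open>(a - 1, b + 1)\<close> and \<open>(a + 1, b - 1)\<close>; this is the origin of the three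
  diagonals and of their quotient. The real basis only sees \<open>l = \<bar>a - b\<bar>\<close>, so
  the matrix appears folded at \<open>l = 0\<close>. There an index is reached in two ways, and the
  halved coefficients undo this. The raw weights \<open>l powr (2 * s1)\<close> and
  \<open>n powr (2 * s2)\<close> vanish at 0, so neighbouring weights in a block need not have a
  bounded quotient; this forces the detour through shifted weights.\<close>

lemma sum_choose_Suc:
  fixes f :: "nat \<Rightarrow> 'a::comm_ring_1"
  shows "(\<Sum>j\<le>Suc m. of_nat (Suc m choose j) * f j) = (\<Sum>j\<le>m. of_nat (m choose j) * (f j + f (Suc j)))"
proof -
  have eq: "(\<Sum>j\<le>Suc m. of_nat (Suc m choose j) * f j)
      = f 0 + (\<Sum>j\<le>m. of_nat (m choose j) * f (Suc j)) + (\<Sum>j\<le>m. of_nat (m choose Suc j) * f (Suc j))"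
    by (simp add: sum.atMost_Suc_shift sum.distrib algebra_simps del: sum.atMost_Suc)
  have "f 0 + (\<Sum>j\<le>m. of_nat (m choose Suc j) * f (Suc j)) = (\<Sum>j\<le>Suc m. of_nat (m choose j) * f j)"
    by (subst sum.atMost_Suc_shift) simp
  also have "\<dots> = (\<Sum>j\<le>m. of_nat (m choose j) * f j)" by (simp add: binomial_eq_0)
  finally show ?thesis unfolding eq by (simp add: sum.distrib algebra_simps)
qed

lemma of_nat_choose_Suc:
  "real (Suc k) * real (n choose Suc k) = (real n - real k) * real (n choose k)"
proof (cases "k \<le> n")
  case True
  have "Suc k * (n choose Suc k) = (n - k) * (n choose k)"
    by (metis binomial_absorb_comp binomial_absorption)
  then have "real (Suc k * (n choose Suc k)) = real ((n - k) * (n choose k))" by (rule arg_cong)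
  then show ?thesis using True by (simp only: of_nat_mult of_nat_diff)
qed (simp add: binomial_eq_0)

text \<open>The induction step is a telescoping sum (Zeilberger's algorithm with certificate \<open>H\<close>).\<close>

lemma Pfaff_Saalschuetz:
  fixes a b c :: real
  assumes "c \<notin> \<int>"
  shows "(\<Sum>j\<le>m. real (m choose j) * (pochhammer a j * pochhammer b j
           * pochhammer (c - a - b) (m - j) * pochhammer (c + real j) (m - j)))
         = pochhammer (c - a) m * pochhammer (c - b) m"
proof (induction m)
  case 0
  show ?case by simp
next
  case (Suc m)
  define e where "e = c - a - b"
  have nz: "c + real j \<noteq> 0" for j
    using assms by (metis Ints_minus Ints_of_nat add.commute add_eq_0_iff2 minus_minus)
  define p where "p j = pochhammer a j * pochhammer b j" for j
  have p_Suc: "p (Suc j) = (a + real j) * (b + real j) * p j" for j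
    by (simp add: p_def pochhammer_Suc)
  define T where "T j = real (m choose j) * (p j * pochhammer e (m - j) * pochhammer (c + real j) (m - j))" for j
  define H where "H j = (case j of 0 \<Rightarrow> 0
      | Suc i \<Rightarrow> (real m - real i) * (a + real i) * (b + real i) / (c + real i) * T i)" for j
  have poch_shift: "pochhammer (c + real j + 1) k = pochhammer (c + real j) k * (c + real j + real k) / (c + real j)" for j k
  proof -
    have "(c + real j) * pochhammer (c + real j + 1) k = pochhammer (c + real j) (Suc k)"
      by (simp add: pochhammer_rec)
    also have "\<dots> = pochhammer (c + real j) k * (c + real j + real k)"
      by (simp add: pochhammer_Suc)
    finally show ?thesis using nz[of j] by (simp add: field_simps)
  qed
  \<comment> \<open>Two expressions of \<open>H\<close> are needed: the definition writes
    \<open>H (Suc j)\<close> as a multiple of \<open>T j\<close>, this one writes \<open>H j\<close>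
    as a multiple of the same \<open>T j\<close>.\<close>
  have H_eq: "H j = real j * (e + real m - real j) * T j" if "j \<le> m" for j
  proof (cases j)
    case (Suc i)
    have i: "i < m" using that Suc by simp
    have e': "pochhammer e (m - i) = pochhammer e (m - Suc i) * (e + real m - real (Suc i))"
    proof -
      have "m - i = Suc (m - Suc i)" using i by simp
      moreover have "real (m - Suc i) = real m - real (Suc i)" using i by (intro of_nat_diff) simp
      ultimately show ?thesis by (simp only: pochhammer_Suc add_diff_eq)
    qed
    have "pochhammer (c + real i) (m - i) = (c + real i) * pochhammer (c + real (Suc i)) (m - Suc i)"
    proof -
      have "m - i = Suc (m - Suc i)" using i by simp
      moreover have "c + real i + 1 = c + real (Suc i)" by simp
      ultimately show ?thesis by (simp only: pochhammer_rec)
    qed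
    then have "H j = (real m - real i) * real (m choose i) * ((a + real i) * (b + real i) * p i)
        * pochhammer e (m - Suc i) * (e + real m - real (Suc i)) * pochhammer (c + real (Suc i)) (m - Suc i)"
      using nz[of i] by (simp add: H_def Suc T_def e')
    also have "\<dots> = real j * (e + real m - real j) * T j"
      unfolding of_nat_choose_Suc[symmetric] by (simp add: T_def Suc p_Suc)
    finally show ?thesis .
  qed (simp add: H_def)
  have "(\<Sum>j\<le>Suc m. real (Suc m choose j) * (pochhammer a j * pochhammer b j
           * pochhammer (c - a - b) (Suc m - j) * pochhammer (c + real j) (Suc m - j)))
     = (\<Sum>j\<le>m. real (m choose j) * (p j * pochhammer e (Suc m - j) * pochhammer (c + real j) (Suc m - j)
           + p (Suc j) * pochhammer e (m - j) * pochhammer (c + real j + 1) (m - j)))"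
    unfolding sum_choose_Suc by (simp add: p_def e_def add.assoc add.commute[of 1])
  also have "\<dots> = (\<Sum>j\<le>m. (c - a + real m) * (c - b + real m) * T j + (H (Suc j) - H j))"
  proof (rule sum.cong[OF refl])
    fix j assume "j \<in> {..m}"
    then have j: "j \<le> m" by simp
    have 1: "pochhammer e (Suc m - j) = pochhammer e (m - j) * (e + real m - real j)"
      and 2: "pochhammer (c + real j) (Suc m - j) = pochhammer (c + real j) (m - j) * (c + real m)"
      using j by (simp_all add: Suc_diff_le pochhammer_Suc of_nat_diff add_diff_eq)
    have 3: "pochhammer (c + real j + 1) (m - j) = pochhammer (c + real j) (m - j) * (c + real m) / (c + real j)"
      using j by (subst poch_shift) (simp add: of_nat_diff)
    have "real (m choose j) * (p j * pochhammer e (Suc m - j) * pochhammer (c + real j) (Suc m - j)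
           + p (Suc j) * pochhammer e (m - j) * pochhammer (c + real j + 1) (m - j))
       = T j * ((e + real m - real j) * (c + real m) + (a + real j) * (b + real j) * (c + real m) / (c + real j))"
      unfolding T_def 1 2 3 p_Suc divide_inverse by (simp add: algebra_simps)
    \<comment> \<open>With \<open>T j\<close> divided out, the telescoping property is a rational
      identity, free of Pochhammer symbols.\<close>
    also have "(e + real m - real j) * (c + real m) + (a + real j) * (b + real j) * (c + real m) / (c + real j)
       = (c - a + real m) * (c - b + real m) + ((real m - real j) * (a + real j) * (b + real j) / (c + real j)
          - real j * (e + real m - real j))"
      unfolding e_def using nz[of j] by (simp add: divide_simps) algebra
    also have "T j * \<dots> = (c - a + real m) * (c - b + real m) * T j + (H (Suc j) - H j)"
      unfolding H_eq[OF j] by (simp add: H_def algebra_simps)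
    finally show "real (m choose j) * (p j * pochhammer e (Suc m - j) * pochhammer (c + real j) (Suc m - j)
           + p (Suc j) * pochhammer e (m - j) * pochhammer (c + real j + 1) (m - j))
       = (c - a + real m) * (c - b + real m) * T j + (H (Suc j) - H j)" .
  qed
  also have "\<dots> = (c - a + real m) * (c - b + real m) * (\<Sum>j\<le>m. T j) + (H (Suc m) - H 0)"
    using sum_telescope[of H m] by (simp add: sum.distrib sum_distrib_left sum_subtractf)
  also have "H (Suc m) - H 0 = 0" by (simp add: H_def)
  also have "(\<Sum>j\<le>m. T j) = pochhammer (c - a) m * pochhammer (c - b) m"
    using Suc.IH by (simp add: T_def p_def e_def)
  finally show ?case by (simp add: pochhammer_Suc)
qed

text \<open>Disk polynomials in a scaling where the Gamma factor depends on
  \<open>\<sigma> + a + b\<close> only. Both derivative formulas move \<open>\<sigma>\<close> and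
  one index in opposite directions, so this sum is preserved and their constants stay simple. The
  binomials vanish for \<open>j\<close> above \<open>min a b\<close>, which keeps the truncated
  exponents of \<open>zernike\<close> harmless.\<close>

definition zernike_coeff :: "real \<Rightarrow> nat \<Rightarrow> nat \<Rightarrow> nat \<Rightarrow> real" where
  "zernike_coeff \<sigma> a b j = (- 1) ^ j * fact j * real (a choose j) * real (b choose j)
     * Gamma (\<sigma> + real a + real b - real j + 1)"

definition zernike :: "real \<Rightarrow> nat \<Rightarrow> nat \<Rightarrow> complex \<Rightarrow> complex" where
  "zernike \<sigma> a b z = (\<Sum>j\<le>a. of_real (zernike_coeff \<sigma> a b j) * z ^ (a - j) * cnj z ^ (b - j))"

lemma zernike_coeff_commute: "zernike_coeff \<sigma> a b j = zernike_coeff \<sigma> b a j"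
  by (simp add: zernike_coeff_def algebra_simps)

lemma zernike_coeff_eq_0: "a < j \<or> b < j \<Longrightarrow> zernike_coeff \<sigma> a b j = 0"
  by (auto simp: zernike_coeff_def binomial_eq_0)

text \<open>The coefficients vanish beyond \<open>min a b\<close>, so a bound above either index
  will do; this is what makes the two indices interchangeable.\<close>

lemma zernike_upto:
  assumes "a \<le> M \<or> b \<le> M"
  shows "zernike \<sigma> a b z = (\<Sum>j\<le>M. of_real (zernike_coeff \<sigma> a b j) * z ^ (a - j) * cnj z ^ (b - j))"
proof -
  have "zernike \<sigma> a b z = (\<Sum>j\<le>a + M. of_real (zernike_coeff \<sigma> a b j) * z ^ (a - j) * cnj z ^ (b - j))"
    unfolding zernike_def by (rule sum.mono_neutral_left) (auto simp: zernike_coeff_eq_0)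
  also have "\<dots> = (\<Sum>j\<le>M. of_real (zernike_coeff \<sigma> a b j) * z ^ (a - j) * cnj z ^ (b - j))"
    using assms by (intro sum.mono_neutral_right) (auto simp: zernike_coeff_eq_0)
  finally show ?thesis .
qed

lemma cnj_zernike: "cnj (zernike \<sigma> a b z) = zernike \<sigma> b a z"
proof -
  have "cnj (zernike \<sigma> a b z) = (\<Sum>j\<le>a. of_real (zernike_coeff \<sigma> b a j) * z ^ (b - j) * cnj z ^ (a - j))"
    unfolding zernike_def by (simp add: zernike_coeff_commute[of \<sigma> a b] mult_ac)
  also have "\<dots> = zernike \<sigma> b a z" by (rule zernike_upto[symmetric]) simp
  finally show ?thesis .
qed

text \<open>The right side is the termwise derivative in \<open>z\<close>. The prefactor
  \<open>a\<close> keeps the formula true at \<open>a = 0\<close>, where \<open>a - 1\<close> is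
  truncated.\<close>

lemma zernike_deriv_expand:
  "of_nat a * zernike (\<sigma> + 1) (a - 1) b z
     = (\<Sum>j\<le>a + b. of_real (zernike_coeff \<sigma> a b j) * of_nat (a - j) * z ^ (a - j - 1) * cnj z ^ (b - j))"
proof (cases a)
  case 0
  show ?thesis by (simp add: 0)
next
  case (Suc c)
  have eq: "real a * zernike_coeff (\<sigma> + 1) (a - 1) b j = zernike_coeff \<sigma> a b j * real (a - j)" for j
  proof (cases "j \<le> c")
    case True
    have "real a * real (a - 1 choose j) = real (a - j) * real (a choose j)"
      using True Suc by (metis binomial_absorb_comp of_nat_mult diff_Suc_1)
    moreover have "\<sigma> + 1 + real (a - 1) + real b - real j + 1 = \<sigma> + real a + real b - real j + 1"
      by (simp add: Suc)
    ultimately show ?thesis by (simp add: zernike_coeff_def mult_ac)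
  next
    case False
    then show ?thesis using Suc by (auto simp: zernike_coeff_eq_0)
  qed
  have "of_nat a * zernike (\<sigma> + 1) (a - 1) b z
     = (\<Sum>j\<le>a + b. of_real (real a * zernike_coeff (\<sigma> + 1) (a - 1) b j) * z ^ (a - 1 - j) * cnj z ^ (b - j))"
    by (subst zernike_upto[of _ "a + b"]) (auto simp: sum_distrib_left mult_ac)
  then show ?thesis unfolding eq by (simp add: diff_commute)
qed

text \<open>This is the derivative in \<open>z\<close> of
  \<open>(1 - z * cnj z) powr s * zernike s a b z\<close>, divided by
  \<open>(1 - z * cnj z) powr (s - 1)\<close>: the product rule on the left, the raised index
  \<open>b\<close> on the right.\<close>

lemma zernike_weight_deriv:
  assumes "0 < s"
  shows "(1 - z * cnj z) * (of_nat a * zernike (s + 1) (a - 1) b z) - of_real s * cnj z * zernike s a b z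
     = - of_real (s + real a) * zernike (s - 1) a (Suc b) z"
proof -
  let ?c = "\<lambda>j. complex_of_real (zernike_coeff s a b j)"
  let ?c' = "\<lambda>j. complex_of_real (zernike_coeff (s - 1) a (Suc b) j)"
  \<comment> \<open>Comparison of the coefficients of
    \<open>z ^ (a - Suc j) * cnj z ^ (b - j)\<close>. After the absorption identities for both
    binomials it comes down to Pascal's rule for \<open>Suc b choose Suc j\<close>.\<close>
  have rel: "zernike_coeff s a b j * real (a - j) - (real a - real j - 1 + s) * zernike_coeff s a b (Suc j)
      = - (s + real a) * zernike_coeff (s - 1) a (Suc b) (Suc j)" for j
  proof (cases "j \<le> a")
    case True
    define A B B1 G where "A = real (a choose j)" and "B = real (b choose j)" and "B1 = real (b choose Suc j)"
      and "G = Gamma (s + real a + real b - real j)"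
    have G: "Gamma (s + real a + real b - real j + 1) = (s + real a + real b - real j) * G"
      unfolding G_def using assms True by (intro Gamma_plus1) (auto elim!: nonpos_Ints_cases)
    have a1: "real (Suc j) * real (a choose Suc j) = (real a - real j) * A"
      unfolding A_def by (rule of_nat_choose_Suc)
    have b1: "real (Suc j) * B1 = (real b - real j) * B"
      unfolding B_def B1_def by (rule of_nat_choose_Suc)
    define F where "F = (-1) ^ j * (fact j :: real)"
    have c1: "zernike_coeff s a b j = F * A * B * ((s + real a + real b - real j) * G)"
      unfolding zernike_coeff_def A_def B_def G F_def ..
    have c2: "zernike_coeff s a b (Suc j) = - (F * (real (Suc j) * real (a choose Suc j)) * B1 * G)"
      unfolding zernike_coeff_def B1_def G_def F_def by (simp add: algebra_simps)
    have c3: "zernike_coeff (s - 1) a (Suc b) (Suc j) = - (F * (real (Suc j) * real (a choose Suc j)) * (B + B1) * G)"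
      unfolding zernike_coeff_def B1_def B_def G_def F_def by (simp add: algebra_simps)
    have "B * (s + real a + real b - real j) + (real a - real j - 1 + s) * B1 = (s + real a) * (B + B1)"
      using b1 by (simp add: algebra_simps)
    then have "F * A * G * (real a - real j) * (B * (s + real a + real b - real j) + (real a - real j - 1 + s) * B1)
        = F * A * G * (real a - real j) * ((s + real a) * (B + B1))" by (rule arg_cong)
    moreover have "real (a - j) = real a - real j" using True by (rule of_nat_diff)
    ultimately show ?thesis unfolding c1 c2 c3 a1 by algebra
  qed (simp add: zernike_coeff_eq_0)
  have 1: "of_nat a * zernike (s + 1) (a - 1) b z
     = (\<Sum>j\<le>a + b. ?c j * of_nat (a - j) * z ^ (a - Suc j) * cnj z ^ (Suc b - Suc j))"
    unfolding zernike_deriv_expand by simp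
  have 2: "z * cnj z * (of_nat a * zernike (s + 1) (a - 1) b z)
     = (\<Sum>j\<le>a + b. ?c j * of_nat (a - j) * z ^ (a - j) * cnj z ^ (Suc b - j))"
    unfolding zernike_deriv_expand sum_distrib_left
  proof (rule sum.cong[OF refl])
    fix j assume "j \<in> {..a + b}"
    show "z * cnj z * (?c j * of_nat (a - j) * z ^ (a - j - 1) * cnj z ^ (b - j))
      = ?c j * of_nat (a - j) * z ^ (a - j) * cnj z ^ (Suc b - j)"
    proof (cases "j < a \<and> j \<le> b")
      case True
      then have "a - j = Suc (a - j - 1)" "Suc b - j = Suc (b - j)" by auto
      then have "z ^ (a - j) = z * z ^ (a - j - 1)" "cnj z ^ (Suc b - j) = cnj z * cnj z ^ (b - j)"
        by (metis power_Suc)+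
      then show ?thesis by (simp add: mult_ac)
    next
      case False
      then show ?thesis by (auto simp: zernike_coeff_eq_0 not_less not_le)
    qed
  qed
  have 3: "cnj z * zernike s a b z = (\<Sum>j\<le>a + b. ?c j * z ^ (a - j) * cnj z ^ (Suc b - j))"
    unfolding zernike_upto[of a "a + b" b, simplified] sum_distrib_left
  proof (rule sum.cong[OF refl])
    fix j assume "j \<in> {..a + b}"
    show "cnj z * (?c j * z ^ (a - j) * cnj z ^ (b - j)) = ?c j * z ^ (a - j) * cnj z ^ (Suc b - j)"
      by (cases "j \<le> b") (auto simp: Suc_diff_le zernike_coeff_eq_0)
  qed
  have "z * cnj z * (of_nat a * zernike (s + 1) (a - 1) b z) + of_real s * (cnj z * zernike s a b z)
     = (\<Sum>j\<le>a + b. of_real ((real (a - j) + s) * zernike_coeff s a b j) * z ^ (a - j) * cnj z ^ (Suc b - j))"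
    unfolding 2 3 sum_distrib_left sum.distrib[symmetric]
    by (rule sum.cong) (simp_all add: algebra_simps)
  \<comment> \<open>Padding with a zero term lets the sum be split at 0 and shifted by one, so that
    it lines up with the unshifted terms.\<close>
  also have "\<dots> = (\<Sum>j\<le>Suc (a + b). of_real ((real (a - j) + s) * zernike_coeff s a b j) * z ^ (a - j) * cnj z ^ (Suc b - j))"
    by (simp add: zernike_coeff_eq_0)
  finally have 5: "z * cnj z * (of_nat a * zernike (s + 1) (a - 1) b z) + of_real s * (cnj z * zernike s a b z)
     = of_real ((real a + s) * zernike_coeff s a b 0) * z ^ a * cnj z ^ Suc b
      + (\<Sum>j\<le>a + b. of_real ((real (a - Suc j) + s) * zernike_coeff s a b (Suc j)) * z ^ (a - Suc j) * cnj z ^ (Suc b - Suc j))"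
    by (subst (asm) sum.atMost_Suc_shift) simp
  have 6: "zernike (s - 1) a (Suc b) z = ?c' 0 * z ^ a * cnj z ^ Suc b
      + (\<Sum>j\<le>a + b. ?c' (Suc j) * z ^ (a - Suc j) * cnj z ^ (Suc b - Suc j))"
    by (subst zernike_upto[of _ "Suc (a + b)"], simp, subst sum.atMost_Suc_shift, simp)
  have 7: "(\<Sum>j\<le>a + b. ?c j * of_nat (a - j) * z ^ (a - Suc j) * cnj z ^ (Suc b - Suc j))
      - (\<Sum>j\<le>a + b. of_real ((real (a - Suc j) + s) * zernike_coeff s a b (Suc j)) * z ^ (a - Suc j) * cnj z ^ (Suc b - Suc j))
    = - of_real (s + real a) * (\<Sum>j\<le>a + b. ?c' (Suc j) * z ^ (a - Suc j) * cnj z ^ (Suc b - Suc j))"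
    unfolding sum_distrib_left sum_subtractf[symmetric]
  proof (rule sum.cong[OF refl])
    fix j
    have "?c j * of_nat (a - j) - of_real ((real (a - Suc j) + s) * zernike_coeff s a b (Suc j))
        = - of_real (s + real a) * ?c' (Suc j)"
    proof -
      have "(real (a - Suc j) + s) * zernike_coeff s a b (Suc j) = (real a - real j - 1 + s) * zernike_coeff s a b (Suc j)"
      proof (cases "j < a")
        case True
        then have "real (a - Suc j) = real a - real j - 1" by (simp add: of_nat_diff)
        then show ?thesis by (simp only:)
      qed (simp add: zernike_coeff_eq_0)
      then have "zernike_coeff s a b j * real (a - j) - (real (a - Suc j) + s) * zernike_coeff s a b (Suc j)
          = - (s + real a) * zernike_coeff (s - 1) a (Suc b) (Suc j)"
        using rel[of j] by (simp only:)
      then show ?thesis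
        by (auto dest: arg_cong[of _ _ complex_of_real] simp only: of_real_mult of_real_of_nat_eq of_real_diff of_real_minus)
    qed
    then have "(?c j * of_nat (a - j) - of_real ((real (a - Suc j) + s) * zernike_coeff s a b (Suc j))) * (z ^ (a - Suc j) * cnj z ^ (Suc b - Suc j))
        = - of_real (s + real a) * ?c' (Suc j) * (z ^ (a - Suc j) * cnj z ^ (Suc b - Suc j))"
      by simp
    then show "?c j * of_nat (a - j) * z ^ (a - Suc j) * cnj z ^ (Suc b - Suc j)
       - of_real ((real (a - Suc j) + s) * zernike_coeff s a b (Suc j)) * z ^ (a - Suc j) * cnj z ^ (Suc b - Suc j)
      = - of_real (s + real a) * (?c' (Suc j) * z ^ (a - Suc j) * cnj z ^ (Suc b - Suc j))"
      by (simp only: left_diff_distrib mult.assoc)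
  qed
  have 8: "zernike_coeff (s - 1) a (Suc b) 0 = zernike_coeff s a b 0"
    by (simp add: zernike_coeff_def algebra_simps)
  have "(1 - z * cnj z) * (of_nat a * zernike (s + 1) (a - 1) b z) - of_real s * cnj z * zernike s a b z
    = of_nat a * zernike (s + 1) (a - 1) b z
      - (z * cnj z * (of_nat a * zernike (s + 1) (a - 1) b z) + of_real s * (cnj z * zernike s a b z))"
    by (simp add: algebra_simps)
  also have "\<dots> = - of_real (s + real a) * zernike (s - 1) a (Suc b) z"
    unfolding 5 unfolding 6 distrib_left 7[symmetric] 8 unfolding 1 by (simp add: algebra_simps)
  finally show ?thesis .
qed

text \<open>The coefficients agree by the Chu-Vandermonde identity.\<close>

lemma jacobi_poly_power_sum:
  "jacobi_poly n \<sigma> (real l) (2 * t - 1)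
     = (\<Sum>j\<le>n. (-1) ^ j * real ((n + l) choose j) * ((\<sigma> + 2 * real n + real l - real j) gchoose (n - j)) * t ^ (n - j))"
proof -
  define v where "v j = (-1) ^ j * real ((n + l) choose j) * ((\<sigma> + 2 * real n + real l - real j) gchoose (n - j))" for j
  have "jacobi_poly n \<sigma> (real l) (2 * t - 1)
     = (\<Sum>k\<le>n. \<Sum>j\<le>n. ((real n + \<sigma>) gchoose (n - k)) * ((real n + real l) gchoose k) * (real (k choose j) * (-1) ^ j * t ^ (n - j)))"
    unfolding jacobi_poly_def
  proof (rule sum.cong[OF refl])
    fix k assume "k \<in> {..n}"
    then have k: "k \<le> n" by simp
    have "(t - 1) ^ k * t ^ (n - k) = (\<Sum>j\<le>k. real (k choose j) * (-1) ^ j * t ^ (k - j)) * t ^ (n - k)"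
      using binomial_ring[of "-1" t k] by (simp add: add.commute)
    also have "\<dots> = (\<Sum>j\<le>k. real (k choose j) * (-1) ^ j * t ^ (n - j))"
      unfolding sum_distrib_right using k by (intro sum.cong) (auto simp flip: power_add simp: mult.assoc)
    also have "\<dots> = (\<Sum>j\<le>n. real (k choose j) * (-1) ^ j * t ^ (n - j))"
      using k by (intro sum.mono_neutral_left) auto
    finally show "((real n + \<sigma>) gchoose (n - k)) * ((real n + real l) gchoose k) * ((2 * t - 1 - 1) / 2) ^ k * ((2 * t - 1 + 1) / 2) ^ (n - k)
      = (\<Sum>j\<le>n. ((real n + \<sigma>) gchoose (n - k)) * ((real n + real l) gchoose k) * (real (k choose j) * (-1) ^ j * t ^ (n - j)))"
      by (simp add: sum_distrib_left[symmetric] diff_divide_distrib mult.assoc)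
  qed
  also have "\<dots> = (\<Sum>j\<le>n. v j * t ^ (n - j))"
  proof (subst sum.swap, rule sum.cong[OF refl])
    fix j assume "j \<in> {..n}"
    then have j: "j \<le> n" by simp
    have "(\<Sum>k\<le>n. ((real n + \<sigma>) gchoose (n - k)) * ((real n + real l) gchoose k) * real (k choose j))
       = (\<Sum>k=j..n. ((real n + \<sigma>) gchoose (n - k)) * ((real n + real l) gchoose k) * real (k choose j))"
      by (rule sum.mono_neutral_right) auto
    also have "\<dots> = (\<Sum>i\<le>n - j. ((real n + \<sigma>) gchoose (n - (i + j))) * ((real n + real l) gchoose (i + j)) * real ((i + j) choose j))"
      using j by (intro sum.reindex_bij_witness[of _ "\<lambda>i. i + j" "\<lambda>k. k - j"]) auto
    also have "\<dots> = (\<Sum>i\<le>n - j. real ((n + l) choose j) * (((real n + real l - real j) gchoose i) * ((real n + \<sigma>) gchoose (n - j - i))))"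
    proof (rule sum.cong[OF refl])
      fix i
      have "((real n + real l) gchoose (i + j)) * real ((i + j) choose j) = ((real n + real l) gchoose j) * ((real n + real l - real j) gchoose i)"
        using gbinomial_trinomial_revision[of j "i + j" "real n + real l"]
        by (simp add: binomial_gbinomial)
      also have "(real n + real l) gchoose j = real ((n + l) choose j)"
        by (simp add: binomial_gbinomial)
      finally show "((real n + \<sigma>) gchoose (n - (i + j))) * ((real n + real l) gchoose (i + j)) * real ((i + j) choose j)
         = real ((n + l) choose j) * (((real n + real l - real j) gchoose i) * ((real n + \<sigma>) gchoose (n - j - i)))"
        by (simp add: mult_ac add.commute)
    qed
    also have "\<dots> = real ((n + l) choose j) * ((\<sigma> + 2 * real n + real l - real j) gchoose (n - j))"
      unfolding sum_distrib_left[symmetric] atMost_atLeast0 gbinomial_Vandermonde by (simp add: algebra_simps)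
    finally show "(\<Sum>k\<le>n. ((real n + \<sigma>) gchoose (n - k)) * ((real n + real l) gchoose k) * (real (k choose j) * (-1) ^ j * t ^ (n - j)))
        = v j * t ^ (n - j)"
      by (simp add: v_def mult.assoc[symmetric] sum_distrib_right[symmetric])
  qed
  finally show ?thesis unfolding v_def .
qed

text \<open>With \<open>t = (cmod z)\<^sup>2\<close>, the term \<open>z ^ l * t ^ (n - j)\<close> is
  the monomial \<open>z ^ (n + l - j) * cnj z ^ (n - j)\<close>, and the quotient of the two
  coefficients does not depend on \<open>j\<close>.\<close>

lemma jacobi_poly_eq_zernike:
  assumes "-1 < \<sigma>"
  shows "z ^ l * of_real (jacobi_poly n \<sigma> (real l) (2 * (cmod z)\<^sup>2 - 1))
     = zernike \<sigma> (n + l) n z / of_real (fact n * Gamma (\<sigma> + real n + real l + 1))"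
proof -
  define t where "t = (cmod z)\<^sup>2"
  define v where "v j = (-1) ^ j * real ((n + l) choose j) * ((\<sigma> + 2 * real n + real l - real j) gchoose (n - j))" for j
  have jac: "jacobi_poly n \<sigma> (real l) (2 * t - 1) = (\<Sum>j\<le>n. v j * t ^ (n - j))"
    unfolding v_def by (rule jacobi_poly_power_sum)
  have coeff: "v j * (fact n * Gamma (\<sigma> + real n + real l + 1)) = zernike_coeff \<sigma> (n + l) n j" if j: "j \<le> n" for j
  proof -
    have pos: "\<sigma> + real n + real l + 1 > 0" using assms by linarith
    have G0: "Gamma (\<sigma> + real n + real l + 1) \<noteq> 0" using Gamma_real_pos[OF pos] by simp
    have "((\<sigma> + 2 * real n + real l - real j) gchoose (n - j)) = pochhammer (\<sigma> + real n + real l + 1) (n - j) / fact (n - j)"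
      using j by (simp add: gbinomial_pochhammer' of_nat_diff algebra_simps)
    also have "pochhammer (\<sigma> + real n + real l + 1) (n - j) = Gamma (\<sigma> + real n + real l + 1 + real (n - j)) / Gamma (\<sigma> + real n + real l + 1)"
      using pos by (intro pochhammer_Gamma) (auto elim!: nonpos_Ints_cases)
    finally have "((\<sigma> + 2 * real n + real l - real j) gchoose (n - j)) * (fact n * Gamma (\<sigma> + real n + real l + 1))
       = fact n / fact (n - j) * Gamma (\<sigma> + real (n + l) + real n - real j + 1)"
      using G0 j by (simp add: of_nat_diff algebra_simps)
    also have "fact n / fact (n - j) = (fact j * real (n choose j) :: real)"
      using j by (simp add: binomial_fact)
    finally show ?thesis unfolding v_def zernike_coeff_def by (simp add: mult_ac)
  qed
  have pos: "Gamma (\<sigma> + real n + real l + 1) > 0" using assms by (intro Gamma_real_pos) linarith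
  have "z ^ l * of_real (jacobi_poly n \<sigma> (real l) (2 * t - 1)) * of_real (fact n * Gamma (\<sigma> + real n + real l + 1))
     = (\<Sum>j\<le>n. of_real (v j * (fact n * Gamma (\<sigma> + real n + real l + 1))) * (z ^ l * of_real t ^ (n - j)))"
    unfolding jac by (simp add: sum_distrib_left sum_distrib_right mult_ac)
  also have "\<dots> = (\<Sum>j\<le>n. of_real (zernike_coeff \<sigma> (n + l) n j) * z ^ (n + l - j) * cnj z ^ (n - j))"
  proof (rule sum.cong[OF refl])
    fix j assume "j \<in> {..n}"
    then have j: "j \<le> n" by simp
    have "z ^ l * of_real t ^ (n - j) = z ^ (n + l - j) * cnj z ^ (n - j)"
      using j unfolding t_def complex_norm_square power_mult_distrib
      by (simp flip: power_add mult.assoc add: add.commute)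
    then show "of_real (v j * (fact n * Gamma (\<sigma> + real n + real l + 1))) * (z ^ l * of_real t ^ (n - j))
       = of_real (zernike_coeff \<sigma> (n + l) n j) * z ^ (n + l - j) * cnj z ^ (n - j)"
      unfolding coeff[OF j] by (simp only: mult.assoc)
  qed
  also have "\<dots> = zernike \<sigma> (n + l) n z"
    by (rule zernike_upto[symmetric]) simp
  finally show ?thesis using pos unfolding t_def
    by (simp add: field_simps del: of_real_mult)
qed

text \<open>Up to the factor \<open>pi * Gamma s * Gamma (1 - s)\<close>, the integral of a monomial
  against the weighted Riesz kernel. The summand is a product of coefficients of three binomial
  series: one for \<open>(1 - (cmod w)\<^sup>2) powr (s - 1)\<close> and one for each of the two
  conjugate factors of the kernel term.\<close>

definition riesz_monomial :: "real \<Rightarrow> nat \<Rightarrow> nat \<Rightarrow> complex \<Rightarrow> complex" where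
  "riesz_monomial s a b z = (\<Sum>k\<le>min a b. of_real (pochhammer (1 - s) k / fact k
      * (pochhammer s (a - k) / fact (a - k)) * (pochhammer s (b - k) / fact (b - k)))
      * z ^ (a - k) * cnj z ^ (b - k))"

text \<open>The left side is what the potential makes of the coefficient of
  \<open>z ^ (a - m) * cnj z ^ (b - m)\<close>; on the right stands the old coefficient times a
  factor independent of \<open>m\<close>, the eigenvalue. The sum is a terminating balanced
  hypergeometric sum with upper parameters \<open>- a\<close>, \<open>- b\<close>, so the
  Pfaff-Saalschuetz identity evaluates it.\<close>

lemma zernike_coeff_convolution:
  assumes "0 < s" "s < 1" "m \<le> a" "m \<le> b"
  shows "(\<Sum>j\<le>m. zernike_coeff (s - 1) a b j * (pochhammer (1 - s) (m - j) / fact (m - j)))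
      * (pochhammer s (a - m) / fact (a - m) * (pochhammer s (b - m) / fact (b - m)))
    = pochhammer s a * pochhammer s b / (fact a * fact b) * zernike_coeff (s - 1) a b m"
proof -
  \<comment> \<open>This lower parameter is not an integer because \<open>0 < s < 1\<close>, as the
    summation formula requires.\<close>
  define c where "c = s - real m"
  define G where "G = Gamma (s + real a + real b - real m)"
  have c: "c \<notin> \<int>"
  proof
    assume "c \<in> \<int>"
    then have "s \<in> \<int>" unfolding c_def by (metis Ints_add Ints_of_nat diff_add_cancel)
    then show False using assms(1,2) by (auto elim!: Ints_cases)
  qed
  have pm: "pochhammer (- real n) j = (-1) ^ j * (fact n / fact (n - j))" if "j \<le> n" for n j
  proof -
    have "fact n = fact (n - j) * pochhammer (real n - real j + 1) j"
      using pochhammer_product'[of "1::real" "n - j" j] that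
      by (simp add: pochhammer_fact of_nat_diff algebra_simps)
    then show ?thesis by (simp add: pochhammer_minus)
  qed
  have summand: "zernike_coeff (s - 1) a b j * (pochhammer (1 - s) (m - j) / fact (m - j))
     = (-1) ^ m * G / fact m * (real (m choose j) * (pochhammer (- real a) j * pochhammer (- real b) j
           * pochhammer (c - (- real a) - (- real b)) (m - j) * pochhammer (c + real j) (m - j)))"
    if "j \<le> m" for j
  proof -
    have ja: "j \<le> a" and jb: "j \<le> b" using that assms by auto
    have pos: "s + real a + real b - real m > 0" using assms by linarith
    have "pochhammer (s + real a + real b - real m) (m - j)
        = Gamma (s + real a + real b - real m + real (m - j)) / G"
      unfolding G_def using pos by (intro pochhammer_Gamma) (auto elim!: nonpos_Ints_cases)
    then have G1: "Gamma (s + real a + real b - real j) = G * pochhammer (c - (- real a) - (- real b)) (m - j)"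
      using Gamma_real_pos[OF pos] that by (simp add: G_def c_def of_nat_diff algebra_simps)
    have "pochhammer (c + real j) (m - j) = (-1) ^ (m - j) * pochhammer (1 - s) (m - j)"
      using pochhammer_minus'[of "s - 1" "m - j"] that
      by (simp add: c_def of_nat_diff algebra_simps)
    then have p1: "pochhammer (1 - s) (m - j) = (-1) ^ m * (-1) ^ j * pochhammer (c + real j) (m - j)"
      using that by (simp add: minus_one_power_iff split: if_splits)
    have z0: "zernike_coeff (s - 1) a b j = (-1) ^ j * fact j * (fact a / (fact j * fact (a - j))) * (fact b / (fact j * fact (b - j)))
        * (G * pochhammer (c - (- real a) - (- real b)) (m - j))"
      unfolding zernike_coeff_def G1[symmetric] binomial_fact[OF ja] binomial_fact[OF jb] by (simp add: algebra_simps)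
    show ?thesis
      unfolding z0 p1 pm[OF ja] pm[OF jb] binomial_fact[OF that]
      by (simp add: field_simps)
  qed
  \<comment> \<open>The summation formula supplies exactly the last \<open>m\<close> factors missing
    from \<open>pochhammer s (a - m)\<close> and \<open>pochhammer s (b - m)\<close>.\<close>
  have poch_split: "pochhammer s n = pochhammer s (n - m) * pochhammer (c - (- real n)) m" if "m \<le> n" for n
    using pochhammer_product'[of s "n - m" m] that by (simp add: c_def of_nat_diff algebra_simps)
  have "(\<Sum>j\<le>m. zernike_coeff (s - 1) a b j * (pochhammer (1 - s) (m - j) / fact (m - j)))
     = (-1) ^ m * G / fact m * (\<Sum>j\<le>m. real (m choose j) * (pochhammer (- real a) j * pochhammer (- real b) j
           * pochhammer (c - (- real a) - (- real b)) (m - j) * pochhammer (c + real j) (m - j)))"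
    unfolding sum_distrib_left by (intro sum.cong refl summand) simp
  also have "\<dots> = (-1) ^ m * G / fact m * (pochhammer (c - (- real a)) m * pochhammer (c - (- real b)) m)"
    unfolding Pfaff_Saalschuetz[OF c] ..
  finally have "(\<Sum>j\<le>m. zernike_coeff (s - 1) a b j * (pochhammer (1 - s) (m - j) / fact (m - j)))
      * (pochhammer s (a - m) / fact (a - m) * (pochhammer s (b - m) / fact (b - m)))
    = (-1) ^ m * G / fact m * (pochhammer s a * pochhammer s b) / (fact (a - m) * fact (b - m))"
    unfolding poch_split[OF assms(3)] poch_split[OF assms(4)] by (simp add: field_simps)
  also have "\<dots> = pochhammer s a * pochhammer s b / (fact a * fact b) * zernike_coeff (s - 1) a b m"
    unfolding zernike_coeff_def binomial_fact[OF assms(3)] binomial_fact[OF assms(4)] G_def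
    by (simp add: field_simps)
  finally show ?thesis .
qed

text \<open>Applied monomial by monomial and regrouped by \<open>m = j + k\<close>, the map turns
  each coefficient into the convolution above; hence the polynomial is reproduced up to a
  scalar.\<close>

lemma zernike_riesz_monomial:
  assumes "0 < s" "s < 1"
  shows "(\<Sum>j\<le>a. of_real (zernike_coeff (s - 1) a b j) * riesz_monomial s (a - j) (b - j) z)
    = of_real (pochhammer s a * pochhammer s b / (fact a * fact b)) * zernike (s - 1) a b z"
proof -
  define M where "M = min a b"
  define r where "r m = pochhammer s (a - m) / fact (a - m) * (pochhammer s (b - m) / fact (b - m))" for m
  define q where "q k = pochhammer (1 - s) k / fact k" for k
  have "(\<Sum>j\<le>a. of_real (zernike_coeff (s - 1) a b j) * riesz_monomial s (a - j) (b - j) z)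
    = (\<Sum>j\<le>M. of_real (zernike_coeff (s - 1) a b j) * riesz_monomial s (a - j) (b - j) z)"
    unfolding M_def by (rule sum.mono_neutral_right) (auto simp: zernike_coeff_eq_0)
  also have "\<dots> = (\<Sum>j\<le>M. \<Sum>k\<le>M - j. of_real (zernike_coeff (s - 1) a b j * q k * r (j + k)) * z ^ (a - (j + k)) * cnj z ^ (b - (j + k)))"
  proof (rule sum.cong[OF refl])
    fix j assume "j \<in> {..M}"
    have "min (a - j) (b - j) = M - j" by (auto simp: M_def)
    then show "of_real (zernike_coeff (s - 1) a b j) * riesz_monomial s (a - j) (b - j) z
      = (\<Sum>k\<le>M - j. of_real (zernike_coeff (s - 1) a b j * q k * r (j + k)) * z ^ (a - (j + k)) * cnj z ^ (b - (j + k)))"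
      by (simp add: riesz_monomial_def sum_distrib_left q_def r_def mult.assoc)
  qed
  also have "\<dots> = (\<Sum>(j, k)\<in>{(j, k). j + k \<le> M}. of_real (zernike_coeff (s - 1) a b j * q k * r (j + k)) * z ^ (a - (j + k)) * cnj z ^ (b - (j + k)))"
    by (subst sum.Sigma) (auto intro!: sum.cong)
  also have "\<dots> = (\<Sum>m\<le>M. \<Sum>j\<le>m. of_real (zernike_coeff (s - 1) a b j * q (m - j) * r (j + (m - j))) * z ^ (a - (j + (m - j))) * cnj z ^ (b - (j + (m - j))))"
    by (rule sum.triangle_reindex_eq)
  also have "\<dots> = (\<Sum>m\<le>M. of_real ((\<Sum>j\<le>m. zernike_coeff (s - 1) a b j * q (m - j)) * r m) * z ^ (a - m) * cnj z ^ (b - m))"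
    by (simp add: sum_distrib_right)
  also have "\<dots> = (\<Sum>m\<le>M. of_real (pochhammer s a * pochhammer s b / (fact a * fact b) * zernike_coeff (s - 1) a b m) * z ^ (a - m) * cnj z ^ (b - m))"
    using assms by (intro sum.cong refl) (simp only: q_def r_def, subst zernike_coeff_convolution, auto simp: M_def)
  also have "\<dots> = of_real (pochhammer s a * pochhammer s b / (fact a * fact b)) * zernike (s - 1) a b z"
    by (subst zernike_upto[of a M b]) (auto simp: M_def sum_distrib_left mult.assoc)
  finally show ?thesis .
qed

section \<open>Derivatives with respect to \<open>z\<close> and \<open>cnj z\<close>\<close>

lemma zernike_has_derivative:
  "(zernike \<sigma> a b has_derivative
     (\<lambda>h. of_nat a * zernike (\<sigma> + 1) (a - 1) b z * h + of_nat b * zernike (\<sigma> + 1) a (b - 1) z * cnj h)) (at z)"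
proof -
  let ?c = "\<lambda>j. complex_of_real (zernike_coeff \<sigma> a b j)"
  have zernike_eq: "zernike \<sigma> a b = (\<lambda>z. \<Sum>j\<le>a + b. ?c j * z ^ (a - j) * cnj z ^ (b - j))"
    by (rule ext, rule zernike_upto) simp
  have e1: "of_nat a * zernike (\<sigma> + 1) (a - 1) b z
     = (\<Sum>j\<le>a + b. ?c j * of_nat (a - j) * z ^ (a - j - 1) * cnj z ^ (b - j))"
    by (rule zernike_deriv_expand)
  have "of_nat b * zernike (\<sigma> + 1) a (b - 1) z = cnj (of_nat b * zernike (\<sigma> + 1) (b - 1) a z)"
    by (simp add: cnj_zernike)
  also have "\<dots> = (\<Sum>j\<le>a + b. ?c j * of_nat (b - j) * z ^ (a - j) * cnj z ^ (b - j - 1))"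
    unfolding zernike_deriv_expand by (simp add: zernike_coeff_commute[of \<sigma> b a] add.commute mult_ac)
  finally have e2: "of_nat b * zernike (\<sigma> + 1) a (b - 1) z
     = (\<Sum>j\<le>a + b. ?c j * of_nat (b - j) * z ^ (a - j) * cnj z ^ (b - j - 1))" .
  have "((\<lambda>z. \<Sum>j\<le>a + b. ?c j * z ^ (a - j) * cnj z ^ (b - j)) has_derivative
      (\<lambda>h. \<Sum>j\<le>a + b. ?c j * of_nat (a - j) * z ^ (a - j - 1) * cnj z ^ (b - j) * h
         + ?c j * of_nat (b - j) * z ^ (a - j) * cnj z ^ (b - j - 1) * cnj h)) (at z)"
    by (auto intro!: derivative_eq_intros bounded_linear.has_derivative[OF bounded_linear_cnj] ext
        simp: algebra_simps)
  then show ?thesis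
    unfolding e1 e2 sum_distrib_right sum.distrib[symmetric]
    by (simp add: zernike_eq)
qed

text \<open>The coefficients of \<open>h\<close> and \<open>cnj h\<close> are the derivatives in
  \<open>z\<close> and \<open>cnj z\<close>. The second follows from the first by conjugation, which
  swaps \<open>a\<close> and \<open>b\<close>.\<close>

lemma weighted_zernike_has_derivative:
  assumes s: "0 < s" and z: "cmod z < 1"
  shows "((\<lambda>z. of_real ((1 - (cmod z)\<^sup>2) powr s) * zernike s a b z) has_derivative
     (\<lambda>h. - of_real (s + real a) * (of_real ((1 - (cmod z)\<^sup>2) powr (s - 1)) * zernike (s - 1) a (Suc b) z) * h
          - of_real (s + real b) * (of_real ((1 - (cmod z)\<^sup>2) powr (s - 1)) * zernike (s - 1) (Suc a) b z) * cnj h)) (at z)"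
proof -
  define w where "w = 1 - (cmod z)\<^sup>2"
  have w: "w > 0" using z by (simp add: w_def power_less_one_iff abs_square_less_1)
  have w_c: "complex_of_real w = 1 - z * cnj z"
    by (simp add: w_def complex_norm_square del: of_real_power)
  have "((\<lambda>z::complex. 1 - (z \<bullet> z)) has_derivative (\<lambda>h. - (z \<bullet> h + h \<bullet> z))) (at z)"
    by (auto intro!: derivative_eq_intros)
  then have d1: "((\<lambda>z. 1 - (cmod z)\<^sup>2) has_derivative (\<lambda>h. - (2 * (z \<bullet> h)))) (at z)"
    by (simp add: power2_norm_eq_inner inner_commute)
  have "((\<lambda>r. r powr s) has_real_derivative s * w powr (s - 1)) (at w)"
    using w by (rule has_real_derivative_powr)
  then have d2: "((\<lambda>r. r powr s) has_derivative (*) (s * w powr (s - 1))) (at (1 - (cmod z)\<^sup>2))"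
    by (simp add: has_field_derivative_def w_def)
  have d3: "((\<lambda>z. complex_of_real ((1 - (cmod z)\<^sup>2) powr s)) has_derivative
       (\<lambda>h. of_real (s * w powr (s - 1) * - (2 * (z \<bullet> h))))) (at z)"
    using bounded_linear.has_derivative[OF bounded_linear_of_real has_derivative_compose[OF d1 d2]]
    by (simp add: o_def)
  have inner_c: "complex_of_real (2 * (z \<bullet> h)) = cnj z * h + z * cnj h" for h
    by (simp add: complex_eq_iff inner_complex_def algebra_simps)
  have k1: "of_real w * (of_nat a * zernike (s + 1) (a - 1) b z) - of_real s * cnj z * zernike s a b z
     = - of_real (s + real a) * zernike (s - 1) a (Suc b) z"
    unfolding w_c by (rule zernike_weight_deriv[OF s])
  have "cnj (of_real w * (of_nat b * zernike (s + 1) (b - 1) a z) - of_real s * cnj z * zernike s b a z)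
     = cnj (- of_real (s + real b) * zernike (s - 1) b (Suc a) z)"
    unfolding w_c by (rule arg_cong[OF zernike_weight_deriv[OF s]])
  then have k2: "of_real w * (of_nat b * zernike (s + 1) a (b - 1) z) - of_real s * z * zernike s a b z
     = - of_real (s + real b) * zernike (s - 1) (Suc a) b z"
    by (simp add: cnj_zernike)
  have ws: "w powr s = w powr (s - 1) * w"
    using w by (metis powr_mult_base mult.commute add.commute diff_add_cancel less_imp_le)
  define D1 D2 where "D1 = of_nat a * zernike (s + 1) (a - 1) b z" and "D2 = of_nat b * zernike (s + 1) a (b - 1) z"
  have "of_real (w powr s) * (D1 * h + D2 * cnj h) + of_real (s * w powr (s - 1) * - (2 * (z \<bullet> h))) * zernike s a b z
     = of_real (w powr (s - 1)) * ((of_real w * D1 - of_real s * cnj z * zernike s a b z) * h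
          + (of_real w * D2 - of_real s * z * zernike s a b z) * cnj h)" for h
    unfolding ws of_real_mult of_real_minus inner_c[unfolded of_real_mult] by (simp add: algebra_simps)
  then have fin: "of_real (w powr s) * (D1 * h + D2 * cnj h) + of_real (s * w powr (s - 1) * - (2 * (z \<bullet> h))) * zernike s a b z
     = - of_real (s + real a) * (of_real (w powr (s - 1)) * zernike (s - 1) a (Suc b) z) * h
          - of_real (s + real b) * (of_real (w powr (s - 1)) * zernike (s - 1) (Suc a) b z) * cnj h" for h
    unfolding D1_def D2_def k1 k2 by (simp add: algebra_simps)
  show ?thesis
    using has_derivative_mult[OF d3 zernike_has_derivative[of s a b z]]
    unfolding w_def[symmetric] D1_def[symmetric] D2_def[symmetric] fin .
qed

section \<open>Integration over the disk\<close>

definition to_complex :: "real^2 \<Rightarrow> complex" where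
  "to_complex x = Complex (x $ 1) (x $ 2)"

definition of_complex :: "complex \<Rightarrow> real^2" where
  "of_complex z = (\<chi> i. if i = 1 then Re z else Im z)"

lemma to_complex_of_complex [simp]: "to_complex (of_complex z) = z"
  by (simp add: to_complex_def of_complex_def)

lemma of_complex_to_complex [simp]: "of_complex (to_complex x) = x"
  by (simp add: to_complex_def of_complex_def vec_eq_iff forall_2)

lemma cmod_to_complex [simp]: "cmod (to_complex x) = norm x"
  by (simp add: to_complex_def cmod_def norm_eq_sqrt_inner inner_vec_def sum_2 power2_eq_square)

lemma norm_of_complex [simp]: "norm (of_complex z) = cmod z"
  by (metis cmod_to_complex to_complex_of_complex)

lemma to_complex_axis: "to_complex (axis 1 1) = 1" "to_complex (axis 2 1) = \<i>"
  by (simp_all add: to_complex_def axis_def complex_eq_iff)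

lemma bounded_linear_to_complex: "bounded_linear to_complex"
  by (rule bounded_linear_intro[of _ 1]) (simp_all add: to_complex_def complex_eq_iff
     flip: cmod_to_complex[unfolded to_complex_def])

lemma bounded_linear_of_complex: "bounded_linear of_complex"
  by (rule bounded_linear_intro[of _ 1])
    (simp_all add: vec_eq_iff of_complex_def forall_2 flip: norm_of_complex[unfolded of_complex_def])

lemma measurable_to_complex [measurable]: "to_complex \<in> borel_measurable borel"
  by (intro borel_measurable_continuous_onI linear_continuous_on bounded_linear_to_complex)

lemma measurable_of_complex [measurable]: "of_complex \<in> borel_measurable borel"
  by (intro borel_measurable_continuous_onI linear_continuous_on bounded_linear_of_complex)

lemma measurable_cnj [measurable]: "cnj \<in> borel_measurable borel"
  by (intro borel_measurable_continuous_onI continuous_intros)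

text \<open>Moving the disk to \<open>complex\<close> as a Borel measure makes rotations,
  automorphisms and power series available; integrals of Borel functions are unaffected by the
  completion of Lebesgue measure.\<close>

definition disk_measure :: "complex measure" where
  "disk_measure = distr (restrict_space lborel unit_disk) borel to_complex"

lemma sets_disk_measure [simp, measurable_cong]: "sets disk_measure = sets borel"
  by (simp add: disk_measure_def)

lemma measurable_to_complex_restrict [measurable]:
  "to_complex \<in> restrict_space lborel unit_disk \<rightarrow>\<^sub>M borel"
  by (intro measurable_restrict_space1) simp

lemma AE_disk_measure: "AE z in disk_measure. cmod z < 1"
  unfolding disk_measure_def by (subst AE_distr_iff) (auto simp: AE_restrict_space_iff)

lemma set_integrable_disk_iff:
  fixes F :: "complex \<Rightarrow> 'b::{banach, second_countable_topology}"
  assumes [measurable]: "F \<in> borel_measurable borel"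
  shows "set_integrable lebesgue unit_disk (\<lambda>x. F (to_complex x)) \<longleftrightarrow> integrable disk_measure F"
proof -
  have [measurable]: "(\<lambda>x. F (to_complex x)) \<in> borel_measurable borel"
    by (rule measurable_compose[OF measurable_to_complex assms])
  have m: "(\<lambda>x. indicat_real unit_disk x *\<^sub>R F (to_complex x)) \<in> borel_measurable lborel"
    unfolding measurable_lborel1 by (intro borel_measurable_scaleR borel_measurable_indicator) auto
  show ?thesis
    unfolding disk_measure_def set_integrable_def integrable_completion[OF m]
    by (simp add: integrable_distr_eq integrable_restrict_space)
qed

lemma set_integral_disk_eq:
  fixes F :: "complex \<Rightarrow> 'b::{banach, second_countable_topology}"
  assumes [measurable]: "F \<in> borel_measurable borel"
  shows "set_lebesgue_integral lebesgue unit_disk (\<lambda>x. F (to_complex x)) = integral\<^sup>L disk_measure F"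
proof -
  have [measurable]: "(\<lambda>x. F (to_complex x)) \<in> borel_measurable borel"
    by (rule measurable_compose[OF measurable_to_complex assms])
  have m: "(\<lambda>x. indicat_real unit_disk x *\<^sub>R F (to_complex x)) \<in> borel_measurable lborel"
    unfolding measurable_lborel1 by (intro borel_measurable_scaleR borel_measurable_indicator) auto
  show ?thesis
    unfolding disk_measure_def set_lebesgue_integral_def integral_completion[OF m]
    by (simp add: integral_distr integral_restrict_space)
qed

text \<open>The Jacobian determinant of a holomorphic map is the square of
  \<open>cmod (g' z)\<close>. The values of \<open>F\<close> are carried to \<open>real^2\<close>
  together with the points. If \<open>F\<close> is not integrable, neither is the transformed
  integrand, and both integrals are 0.\<close>

lemma disk_change_of_variables:
  fixes F :: "complex \<Rightarrow> complex"
  assumes F [measurable]: "F \<in> borel_measurable borel"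
    and g [measurable]: "g \<in> borel_measurable borel" and g' [measurable]: "g' \<in> borel_measurable borel"
    and deriv: "\<And>z. cmod z < 1 \<Longrightarrow> (g has_field_derivative g' z) (at z)"
    and inj: "inj_on g (ball 0 1)" and surj: "g ` ball 0 1 = ball 0 1"
  shows "integrable disk_measure (\<lambda>z. of_real ((cmod (g' z))\<^sup>2) * F (g z)) \<longleftrightarrow> integrable disk_measure F"
    and "integral\<^sup>L disk_measure (\<lambda>z. of_real ((cmod (g' z))\<^sup>2) * F (g z)) = integral\<^sup>L disk_measure F"
proof -
  define h where "h x = of_complex (g (to_complex x))" for x
  define h' where "h' x = (\<lambda>y. of_complex (g' (to_complex x) * to_complex y))" for x
  define G where "G z = of_real ((cmod (g' z))\<^sup>2) * F (g z)" for z
  have [measurable]: "G \<in> borel_measurable borel" unfolding G_def by measurable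
  have ball_eq: "to_complex ` unit_disk = ball 0 1"
  proof safe
    fix z :: complex assume "z \<in> ball 0 1"
    then show "z \<in> to_complex ` unit_disk"
      by (intro image_eqI[of _ _ "of_complex z"]) auto
  qed auto
  have "(h has_derivative h' x) (at x within unit_disk)" if "x \<in> unit_disk" for x
  proof -
    have 1: "(to_complex has_derivative to_complex) (at x)"
      by (rule bounded_linear_imp_has_derivative[OF bounded_linear_to_complex])
    have "(g has_derivative (*) (g' (to_complex x))) (at (to_complex x))"
      using deriv[of "to_complex x"] that by (simp add: has_field_derivative_def)
    from has_derivative_compose[OF 1 this]
    have "((\<lambda>x. g (to_complex x)) has_derivative (\<lambda>y. g' (to_complex x) * to_complex y)) (at x)" .
    from bounded_linear.has_derivative[OF bounded_linear_of_complex this]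
    show ?thesis unfolding h_def h'_def by (rule has_derivative_at_withinI)
  qed
  moreover have "inj_on h unit_disk"
  proof (rule inj_onI)
    fix x y assume "x \<in> unit_disk" "y \<in> unit_disk" "h x = h y"
    then have "g (to_complex x) = g (to_complex y)" unfolding h_def by (metis to_complex_of_complex)
    then have "to_complex x = to_complex y" 
      using inj_onD[OF inj] \<open>x \<in> unit_disk\<close> \<open>y \<in> unit_disk\<close> by auto
    then show "x = y" by (metis of_complex_to_complex)
  qed
  ultimately have cov: "(\<lambda>x. \<bar>det (matrix (h' x))\<bar> *\<^sub>R of_complex (F (to_complex (h x)))) absolutely_integrable_on unit_disk \<and>
           integral unit_disk (\<lambda>x. \<bar>det (matrix (h' x))\<bar> *\<^sub>R of_complex (F (to_complex (h x)))) = b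
     \<longleftrightarrow> (\<lambda>x. of_complex (F (to_complex x))) absolutely_integrable_on (h ` unit_disk) \<and> integral (h ` unit_disk) (\<lambda>x. of_complex (F (to_complex x))) = b" for b
    by (intro has_absolute_integral_change_of_variables) auto
  have him: "h ` unit_disk = unit_disk"
  proof -
    have "h ` unit_disk = of_complex ` g ` to_complex ` unit_disk" by (auto simp: h_def image_image)
    also have "\<dots> = of_complex ` to_complex ` unit_disk" unfolding ball_eq surj ..
    finally show ?thesis by (simp add: image_image)
  qed
  have det: "\<bar>det (matrix (h' x))\<bar> = (cmod (g' (to_complex x)))\<^sup>2" for x
    by (simp add: det_2 matrix_def h'_def to_complex_axis of_complex_def cmod_power2) (simp add: power2_eq_square)
  have lhs: "\<bar>det (matrix (h' x))\<bar> *\<^sub>R of_complex (F (to_complex (h x))) = of_complex (G (to_complex x))" for x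
    unfolding det G_def h_def
    by (simp add: linear_simps[OF bounded_linear_of_complex] scaleR_conv_of_real[symmetric] del: of_real_power)
  note cov = cov[unfolded lhs him]
  have conv: "(\<lambda>x. of_complex (H (to_complex x))) absolutely_integrable_on unit_disk \<longleftrightarrow> integrable disk_measure H"
    and conv_int: "integrable disk_measure H \<Longrightarrow> integral unit_disk (\<lambda>x. of_complex (H (to_complex x))) = of_complex (integral\<^sup>L disk_measure H)"
    if [measurable]: "H \<in> borel_measurable borel" for H
  proof -
    have 1: "(\<lambda>x. of_complex (H (to_complex x))) absolutely_integrable_on unit_disk \<longleftrightarrow> integrable disk_measure (\<lambda>z. of_complex (H z))"
      by (subst set_integrable_disk_iff[symmetric]) auto
    have 2: "integrable disk_measure (\<lambda>z. of_complex (H z)) \<longleftrightarrow> integrable disk_measure H"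
    proof
      assume "integrable disk_measure (\<lambda>z. of_complex (H z))"
      from integrable_bounded_linear[OF bounded_linear_to_complex this] show "integrable disk_measure H" by simp
    qed (rule integrable_bounded_linear[OF bounded_linear_of_complex])
    show 3: "(\<lambda>x. of_complex (H (to_complex x))) absolutely_integrable_on unit_disk \<longleftrightarrow> integrable disk_measure H"
      using 1 2 by simp
    assume H: "integrable disk_measure H"
    have "integral unit_disk (\<lambda>x. of_complex (H (to_complex x))) = set_lebesgue_integral lebesgue unit_disk (\<lambda>x. of_complex (H (to_complex x)))"
      using 3 H by (intro set_lebesgue_integral_eq_integral(2)[symmetric]) auto
    also have "\<dots> = integral\<^sup>L disk_measure (\<lambda>z. of_complex (H z))"
      by (rule set_integral_disk_eq) simp
    also have "\<dots> = of_complex (integral\<^sup>L disk_measure H)"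
      by (rule integral_bounded_linear[OF bounded_linear_of_complex H])
    finally show "integral unit_disk (\<lambda>x. of_complex (H (to_complex x))) = of_complex (integral\<^sup>L disk_measure H)" .
  qed
  show iff: "integrable disk_measure (\<lambda>z. of_real ((cmod (g' z))\<^sup>2) * F (g z)) \<longleftrightarrow> integrable disk_measure F"
    using cov conv[of F] conv[of G] unfolding G_def[symmetric, abs_def] by auto
  show "integral\<^sup>L disk_measure (\<lambda>z. of_real ((cmod (g' z))\<^sup>2) * F (g z)) = integral\<^sup>L disk_measure F"
  proof (cases "integrable disk_measure F")
    case True
    then have "integrable disk_measure G" using iff by (simp add: G_def[abs_def])
    then have "of_complex (integral\<^sup>L disk_measure G) = of_complex (integral\<^sup>L disk_measure F)"
      using True cov conv[of F] conv_int[of F] conv[of G] conv_int[of G] by auto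
    then show ?thesis unfolding G_def[symmetric, abs_def] by (metis to_complex_of_complex)
  next
    case False
    then show ?thesis using iff by (simp add: not_integrable_integral_eq)
  qed
qed

text \<open>The annulus between squared radii \<open>t\<close> and 1 has area
  \<open>pi * (1 - t)\<close>, which is linear in \<open>t\<close>; hence the squared radius is
  uniformly distributed. Half-lines determine the measure.\<close>

lemma distr_disk_measure_norm_square:
  "distr disk_measure borel (\<lambda>z. (cmod z)\<^sup>2) = density lborel (\<lambda>t. ennreal (pi * indicator {0<..<1} t))"
  (is "?M = ?N")
proof -
  have ball: "emeasure lborel (ball (0::real^2) r) = ennreal (pi * r\<^sup>2)" if "r \<ge> 0" for r
    using emeasure_ball[OF that, of "0::real^2"] by (simp add: unit_ball_vol_2)
  have cball: "emeasure lborel (cball (0::real^2) r) = ennreal (pi * r\<^sup>2)" if "r \<ge> 0" for r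
    using emeasure_cball[OF that, of "0::real^2"] by (simp add: unit_ball_vol_2)
  have eq: "emeasure ?M {t<..} = emeasure lborel {x::real^2. norm x < 1 \<and> t < (norm x)\<^sup>2}" for t
  proof -
    have "emeasure ?M {t<..} = emeasure (restrict_space lborel (unit_disk :: (real^2) set)) (to_complex -` ((\<lambda>z. (cmod z)\<^sup>2) -` {t<..}) \<inter> space (restrict_space lborel unit_disk))"
      unfolding disk_measure_def by (subst distr_distr, simp_all, subst emeasure_distr, simp_all add: vimage_comp)
    also have "\<dots> = emeasure lborel (to_complex -` ((\<lambda>z. (cmod z)\<^sup>2) -` {t<..}) \<inter> unit_disk)"
      by (subst emeasure_restrict_space) (auto simp: space_restrict_space)
    also have "to_complex -` ((\<lambda>z. (cmod z)\<^sup>2) -` {t<..}) \<inter> unit_disk = {x. norm x < 1 \<and> t < (norm x)\<^sup>2}"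
      by auto
    finally show ?thesis .
  qed
  have N: "emeasure ?N {t<..} = ennreal pi * emeasure lborel ({t<..} \<inter> {0<..<1})" for t
  proof -
    have "emeasure ?N {t<..} = (\<integral>\<^sup>+ x. ennreal (pi * indicator {0<..<1} x) * indicator {t<..} x \<partial>lborel)"
      by (rule emeasure_density) auto
    also have "\<dots> = (\<integral>\<^sup>+ x. ennreal pi * indicator ({t<..} \<inter> {0<..<1}) x \<partial>lborel)"
      by (intro nn_integral_cong) (auto split: split_indicator)
    also have "\<dots> = ennreal pi * emeasure lborel ({t<..} \<inter> {0<..<1})"
      by (rule nn_integral_cmult_indicator) auto
    finally show ?thesis .
  qed
  show ?thesis
  proof (rule measure_eqI_lessThan)
    fix t :: real
    show 1: "emeasure ?M {t<..} = emeasure ?N {t<..}"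
    proof -
      consider "t < 0" | "0 \<le> t" "t < 1" | "t \<ge> 1" by linarith
      then show ?thesis
      proof cases
        case 1
        have "{x::real^2. norm x < 1 \<and> t < (norm x)\<^sup>2} = ball 0 1"
          using 1 by (auto intro: less_le_trans[OF _ zero_le_power2])
        moreover have "{t<..} \<inter> {0<..<1} = {0<..<1::real}" using 1 by auto
        ultimately show ?thesis unfolding eq N using ball[of 1] by simp
      next
        case 2
        have "{x::real^2. norm x < 1 \<and> t < (norm x)\<^sup>2} = ball 0 1 - cball 0 (sqrt t)"
          by (auto simp: not_le real_less_rsqrt real_sqrt_less_iff dest: real_sqrt_less_mono)
            (metis abs_norm_cancel real_sqrt_abs real_sqrt_less_iff)
        also have "emeasure lborel \<dots> = ennreal (pi * 1\<^sup>2) - ennreal (pi * (sqrt t)\<^sup>2)"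
        proof -
          have st: "sqrt t < 1" using 2 by simp
          have "cball 0 (sqrt t) \<subseteq> (ball 0 1 :: (real^2) set)"
          proof
            fix x :: "real^2" assume "x \<in> cball 0 (sqrt t)"
            then have "norm x \<le> sqrt t" by simp
            from le_less_trans[OF this st] show "x \<in> ball 0 1" by simp
          qed
          then show ?thesis using 2 by (subst emeasure_Diff) (auto simp: ball cball)
        qed
        also have "\<dots> = ennreal (pi * (1 - t))"
          using 2 by (simp add: ennreal_minus[symmetric] algebra_simps)
        finally have a: "emeasure ?M {t<..} = ennreal (pi * (1 - t))" unfolding eq .
        have "{t<..} \<inter> {0<..<1} = {t<..<1::real}" using 2 by auto
        then show ?thesis unfolding a N using 2 by (simp add: ennreal_mult)
      next
        case 3
        have "norm x < 1 \<Longrightarrow> \<not> t < (norm x)\<^sup>2" for x :: "real^2"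
          using 3 by (smt (verit) norm_ge_zero power_le_one)
        then have "{x::real^2. norm x < 1 \<and> t < (norm x)\<^sup>2} = {}" by auto
        moreover have "{t<..} \<inter> {0<..<1} = ({} :: real set)" using 3 by auto
        ultimately show ?thesis unfolding eq N by (simp only: emeasure_empty mult_zero_right)
      qed
    qed
    have "emeasure lborel {x::real^2. norm x < 1 \<and> t < (norm x)\<^sup>2} \<le> emeasure lborel (ball (0::real^2) 1)"
      by (intro emeasure_mono) auto
    also have "\<dots> < \<infinity>" using ball[of 1] by simp
    finally show "emeasure ?M {t<..} < \<infinity>" unfolding eq .
  qed simp_all
qed

lemma integrable_radial_iff:
  fixes f :: "real \<Rightarrow> 'b::{banach, second_countable_topology}"
  assumes [measurable]: "f \<in> borel_measurable borel"
  shows "integrable disk_measure (\<lambda>z. f ((cmod z)\<^sup>2)) \<longleftrightarrow> set_integrable lborel {0<..<1} f"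
proof -
  have "integrable disk_measure (\<lambda>z. f ((cmod z)\<^sup>2)) \<longleftrightarrow> integrable (distr disk_measure borel (\<lambda>z. (cmod z)\<^sup>2)) f"
    by (subst integrable_distr_eq) auto
  also have "\<dots> \<longleftrightarrow> integrable lborel (\<lambda>t. pi *\<^sub>R (indicator {0<..<1} t *\<^sub>R f t))"
    unfolding distr_disk_measure_norm_square by (subst integrable_density) auto
  also have "\<dots> \<longleftrightarrow> integrable lborel (\<lambda>t. indicator {0<..<1} t *\<^sub>R f t)"
    using integrable_scaleR_right[of "1 / pi" lborel "\<lambda>t. pi *\<^sub>R (indicator {0<..<1} t *\<^sub>R f t)"]
      integrable_scaleR_right[of pi lborel "\<lambda>t. indicator {0<..<1} t *\<^sub>R f t"] by auto
  finally show ?thesis by (simp add: set_integrable_def)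
qed

lemma integral_radial:
  fixes f :: "real \<Rightarrow> 'b::{banach, second_countable_topology}"
  assumes [measurable]: "f \<in> borel_measurable borel"
  shows "integral\<^sup>L disk_measure (\<lambda>z. f ((cmod z)\<^sup>2)) = pi *\<^sub>R set_lebesgue_integral lborel {0<..<1} f"
proof -
  have "integral\<^sup>L disk_measure (\<lambda>z. f ((cmod z)\<^sup>2)) = integral\<^sup>L (distr disk_measure borel (\<lambda>z. (cmod z)\<^sup>2)) f"
    by (subst integral_distr) auto
  also have "\<dots> = integral\<^sup>L lborel (\<lambda>t. pi *\<^sub>R (indicator {0<..<1} t *\<^sub>R f t))"
    unfolding distr_disk_measure_norm_square by (subst integral_density) auto
  finally show ?thesis by (simp add: set_lebesgue_integral_def flip: scaleR_scaleR)
qed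

text \<open>A rotation \<open>u\<close> with \<open>u ^ p * cnj u ^ q = - 1\<close> preserves the
  measure and changes the sign of the integrand, so the integral equals its own negative. A
  non-integrable integrand is covered as well, its integral being 0 by convention.\<close>

lemma integral_disk_angular:
  fixes f :: "real \<Rightarrow> complex"
  assumes [measurable]: "f \<in> borel_measurable borel" and "p \<noteq> q"
  shows "integral\<^sup>L disk_measure (\<lambda>z. f ((cmod z)\<^sup>2) * z ^ p * cnj z ^ q) = 0"
proof -
  define u where "u = cis (pi / (real p - real q))"
  let ?F = "\<lambda>z. f ((cmod z)\<^sup>2) * z ^ p * cnj z ^ q"
  have u: "cmod u = 1" "u \<noteq> 0" by (auto simp: u_def)
  have "u ^ p * cnj u ^ q = cis (real p * (pi / (real p - real q))) * cis (- (real q * (pi / (real p - real q))))"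
    unfolding u_def cis_cnj Complex.DeMoivre by simp
  also have "\<dots> = cis ((real p - real q) * (pi / (real p - real q)))"
    by (simp only: cis_mult left_diff_distrib add_uminus_conv_diff)
  also have "\<dots> = -1" using \<open>p \<noteq> q\<close> by simp
  finally have uu: "u ^ p * cnj u ^ q = -1" .
  have "integral\<^sup>L disk_measure (\<lambda>z. of_real ((cmod u)\<^sup>2) * ?F (u * z)) = integral\<^sup>L disk_measure ?F"
  proof (rule disk_change_of_variables(2))
    show "(\<lambda>z. u * z) ` ball 0 1 = ball 0 1"
    proof safe
      fix z :: complex assume "z \<in> ball 0 1"
      then show "z \<in> (\<lambda>z. u * z) ` ball 0 1"
        using u by (intro image_eqI[of _ _ "z / u"]) (auto simp: norm_divide)
    qed (use u in \<open>auto simp: norm_mult\<close>)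
    show "inj_on (\<lambda>z. u * z) (ball 0 1)" using u by (auto intro: inj_onI)
  qed (auto intro!: derivative_eq_intros)
  also have "(\<lambda>z. of_real ((cmod u)\<^sup>2) * ?F (u * z)) = (\<lambda>z. (u ^ p * cnj u ^ q) * ?F z)"
    by (simp add: u norm_mult power_mult_distrib mult_ac)
  also have "integral\<^sup>L disk_measure \<dots> = - integral\<^sup>L disk_measure ?F"
    unfolding uu by simp
  finally show ?thesis by simp
qed

section \<open>Beta integrals and termwise integration\<close>

lemma set_integral_Beta:
  fixes a b :: real
  assumes "a > 0" "b > 0"
  shows "set_integrable lborel {0<..<1} (\<lambda>t. t powr (a - 1) * (1 - t) powr (b - 1))"
    and "set_lebesgue_integral lborel {0<..<1} (\<lambda>t. t powr (a - 1) * (1 - t) powr (b - 1)) = Beta a b"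
proof -
  let ?f = "\<lambda>t::real. t powr (a - 1) * (1 - t) powr (b - 1)"
  have h: "(?f has_integral Beta a b) {0<..<1}"
    using has_integral_Beta_real[OF assms] by (simp add: has_integral_Icc_iff_Ioo)
  then have ai: "?f absolutely_integrable_on {0<..<1}"
    by (intro nonnegative_absolutely_integrable_1) auto
  have m: "(\<lambda>x. indicat_real {0<..<1} x *\<^sub>R ?f x) \<in> borel_measurable lborel"
    by measurable
  show "set_integrable lborel {0<..<1} ?f"
    using ai unfolding set_integrable_def integrable_completion[OF m] .
  have "set_lebesgue_integral lborel {0<..<1} ?f = set_lebesgue_integral lebesgue {0<..<1} ?f"
    unfolding set_lebesgue_integral_def integral_completion[OF m] ..
  also have "\<dots> = integral {0<..<1} ?f" by (rule set_lebesgue_integral_eq_integral(2)[OF ai])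
  also have "\<dots> = Beta a b" using h by (rule integral_unique)
  finally show "set_lebesgue_integral lborel {0<..<1} ?f = Beta a b" .
qed

text \<open>The terms are dominated by \<open>\<bar>W z\<bar> * B n\<close>, whose integrals are
  summable, so sum and integral commute. The unbounded factor \<open>W\<close> is kept apart from
  the terms because it carries all singularities in the applications.\<close>

lemma disk_measure_sums:
  fixes W :: "complex \<Rightarrow> real" and g :: "nat \<Rightarrow> complex \<Rightarrow> complex"
  assumes W: "integrable disk_measure W" and g [measurable]: "\<And>n. g n \<in> borel_measurable borel"
    and bound: "\<And>n z. cmod z < 1 \<Longrightarrow> cmod (g n z) \<le> B n" and B: "summable B"
    and sums: "\<And>z. cmod z < 1 \<Longrightarrow> (\<lambda>n. g n z) sums G z"
    and G [measurable]: "G \<in> borel_measurable borel"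
  shows "integrable disk_measure (\<lambda>z. of_real (W z) * g n z)" (is ?A)
    and "integrable disk_measure (\<lambda>z. of_real (W z) * G z)" (is ?B)
    and "(\<lambda>n. \<integral>z. of_real (W z) * g n z \<partial>disk_measure) sums (\<integral>z. of_real (W z) * G z \<partial>disk_measure)" (is ?C)
proof -
  let ?f = "\<lambda>n z. of_real (W z) * g n z"
  have [measurable]: "W \<in> borel_measurable borel"
    using borel_measurable_integrable[OF W] by simp
  have B0: "0 \<le> B n" for n
  proof -
    have "cmod (g n 0) \<le> B n" by (rule bound) simp
    then show ?thesis using norm_ge_zero[of "g n 0"] by linarith
  qed
  have int: "integrable disk_measure (?f n)" for n
  proof (rule Bochner_Integration.integrable_bound)
    show "integrable disk_measure (\<lambda>z. W z * B n)" using W by simp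
    show "AE z in disk_measure. norm (?f n z) \<le> norm (W z * B n)"
      using AE_disk_measure
      by eventually_elim (use bound B0 in \<open>auto simp: norm_mult abs_mult intro!: mult_left_mono\<close>)
  qed simp
  then show ?A .
  have sumnorm: "AE z in disk_measure. summable (\<lambda>n. norm (?f n z))"
    using AE_disk_measure
  proof eventually_elim
    fix z assume "cmod z < 1"
    then show "summable (\<lambda>n. norm (?f n z))"
      using bound by (intro summable_comparison_test'[OF summable_mult[OF B, of "\<bar>W z\<bar>"], of 0])
        (auto simp: norm_mult intro!: mult_left_mono)
  qed
  have sumint: "summable (\<lambda>n. \<integral>z. norm (?f n z) \<partial>disk_measure)"
  proof (rule summable_comparison_test'[OF summable_mult[OF B, of "\<integral>z. \<bar>W z\<bar> \<partial>disk_measure"], of 0])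
    fix n :: nat
    have "(\<integral>z. norm (?f n z) \<partial>disk_measure) \<le> (\<integral>z. \<bar>W z\<bar> * B n \<partial>disk_measure)"
    proof (rule integral_mono_AE)
      show "AE z in disk_measure. norm (?f n z) \<le> \<bar>W z\<bar> * B n"
        using AE_disk_measure
        by eventually_elim (use bound B0 in \<open>auto simp: norm_mult abs_mult intro!: mult_left_mono\<close>)
    qed (use int[of n] W in auto)
    then show "norm (\<integral>z. norm (?f n z) \<partial>disk_measure) \<le> (\<integral>z. \<bar>W z\<bar> \<partial>disk_measure) * B n"
      by simp
  qed
  have eq: "AE z in disk_measure. (\<Sum>n. ?f n z) = of_real (W z) * G z"
    using AE_disk_measure by eventually_elim (use sums in \<open>auto intro!: sums_unique[symmetric] sums_mult\<close>)
  show ?B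
    using integrable_suminf[OF int sumnorm sumint] eq by (subst integrable_cong_AE[OF _ _ eq, symmetric]) auto
  have "(\<integral>z. (\<Sum>n. ?f n z) \<partial>disk_measure) = (\<integral>z. of_real (W z) * G z \<partial>disk_measure)"
    by (rule integral_cong_AE[OF _ _ eq]) auto
  then show ?C using sums_integral[OF int sumnorm sumint] by simp
qed

section \<open>The Riesz kernel\<close>

text \<open>The shape of the weighted Riesz kernel after its pole has been moved to the origin; it
  is radial.\<close>

definition pole_weight :: "real \<Rightarrow> complex \<Rightarrow> real" where
  "pole_weight s z = (cmod z)\<^sup>2 powr (- s) * (1 - (cmod z)\<^sup>2) powr (s - 1)"

lemma measurable_pole_weight [measurable]: "pole_weight s \<in> borel_measurable borel"
  unfolding pole_weight_def by measurable

lemma pole_weight_moment: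
  assumes "0 < s" "s < 1"
  shows "integrable disk_measure (\<lambda>z. pole_weight s z * ((cmod z)\<^sup>2) ^ k)"
    and "(\<integral>z. pole_weight s z * ((cmod z)\<^sup>2) ^ k \<partial>disk_measure) = pi * Gamma s * Gamma (real k + 1 - s) / fact k"
proof -
  let ?f = "\<lambda>t::real. t powr (- s) * (1 - t) powr (s - 1) * t ^ k"
  let ?g = "\<lambda>t::real. t powr (real k + 1 - s - 1) * (1 - t) powr (s - 1)"
  have eq: "?f t = ?g t" if "t \<in> {0<..<1}" for t
    using that by (simp add: powr_realpow[symmetric] powr_add[symmetric] mult.assoc mult.commute add.commute)
  have B: "set_integrable lborel {0<..<1} ?g" "set_lebesgue_integral lborel {0<..<1} ?g = Beta (real k + 1 - s) s"
    using set_integral_Beta[of "real k + 1 - s" s] assms by auto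
  have "set_integrable lborel {0<..<1} ?f \<longleftrightarrow> set_integrable lborel {0<..<1} ?g"
    by (rule set_integrable_cong) (auto simp: eq)
  then show "integrable disk_measure (\<lambda>z. pole_weight s z * ((cmod z)\<^sup>2) ^ k)"
    using integrable_radial_iff[of ?f] B unfolding pole_weight_def by simp
  have "set_lebesgue_integral lborel {0<..<1} ?f = set_lebesgue_integral lborel {0<..<1} ?g"
    by (rule set_lebesgue_integral_cong) (auto simp: eq)
  then have "(\<integral>z. pole_weight s z * ((cmod z)\<^sup>2) ^ k \<partial>disk_measure) = pi * Beta (real k + 1 - s) s"
    using integral_radial[of ?f] B unfolding pole_weight_def by simp
  then show "(\<integral>z. pole_weight s z * ((cmod z)\<^sup>2) ^ k \<partial>disk_measure) = pi * Gamma s * Gamma (real k + 1 - s) / fact k"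
    by (simp add: Beta_def Gamma_fact[symmetric] add.commute mult_ac)
qed

lemma neg_binomial_sums:
  assumes "\<bar>q\<bar> < (1::real)"
  shows "(\<lambda>k. pochhammer a k / fact k * q ^ k) sums ((1 - q) powr (- a))"
proof -
  have "(\<lambda>k. ((- a) gchoose k) * (- q) ^ k) sums ((1 + - q) powr (- a))"
    using assms by (intro gen_binomial_real) simp
  moreover have "((- a) gchoose k) * (- q) ^ k = pochhammer a k / fact k * q ^ k" for k
    by (simp add: gbinomial_pochhammer power_minus[of q])
  ultimately show ?thesis by simp
qed

text \<open>The moments of \<open>pole_weight s\<close> are Beta values proportional to
  \<open>pochhammer (1 - s) n / fact n\<close>. Integrating the geometric series therefore produces
  the binomial series of exponent \<open>s - 1\<close>.\<close>

lemma integral_pole_weight_geometric: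
  assumes s: "0 < s" "s < 1" and q: "0 \<le> q" "q < 1"
  shows "integrable disk_measure (\<lambda>z. pole_weight s z / (1 - q * (cmod z)\<^sup>2))"
    and "(\<integral>z. pole_weight s z / (1 - q * (cmod z)\<^sup>2) \<partial>disk_measure)
       = pi * Gamma s * Gamma (1 - s) * (1 - q) powr (s - 1)"
proof -
  let ?g = "\<lambda>n z. complex_of_real ((q * (cmod z)\<^sup>2) ^ n)"
  let ?G = "\<lambda>z. complex_of_real (1 / (1 - q * (cmod z)\<^sup>2))"
  have W: "integrable disk_measure (pole_weight s)"
    using pole_weight_moment(1)[OF s, of 0] by simp
  have qz: "q * (cmod z)\<^sup>2 \<le> q" "0 \<le> q * (cmod z)\<^sup>2" if "cmod z < 1" for z
    using that q by (auto intro!: mult_left_le power_le_one)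
  have bound: "cmod (?g n z) \<le> q ^ n" if "cmod z < 1" for n z
    using qz[OF that] by (simp add: norm_power power_mono norm_mult del: power_mult_distrib of_real_power)
  have sums: "(\<lambda>n. ?g n z) sums ?G z" if "cmod z < 1" for z
    using qz[OF that] q by (intro sums_of_real geometric_sums) auto
  note S = disk_measure_sums[OF W _ bound _ sums]
  have "(\<lambda>n. \<integral>z. of_real (pole_weight s z) * ?g n z \<partial>disk_measure) sums (\<integral>z. of_real (pole_weight s z) * ?G z \<partial>disk_measure)"
    using q by (intro S(3)) (auto intro: summable_geometric)
  moreover have "(\<integral>z. of_real (pole_weight s z) * ?g n z \<partial>disk_measure)
      = of_real (pi * Gamma s * Gamma (1 - s) * (pochhammer (1 - s) n / fact n * q ^ n))" for n
  proof -
    have "(\<integral>z. of_real (pole_weight s z) * ?g n z \<partial>disk_measure)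
        = of_real (\<integral>z. q ^ n * (pole_weight s z * ((cmod z)\<^sup>2) ^ n) \<partial>disk_measure)"
      unfolding integral_complex_of_real[symmetric] by (simp add: power_mult_distrib mult_ac)
    also have "(\<integral>z. q ^ n * (pole_weight s z * ((cmod z)\<^sup>2) ^ n) \<partial>disk_measure) = q ^ n * (pi * Gamma s * Gamma (real n + 1 - s) / fact n)"
      unfolding integral_mult_right_zero pole_weight_moment(2)[OF s] ..
    also have "Gamma (real n + 1 - s) = Gamma (1 - s) * pochhammer (1 - s) n"
    proof -
      have "pochhammer (1 - s) n = Gamma (1 - s + real n) / Gamma (1 - s)"
        using s by (intro pochhammer_Gamma) (auto elim!: nonpos_Ints_cases)
      moreover have "Gamma (1 - s) > 0" using s by (intro Gamma_real_pos) simp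
      ultimately show ?thesis by (simp add: field_simps)
    qed
    finally show ?thesis by (simp add: mult_ac)
  qed
  ultimately have "(\<lambda>n. complex_of_real (pi * Gamma s * Gamma (1 - s) * (pochhammer (1 - s) n / fact n * q ^ n)))
     sums (\<integral>z. of_real (pole_weight s z) * ?G z \<partial>disk_measure)" by simp
  moreover have "(\<lambda>n. complex_of_real (pi * Gamma s * Gamma (1 - s) * (pochhammer (1 - s) n / fact n * q ^ n)))
     sums of_real (pi * Gamma s * Gamma (1 - s) * (1 - q) powr (s - 1))"
    using neg_binomial_sums[of q "1 - s"] q by (intro sums_of_real sums_mult) auto
  ultimately have "(\<integral>z. of_real (pole_weight s z) * ?G z \<partial>disk_measure) = of_real (pi * Gamma s * Gamma (1 - s) * (1 - q) powr (s - 1))"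
    by (rule sums_unique2)
  moreover have "of_real (pole_weight s z) * ?G z = of_real (pole_weight s z / (1 - q * (cmod z)\<^sup>2))" for z
    by simp
  ultimately have "complex_of_real (\<integral>z. pole_weight s z / (1 - q * (cmod z)\<^sup>2) \<partial>disk_measure) = of_real (pi * Gamma s * Gamma (1 - s) * (1 - q) powr (s - 1))"
    unfolding integral_complex_of_real[symmetric] by simp
  then show "(\<integral>z. pole_weight s z / (1 - q * (cmod z)\<^sup>2) \<partial>disk_measure)
       = pi * Gamma s * Gamma (1 - s) * (1 - q) powr (s - 1)" unfolding of_real_eq_iff .
  have "integrable disk_measure (\<lambda>z. of_real (pole_weight s z) * ?G z)"
    using q by (intro S(2)) (auto intro: summable_geometric)
  then have "integrable disk_measure (\<lambda>z. complex_of_real (pole_weight s z / (1 - q * (cmod z)\<^sup>2)))" by simp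
  then show "integrable disk_measure (\<lambda>z. pole_weight s z / (1 - q * (cmod z)\<^sup>2))"
    unfolding complex_of_real_integrable_eq .
qed

text \<open>By the Poisson kernel expansion, the angular average of \<open>1 / (cmod (1 - v))\<^sup>2\<close> over a circle
  \<open>cmod v = const\<close> is \<open>1 / (1 - (cmod v)\<^sup>2)\<close>.\<close>

lemma poisson_sums:
  assumes "cmod v < 1"
  shows "(\<lambda>n. v ^ n + (if n = 0 then 0 else cnj v ^ n)) sums
     of_real ((1 - (cmod v)\<^sup>2) / (cmod (1 - v))\<^sup>2)"
proof -
  have v1: "1 - v \<noteq> 0" "1 - cnj v \<noteq> 0"
  proof -
    have "v \<noteq> 1" using assms by auto
    moreover from this have "cnj v \<noteq> 1" by (metis complex_cnj_cnj complex_cnj_one)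
    ultimately show "1 - v \<noteq> 0" "1 - cnj v \<noteq> 0" by auto
  qed
  have "(\<lambda>n. cnj v ^ n) sums (1 / (1 - cnj v))" using assms by (intro geometric_sums) simp
  then have "(\<lambda>n. if n = 0 then 0 else cnj v ^ n) sums (1 / (1 - cnj v) - 1)"
    using sums_If_finite_set'[of "\<lambda>n. cnj v ^ n" "1 / (1 - cnj v)" "{0}" "1 / (1 - cnj v) - 1" "\<lambda>n. 0"]
    by simp
  with geometric_sums[of v] assms
  have "(\<lambda>n. v ^ n + (if n = 0 then 0 else cnj v ^ n)) sums (1 / (1 - v) + (1 / (1 - cnj v) - 1))"
    by (intro sums_add)
  also have "1 / (1 - v) + (1 / (1 - cnj v) - 1) = (1 - v * cnj v) / ((1 - v) * (1 - cnj v))"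
    using v1 by (simp add: divide_simps) (simp add: algebra_simps)
  also have "\<dots> = of_real ((1 - (cmod v)\<^sup>2) / (cmod (1 - v))\<^sup>2)"
    by (simp add: complex_norm_square del: of_real_power)
  finally show ?thesis .
qed

text \<open>With \<open>1 / (1 - q * (cmod z)\<^sup>2)\<close> moved into the radial weight
  \<open>W\<close>, the remaining factor is a Poisson kernel. Its harmonics of positive order
  integrate to 0 against \<open>W\<close>, so only the constant term is left.\<close>

lemma integral_pole_weight_poisson:
  assumes s: "0 < s" "s < 1" and c: "cmod c < 1"
  shows "integrable disk_measure (\<lambda>z. pole_weight s z / (cmod (1 - c * z))\<^sup>2)"
    and "(\<integral>z. pole_weight s z / (cmod (1 - c * z))\<^sup>2 \<partial>disk_measure)
       = pi * Gamma s * Gamma (1 - s) * (1 - (cmod c)\<^sup>2) powr (s - 1)"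
proof -
  define q where "q = (cmod c)\<^sup>2"
  have q: "0 \<le> q" "q < 1" using c by (auto simp: q_def power_less_one_iff abs_square_less_1)
  define W where "W z = pole_weight s z / (1 - q * (cmod z)\<^sup>2)" for z
  have [measurable]: "W \<in> borel_measurable borel" unfolding W_def by measurable
  let ?g = "\<lambda>n z. (c * z) ^ n + (if n = 0 then 0 else cnj (c * z) ^ n)"
  let ?G = "\<lambda>z. complex_of_real ((1 - (cmod (c * z))\<^sup>2) / (cmod (1 - c * z))\<^sup>2)"
  have W: "integrable disk_measure W" unfolding W_def by (rule integral_pole_weight_geometric(1)[OF s q])
  have cz: "cmod (c * z) < 1" "cmod (c * z) \<le> cmod c" if "cmod z < 1" for z
    using that c mult_left_le[of "cmod z" "cmod c"] by (auto simp: norm_mult intro: le_less_trans)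
  have bound: "cmod (?g n z) \<le> 2 * cmod c ^ n" if "cmod z < 1" for n z
  proof -
    have a: "cmod ((c * z) ^ n) \<le> cmod c ^ n" unfolding norm_power using cz[OF that] by (intro power_mono) auto
    have b: "cmod (if n = 0 then 0 else cnj (c * z) ^ n) \<le> cmod c ^ n"
      using cz[OF that] by (auto simp: norm_power norm_mult intro!: power_mono simp del: complex_cnj_mult)
    show ?thesis using norm_triangle_ineq[of "(c * z) ^ n" "if n = 0 then 0 else cnj (c * z) ^ n"] a b by linarith
  qed
  have sums: "(\<lambda>n. ?g n z) sums ?G z" if "cmod z < 1" for z
    using poisson_sums[OF cz(1)[OF that]] .
  have B: "summable (\<lambda>n. 2 * cmod c ^ n)" using c by (intro summable_mult summable_geometric) auto
  have S3: "(\<lambda>n. \<integral>z. of_real (W z) * ?g n z \<partial>disk_measure) sums (\<integral>z. of_real (W z) * ?G z \<partial>disk_measure)"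
    by (rule disk_measure_sums(3)[OF W _ bound B sums]) measurable
  have S2: "integrable disk_measure (\<lambda>z. of_real (W z) * ?G z)"
    by (rule disk_measure_sums(2)[OF W _ bound B sums]) measurable
  have zero: "(\<integral>z. of_real (W z) * ?g n z \<partial>disk_measure) = (if n = 0 then of_real (\<integral>z. W z \<partial>disk_measure) else 0)" for n
  proof (cases "n = 0")
    case False
    let ?w = "\<lambda>t::real. t powr (- s) * (1 - t) powr (s - 1) / (1 - q * t)"
    have Wz: "W z = ?w ((cmod z)\<^sup>2)" for z by (simp add: W_def pole_weight_def)
    have 1: "(\<integral>z. of_real (?w ((cmod z)\<^sup>2)) * c ^ n * z ^ n * cnj z ^ 0 \<partial>disk_measure) = 0"
      using False integral_disk_angular[of "\<lambda>t. of_real (?w t) * c ^ n" n 0] by simp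
    have 2: "(\<integral>z. of_real (?w ((cmod z)\<^sup>2)) * cnj c ^ n * z ^ 0 * cnj z ^ n \<partial>disk_measure) = 0"
      using False integral_disk_angular[of "\<lambda>t. of_real (?w t) * cnj c ^ n" 0 n] by simp
    have int: "integrable disk_measure (\<lambda>z. of_real (W z) * h z ^ n)"
      if [measurable]: "h \<in> borel_measurable borel" and h: "\<And>z. cmod z < 1 \<Longrightarrow> cmod (h z) \<le> 1" for h
    proof (rule Bochner_Integration.integrable_bound[OF W])
      show "AE z in disk_measure. norm (of_real (W z) * h z ^ n) \<le> norm (W z)"
        using AE_disk_measure
        by eventually_elim (use h in \<open>auto simp: norm_mult norm_power intro!: mult_left_le power_le_one\<close>)
    qed measurable
    have i1: "integrable disk_measure (\<lambda>z. of_real (W z) * (c * z) ^ n)"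
      using cz by (intro int) (auto intro: less_imp_le)
    have i2: "integrable disk_measure (\<lambda>z. of_real (W z) * (cnj c * cnj z) ^ n)"
      using cz by (intro int) (auto simp: norm_mult intro: less_imp_le)
    have "(\<integral>z. of_real (W z) * ?g n z \<partial>disk_measure)
       = (\<integral>z. of_real (W z) * (c * z) ^ n \<partial>disk_measure) + (\<integral>z. of_real (W z) * (cnj c * cnj z) ^ n \<partial>disk_measure)"
      using False by (subst Bochner_Integration.integral_add[symmetric, OF i1 i2]) (simp add: distrib_left)
    also have "(\<integral>z. of_real (W z) * (c * z) ^ n \<partial>disk_measure) = 0"
      using 1 unfolding Wz by (simp add: power_mult_distrib mult.assoc)
    also have "(\<integral>z. of_real (W z) * (cnj c * cnj z) ^ n \<partial>disk_measure) = 0"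
      using 2 unfolding Wz by (simp add: power_mult_distrib mult.assoc)
    finally show ?thesis using False by simp
  qed simp
  have "(\<integral>z. of_real (W z) * ?G z \<partial>disk_measure) = of_real (\<integral>z. W z \<partial>disk_measure)"
    using S3 sums_single[of 0 "\<lambda>_. complex_of_real (\<integral>z. W z \<partial>disk_measure)"] unfolding zero
    by (intro sums_unique2[OF S3[unfolded zero]]) (simp cong: if_cong)
  moreover have aeq: "AE z in disk_measure. of_real (W z) * ?G z = of_real (pole_weight s z / (cmod (1 - c * z))\<^sup>2)"
    using AE_disk_measure
  proof eventually_elim
    fix z assume "cmod z < 1"
    from cz(1)[OF this] have "(cmod (c * z))\<^sup>2 < 1" by (simp add: abs_square_less_1)
    then have "1 - q * (cmod z)\<^sup>2 \<noteq> 0" by (simp add: q_def norm_mult power_mult_distrib)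
    then show "of_real (W z) * ?G z = of_real (pole_weight s z / (cmod (1 - c * z))\<^sup>2)"
      unfolding of_real_mult[symmetric] of_real_eq_iff
      by (simp add: W_def norm_mult power_mult_distrib q_def)
  qed
  have ae1: "(\<integral>z. of_real (W z) * ?G z \<partial>disk_measure) = (\<integral>z. complex_of_real (pole_weight s z / (cmod (1 - c * z))\<^sup>2) \<partial>disk_measure)"
    by (rule integral_cong_AE[OF _ _ aeq]) measurable
  have ae2: "integrable disk_measure (\<lambda>z. of_real (W z) * ?G z) \<longleftrightarrow> integrable disk_measure (\<lambda>z. complex_of_real (pole_weight s z / (cmod (1 - c * z))\<^sup>2))"
    by (rule integrable_cong_AE[OF _ _ aeq]) measurable
  ultimately have "complex_of_real (\<integral>z. pole_weight s z / (cmod (1 - c * z))\<^sup>2 \<partial>disk_measure) = of_real (\<integral>z. W z \<partial>disk_measure)"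
    unfolding integral_complex_of_real[symmetric] ae1[symmetric] by simp
  then show "(\<integral>z. pole_weight s z / (cmod (1 - c * z))\<^sup>2 \<partial>disk_measure)
       = pi * Gamma s * Gamma (1 - s) * (1 - (cmod c)\<^sup>2) powr (s - 1)"
    using integral_pole_weight_geometric(2)[OF s q] unfolding of_real_eq_iff W_def q_def by simp
  show "integrable disk_measure (\<lambda>z. pole_weight s z / (cmod (1 - c * z))\<^sup>2)"
    using S2 unfolding ae2 complex_of_real_integrable_eq .
qed

text \<open>The kernel of the potential of order \<open>2 - \<alpha>\<close>, with
  \<open>\<alpha> = 2 * s\<close>, multiplied by the weight of exponent \<open>s - 1\<close> that
  differentiation leaves behind.\<close>

definition riesz_kernel :: "real \<Rightarrow> complex \<Rightarrow> complex \<Rightarrow> real" where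
  "riesz_kernel s x z = (1 - (cmod z)\<^sup>2) powr (s - 1) * cmod (x - z) powr (- (2 * s))"

lemma measurable_riesz_kernel [measurable]: "riesz_kernel s x \<in> borel_measurable borel"
  unfolding riesz_kernel_def by measurable

section \<open>Automorphisms of the disk\<close>

lemma one_minus_cnj_mult_neq_0:
  assumes "cmod w < 1" "cmod z < 1"
  shows "1 - cnj w * z \<noteq> 0"
proof
  assume "1 - cnj w * z = 0"
  then have "cmod (cnj w * z) = 1" by simp
  moreover have "cmod (cnj w * z) < 1"
    using assms mult_left_le[of "cmod z" "cmod w"] by (auto simp: norm_mult)
  ultimately show False by simp
qed

lemma one_minus_cmod_square_pos: "cmod z < 1 \<Longrightarrow> 0 < 1 - (cmod z)\<^sup>2"
  by (simp add: abs_square_less_1)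

lemma power2_powr:
  fixes x a :: real
  assumes "0 \<le> x"
  shows "(x\<^sup>2) powr a = x powr (2 * a)"
proof (cases "x = 0")
  case False
  then have "x\<^sup>2 = x powr 2" using assms by (simp add: powr_numeral)
  then show ?thesis by (simp only: powr_powr)
qed simp

lemma cmod_mobius_identity:
  "(cmod (1 - cnj w * z))\<^sup>2 - (cmod (z - w))\<^sup>2 = (1 - (cmod w)\<^sup>2) * (1 - (cmod z)\<^sup>2)"
proof -
  have "complex_of_real ((cmod (1 - cnj w * z))\<^sup>2 - (cmod (z - w))\<^sup>2) = of_real ((1 - (cmod w)\<^sup>2) * (1 - (cmod z)\<^sup>2))"
    unfolding of_real_diff of_real_mult complex_norm_square of_real_1 by (simp add: algebra_simps)
  then show ?thesis unfolding of_real_eq_iff .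
qed

text \<open>The disk automorphism moving \<open>0\<close> to \<open>x\<close> carries the singularity of the Riesz kernel to the
  origin, where the angular average can be computed.\<close>

lemma riesz_kernel_generating_function:
  assumes s: "0 < s" "s < 1" and x: "cmod x < 1" and w: "cmod w < 1"
  shows "integrable disk_measure (\<lambda>z. riesz_kernel s x z / (cmod (1 - cnj w * z))\<^sup>2)"
    and "(\<integral>z. riesz_kernel s x z / (cmod (1 - cnj w * z))\<^sup>2 \<partial>disk_measure)
       = pi * Gamma s * Gamma (1 - s) * ((1 - (cmod w)\<^sup>2) powr (s - 1) * cmod (1 - cnj w * x) powr (- (2 * s)))"
proof -
  define m where "m = 1 - (cmod x)\<^sup>2"
  define A where "A = 1 - cnj w * x"
  \<comment> \<open>Chosen so that \<open>1 - cnj w * g z\<close> factors as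
    \<open>A * (1 - c * z) / (1 + cnj x * z)\<close>: the generating function is carried to one of
    the same shape with parameter \<open>c\<close>.\<close>
  define c where "c = (cnj w - cnj x) / A"
  define g where "g z = (x + z) / (1 + cnj x * z)" for z
  define g' where "g' z = of_real m / (1 + cnj x * z)\<^sup>2" for z
  define F where "F z = riesz_kernel s x z / (cmod (1 - cnj w * z))\<^sup>2" for z
  have [measurable]: "F \<in> borel_measurable borel" "g \<in> borel_measurable borel" "g' \<in> borel_measurable borel"
    unfolding F_def g_def g'_def by measurable
  have m: "m > 0" using one_minus_cmod_square_pos[OF x] by (simp add: m_def)
  have A: "A \<noteq> 0" unfolding A_def by (rule one_minus_cnj_mult_neq_0[OF w x])
  have D: "1 + cnj x * z \<noteq> 0" if "cmod z < 1" for z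
    using one_minus_cnj_mult_neq_0[of "- x" z] x that by simp
  have cA: "(cmod A)\<^sup>2 - (cmod (cnj w - cnj x))\<^sup>2 = (1 - (cmod w)\<^sup>2) * m"
    using cmod_mobius_identity[of w x] unfolding A_def m_def
    by (metis complex_cnj_diff complex_mod_cnj norm_minus_commute)
  have c2: "1 - (cmod c)\<^sup>2 = (1 - (cmod w)\<^sup>2) * m / (cmod A)\<^sup>2"
    using A cA by (simp add: c_def norm_divide power_divide field_simps)
  have c: "cmod c < 1"
  proof -
    have "1 - (cmod c)\<^sup>2 > 0" unfolding c2 using m A one_minus_cmod_square_pos[OF w] by simp
    then show ?thesis by (simp add: abs_square_less_1)
  qed
  have g_sq: "1 - (cmod (g z))\<^sup>2 = m * (1 - (cmod z)\<^sup>2) / (cmod (1 + cnj x * z))\<^sup>2" if "cmod z < 1" for z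
  proof -
    have "(cmod (1 + cnj x * z))\<^sup>2 - (cmod (x + z))\<^sup>2 = m * (1 - (cmod z)\<^sup>2)"
      using cmod_mobius_identity[of "- x" z] by (simp add: m_def add.commute)
    then show ?thesis using D[OF that] by (simp add: g_def norm_divide power_divide field_simps)
  qed
  have g_lt: "cmod (g z) < 1" if "cmod z < 1" for z
  proof -
    have "1 - (cmod (g z))\<^sup>2 > 0"
      unfolding g_sq[OF that] using m D[OF that] one_minus_cmod_square_pos[OF that] by simp
    then show ?thesis by (simp add: abs_square_less_1)
  qed
  have m_c: "of_real m = 1 - x * cnj x" by (simp add: m_def complex_norm_square del: of_real_power)
  have deriv: "(g has_field_derivative g' z) (at z)" if "cmod z < 1" for z
    unfolding g_def[abs_def] g'_def using D[OF that]
    by (auto intro!: derivative_eq_intros simp: m_c power2_eq_square field_simps)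
  have surj: "g ` ball 0 1 = ball 0 1"
  proof (intro equalityI subsetI)
    fix y assume "y \<in> ball (0::complex) 1"
    then have y: "cmod y < 1" by simp
    define z where "z = (y - x) / (1 - cnj x * y)"
    have d: "1 - cnj x * y \<noteq> 0" by (rule one_minus_cnj_mult_neq_0[OF x y])
    have "(cmod (y - x))\<^sup>2 < (cmod (1 - cnj x * y))\<^sup>2"
      using cmod_mobius_identity[of x y] m one_minus_cmod_square_pos[OF y]
      by (smt (verit) m_def mult_pos_pos)
    then have "cmod (y - x) < cmod (1 - cnj x * y)" by (rule power_less_imp_less_base) simp
    then have z: "cmod z < 1" using d by (simp add: z_def norm_divide)
    have "1 + cnj x * z = of_real m / (1 - cnj x * y)" "x + z = of_real m * y / (1 - cnj x * y)"
      using d by (simp_all add: z_def m_c field_simps)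
    then have "g z = y" using m d by (simp add: g_def)
    then show "y \<in> g ` ball 0 1" using z by (auto intro!: image_eqI[of _ _ z])
  qed (use g_lt in auto)
  have inj: "inj_on g (ball 0 1)"
  proof (rule inj_on_inverseI[where g = "\<lambda>y. (y - x) / (1 - cnj x * y)"])
    fix z assume "z \<in> ball (0::complex) 1"
    then have d: "1 + cnj x * z \<noteq> 0" using D by simp
    have "g z - x = of_real m * z / (1 + cnj x * z)" "1 - cnj x * g z = of_real m / (1 + cnj x * z)"
      using d by (simp_all add: g_def m_c field_simps)
    then show "(g z - x) / (1 - cnj x * g z) = z" using m d by simp
  qed
  \<comment> \<open>All powers of \<open>E = cmod (1 + cnj x * z)\<close> cancel: exponent
    \<open>- 4\<close> from the Jacobian, \<open>2 - 2 * s\<close> from the weight,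
    \<open>2 * s\<close> from the kernel and 2 from the generating function. This singles out the
    square in its denominator.\<close>
  have pt: "(cmod (g' z))\<^sup>2 * F (g z) = m powr (1 - s) / (cmod A)\<^sup>2 * (pole_weight s z / (cmod (1 - c * z))\<^sup>2)"
    if z: "cmod z < 1" for z
  proof -
    define E where "E = cmod (1 + cnj x * z)"
    have E: "E > 0" using D[OF z] by (simp add: E_def)
    define X where "X = 1 - (cmod z)\<^sup>2"
    have X: "X > 0" using one_minus_cmod_square_pos[OF z] by (simp add: X_def)
    have 1: "cmod (g' z) = m / E\<^sup>2" using m by (simp add: g'_def E_def norm_divide norm_power)
    have "x - g z = - (of_real m * z / (1 + cnj x * z))" using D[OF z] by (simp add: g_def m_c field_simps)
    then have 2: "cmod (x - g z) = m * cmod z / E" using m by (simp add: norm_divide norm_mult E_def)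
    have "1 - cnj w * g z = A * (1 - c * z) / (1 + cnj x * z)"
    proof -
      have "A * (1 - c * z) = A - (cnj w - cnj x) * z" using A by (simp add: c_def field_simps)
      then show ?thesis using D[OF z] by (simp add: g_def A_def field_simps)
    qed
    then have 3: "cmod (1 - cnj w * g z) = cmod A * cmod (1 - c * z) / E"
      by (simp only: norm_divide norm_mult E_def)
    define P where "P = E powr (2 * s)"
    have P: "P > 0" using E by (simp add: P_def)
    have e1: "(E\<^sup>2) powr (s - 1) = P / E\<^sup>2"
    proof -
      have "(E\<^sup>2) powr (s - 1) = E powr (2 * s - 2)"
        using E by (simp add: power2_powr algebra_simps)
      also have "\<dots> = P / E powr 2" by (simp add: powr_diff P_def)
      finally show ?thesis using E by (simp add: powr_numeral)
    qed
    have e2: "E powr (- (2 * s)) = 1 / P" by (simp add: P_def powr_minus_divide)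
    have m1: "m\<^sup>2 * m powr (s - 1) * m powr (- (2 * s)) = m powr (1 - s)"
    proof -
      have "m\<^sup>2 = m powr 2" using m by (simp add: powr_numeral)
      then show ?thesis by (simp add: powr_add[symmetric])
    qed
    have z1: "cmod z powr (- (2 * s)) = (cmod z)\<^sup>2 powr (- s)"
      by (simp add: power2_powr)
    have "(cmod (g' z))\<^sup>2 * F (g z) = (m / E\<^sup>2)\<^sup>2 * ((m * X / E\<^sup>2) powr (s - 1) * (m * cmod z / E) powr (- (2 * s)) / (cmod A * cmod (1 - c * z) / E)\<^sup>2)"
      unfolding F_def riesz_kernel_def 1 2 3 g_sq[OF z] X_def E_def ..
    also have "(m * X / E\<^sup>2) powr (s - 1) = m powr (s - 1) * X powr (s - 1) / (P / E\<^sup>2)"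
      using m X E by (simp add: powr_divide powr_mult e1)
    also have "(m * cmod z / E) powr (- (2 * s)) = m powr (- (2 * s)) * cmod z powr (- (2 * s)) * P"
      using m E P by (simp add: powr_divide powr_mult e2)
    also have "(m / E\<^sup>2)\<^sup>2 * (m powr (s - 1) * X powr (s - 1) / (P / E\<^sup>2) * (m powr (- (2 * s)) * cmod z powr (- (2 * s)) * P) / (cmod A * cmod (1 - c * z) / E)\<^sup>2)
       = (m\<^sup>2 * m powr (s - 1) * m powr (- (2 * s))) / (cmod A)\<^sup>2 * (cmod z powr (- (2 * s)) * X powr (s - 1) / (cmod (1 - c * z))\<^sup>2)"
      using E P A by (simp add: power_divide power_mult_distrib field_simps power2_eq_square)
    finally show ?thesis unfolding m1 z1 pole_weight_def X_def .
  qed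
  define K where "K z = m powr (1 - s) / (cmod A)\<^sup>2 * (pole_weight s z / (cmod (1 - c * z))\<^sup>2)" for z
  have [measurable]: "K \<in> borel_measurable borel" unfolding K_def by measurable
  note I = integral_pole_weight_poisson[OF s c]
  have K: "integrable disk_measure K" unfolding K_def by (intro integrable_mult_right I(1))
  have aeq: "AE z in disk_measure. complex_of_real ((cmod (g' z))\<^sup>2) * of_real (F (g z)) = of_real (K z)"
    using AE_disk_measure
  proof eventually_elim
    fix z assume "cmod z < 1"
    from pt[OF this] show "complex_of_real ((cmod (g' z))\<^sup>2) * of_real (F (g z)) = of_real (K z)"
      unfolding of_real_mult[symmetric] of_real_eq_iff K_def by simp
  qed
  have cov: "integrable disk_measure (\<lambda>z. complex_of_real ((cmod (g' z))\<^sup>2) * of_real (F (g z))) \<longleftrightarrow> integrable disk_measure (\<lambda>z. complex_of_real (F z))"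
    "(\<integral>z. complex_of_real ((cmod (g' z))\<^sup>2) * of_real (F (g z)) \<partial>disk_measure) = (\<integral>z. complex_of_real (F z) \<partial>disk_measure)"
    by (rule disk_change_of_variables[OF _ _ _ deriv inj surj]; simp)+
  have "integrable disk_measure (\<lambda>z. complex_of_real (K z))" using K by simp
  then have "integrable disk_measure (\<lambda>z. complex_of_real (F z))"
    unfolding cov(1)[symmetric] by (subst integrable_cong_AE[OF _ _ aeq]) measurable
  then show "integrable disk_measure (\<lambda>z. riesz_kernel s x z / (cmod (1 - cnj w * z))\<^sup>2)"
    unfolding complex_of_real_integrable_eq F_def .
  have "complex_of_real (\<integral>z. F z \<partial>disk_measure) = (\<integral>z. complex_of_real (F z) \<partial>disk_measure)" by simp
  also have "\<dots> = (\<integral>z. complex_of_real (K z) \<partial>disk_measure)"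
    unfolding cov(2)[symmetric] by (rule integral_cong_AE[OF _ _ aeq]) measurable
  finally have "(\<integral>z. F z \<partial>disk_measure) = (\<integral>z. K z \<partial>disk_measure)" by simp
  also have "\<dots> = m powr (1 - s) / (cmod A)\<^sup>2 * (pi * Gamma s * Gamma (1 - s) * (1 - (cmod c)\<^sup>2) powr (s - 1))"
    unfolding K_def integral_mult_right_zero using I(2) by simp
  also have "\<dots> = pi * Gamma s * Gamma (1 - s) * ((1 - (cmod w)\<^sup>2) powr (s - 1) * cmod A powr (- (2 * s)))"
  proof -
    define a where "a = cmod A"
    have a: "a > 0" using A by (simp add: a_def)
    have a2: "(a\<^sup>2) powr (s - 1) = a powr (2 * s) / a\<^sup>2"
    proof -
      have "(a\<^sup>2) powr (s - 1) = a powr (2 * s - 2)"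
        using a by (simp add: power2_powr algebra_simps)
      then show ?thesis using a by (simp add: powr_diff powr_numeral)
    qed
    have mm: "m powr (1 - s) * m powr (s - 1) = 1" using m by (simp add: powr_add[symmetric])
    have ap: "a powr (2 * s) > 0" using a by simp
    define Y where "Y = 1 - (cmod w)\<^sup>2"
    have "Y > 0" using one_minus_cmod_square_pos[OF w] by (simp add: Y_def)
    then have Ym: "(Y * m / a\<^sup>2) powr (s - 1) = Y powr (s - 1) * m powr (s - 1) / (a powr (2 * s) / a\<^sup>2)"
      using m a by (simp add: powr_divide powr_mult a2)
    have "m powr (1 - s) / a\<^sup>2 * (pi * Gamma s * Gamma (1 - s) * (Y powr (s - 1) * m powr (s - 1) / (a powr (2 * s) / a\<^sup>2)))
       = pi * Gamma s * Gamma (1 - s) * (Y powr (s - 1) * (1 / a powr (2 * s))) * (m powr (1 - s) * m powr (s - 1))"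
      using a ap by (simp add: divide_simps)
    then show ?thesis
      unfolding c2 a_def[symmetric] powr_minus_divide Y_def[symmetric] Ym mm by simp
  qed
  finally show "(\<integral>z. riesz_kernel s x z / (cmod (1 - cnj w * z))\<^sup>2 \<partial>disk_measure)
       = pi * Gamma s * Gamma (1 - s) * ((1 - (cmod w)\<^sup>2) powr (s - 1) * cmod (1 - cnj w * x) powr (- (2 * s)))"
    unfolding F_def A_def .
qed

text \<open>Identity theorem with real arguments only. Once the lower coefficients vanish, the
  series divided by \<open>r ^ n\<close> defines a function tending to \<open>a n\<close> at 0, and
  it vanishes at points accumulating there.\<close>

lemma power_series_zero_on_reals:
  fixes a :: "nat \<Rightarrow> complex"
  assumes "\<And>r::real. 0 \<le> r \<Longrightarrow> r < 1 \<Longrightarrow> (\<lambda>n. a n * of_real r ^ n) sums 0"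
  shows "a n = 0"
proof (induction n rule: less_induct)
  case (less n)
  define b where "b k = a (k + n)" for k
  define f where "f z = (\<Sum>k. b k * z ^ k)" for z
  have tail: "(\<lambda>k. a (k + n) * of_real r ^ (k + n)) sums 0" if "0 \<le> r" "r < 1" for r :: real
    using assms[OF that] less.IH by (subst sums_iff_shift) simp
  have zero: "(\<lambda>k. b k * of_real r ^ k) sums 0" if "0 < r" "r < 1" for r :: real
  proof -
    have "(\<lambda>k. a (k + n) * of_real r ^ (k + n) / of_real r ^ n) sums (0 / of_real r ^ n)"
      using that by (intro sums_divide tail) auto
    then show ?thesis using that by (simp add: b_def power_add)
  qed
  have sums: "(\<lambda>k. b k * z ^ k) sums f z" if "norm z < 1" for z
  proof -
    have "\<exists>r. norm z < r \<and> r < 1" using that by (rule dense)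
    then obtain r where r: "norm z < r" "r < 1" by blast
    then have "0 < r" using norm_ge_zero[of z] by linarith
    then have "summable (\<lambda>k. b k * of_real r ^ k)" using zero r by (auto simp: sums_iff)
    then have "summable (\<lambda>k. b k * z ^ k)" by (rule powser_inside) (use r \<open>0 < r\<close> in auto)
    then show ?thesis unfolding f_def by (rule summable_sums)
  qed
  have lim: "(f \<longlongrightarrow> b 0) (at 0)"
    using powser_limit_0[of 1 b f] sums by simp
  \<comment> \<open>The sample points \<open>1 / (j + 2)\<close> are nonzero, lie below 1 and tend
    to 0.\<close>
  have "filterlim (\<lambda>j. complex_of_real (inverse (real (Suc (Suc j))))) (at 0) sequentially"
  proof (rule filterlim_atI)
    have "(\<lambda>j. inverse (real (Suc (Suc j)))) \<longlonglongrightarrow> 0" 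
      by (rule LIMSEQ_Suc[OF LIMSEQ_inverse_real_of_nat])
    then show "(\<lambda>j. complex_of_real (inverse (real (Suc (Suc j))))) \<longlonglongrightarrow> 0"
      by (metis tendsto_of_real of_real_0)
    show "\<forall>\<^sub>F j in sequentially. complex_of_real (inverse (real (Suc (Suc j)))) \<noteq> 0"
    proof (intro always_eventually allI)
      fix j
      have "inverse (real (Suc (Suc j))) \<noteq> 0" by simp
      then show "complex_of_real (inverse (real (Suc (Suc j)))) \<noteq> 0" by (metis of_real_eq_0_iff)
    qed
  qed
  from filterlim_compose[OF lim this]
  have "(\<lambda>j. f (complex_of_real (inverse (real (Suc (Suc j)))))) \<longlonglongrightarrow> b 0" .
  moreover have "f (complex_of_real (inverse (real (Suc (Suc j))))) = 0" for j
    using zero[of "inverse (real (Suc (Suc j)))"] 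
    unfolding f_def by (simp add: sums_iff inverse_less_1_iff del: of_nat_Suc of_real_inverse)
  ultimately have "b 0 = 0" by (simp add: LIMSEQ_const_iff)
  then show ?case by (simp add: b_def)
qed

text \<open>Multiplication by \<open>cnj u ^ N\<close> turns the sum into a polynomial in
  \<open>v = cnj u ^ 2\<close>. Since \<open>v\<close> runs through the whole circle, the polynomial
  has infinitely many roots.\<close>

lemma homogeneous_zero_on_circle:
  fixes d :: "nat \<Rightarrow> complex"
  assumes "\<And>u. cmod u = 1 \<Longrightarrow> (\<Sum>a\<le>N. d a * (cnj u ^ a * u ^ (N - a))) = 0" and "a \<le> N"
  shows "d a = 0"
proof -
  have "(\<Sum>i\<le>N. d i * v ^ i) = 0" if v: "cmod v = 1" for v
  proof -
    obtain u where u: "cnj u ^ 2 = v" "cmod u = 1"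
    proof
      have "csqrt v ^ 2 = v" by simp
      then show "cnj (cnj (csqrt v)) ^ 2 = v" by simp
      have "(cmod (csqrt v))\<^sup>2 = 1" using v by (metis norm_power power2_csqrt)
      then show "cmod (cnj (csqrt v)) = 1" by (simp add: power2_eq_1_iff)
    qed
    have uu: "cnj u * u = 1" using u(2) by (metis complex_norm_square mult.commute of_real_1 one_power2)
    have "cnj u ^ N * (cnj u ^ a * u ^ (N - a)) = v ^ a" if "a \<le> N" for a
    proof -
      have "cnj u ^ N = cnj u ^ a * cnj u ^ (N - a)" using that by (simp flip: power_add)
      then have "cnj u ^ N * (cnj u ^ a * u ^ (N - a)) = (cnj u ^ a * cnj u ^ a) * ((cnj u * u) ^ (N - a))"
        unfolding power_mult_distrib by (simp add: mult_ac)
      then show ?thesis unfolding uu u(1)[symmetric] by (simp add: power_mult[symmetric] mult_2 flip: power_add)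
    qed
    then have "(\<Sum>i\<le>N. d i * v ^ i) = cnj u ^ N * (\<Sum>a\<le>N. d a * (cnj u ^ a * u ^ (N - a)))"
      unfolding sum_distrib_left by (intro sum.cong) (auto simp: mult_ac)
    then show ?thesis using assms(1)[OF u(2)] by simp
  qed
  then have "{v. cmod v = 1} \<subseteq> {v. (\<Sum>i\<le>N. d i * v ^ i) = 0}" by auto
  moreover have "infinite {v. cmod v = 1}"
  proof
    assume "finite {v. cmod v = 1}"
    then have "finite (Re ` {v. cmod v = 1})" by simp
    moreover have "{-1..1} \<subseteq> Re ` {v. cmod v = 1}"
    proof
      fix t :: real assume "t \<in> {-1..1}"
      then show "t \<in> Re ` {v. cmod v = 1}" by (intro image_eqI[of _ _ "cis (arccos t)"]) auto
    qed
    ultimately have "finite {-1..1::real}" by (rule rev_finite_subset)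
    then show False by (simp add: infinite_Icc)
  qed
  ultimately have "infinite {v. (\<Sum>i\<le>N. d i * v ^ i) = 0}" using infinite_super by blast
  then show ?thesis using polyfun_finite_roots[where c = d and n = N] assms(2) by blast
qed

section \<open>Expansion of the generating function\<close>

lemma complex_neg_binomial_sums:
  assumes "cmod v < 1"
  shows "(\<lambda>k. of_real (pochhammer a k / fact k) * v ^ k) sums ((1 - v) powr of_real (- a))"
proof -
  have "(\<lambda>k. (of_real (- a) gchoose k) * (- v) ^ k) sums ((1 + - v) powr of_real (- a))"
    using assms by (intro gen_binomial_complex) simp
  moreover have "(of_real (- a) gchoose k) * (- v) ^ k = of_real (pochhammer a k / fact k) * v ^ k" for k
    by (simp add: gbinomial_pochhammer power_minus[of v] pochhammer_of_real)
  ultimately show ?thesis by simp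
qed

lemma summable_neg_binomial:
  assumes "0 < a" "cmod v < 1"
  shows "summable (\<lambda>k. norm (of_real (pochhammer a k / fact k) * v ^ k))"
proof -
  have "norm (of_real (pochhammer a k / fact k) * v ^ k) = pochhammer a k / fact k * cmod v ^ k" for k
    using assms(1) by (simp add: norm_mult norm_power norm_divide pochhammer_nonneg pochhammer_of_real)
  then show ?thesis using neg_binomial_sums[of "cmod v" a] assms by (simp add: sums_iff)
qed

text \<open>The power of the norm is the product of the principal power
  \<open>(1 - v) powr (- a)\<close> and its conjugate; their Cauchy product groups the terms by
  total degree.\<close>

lemma norm_neg_binomial_square_sums:
  assumes "0 < a" "cmod v < 1"
  defines "q \<equiv> \<lambda>n. \<Sum>i\<le>n. of_real (pochhammer a i / fact i * (pochhammer a (n - i) / fact (n - i))) * v ^ i * cnj v ^ (n - i)"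
  shows "q sums of_real (cmod (1 - v) powr (- (2 * a)))" and "summable (\<lambda>n. norm (q n))"
proof -
  let ?f = "\<lambda>k. of_real (pochhammer a k / fact k) * v ^ k"
  let ?g = "\<lambda>k. of_real (pochhammer a k / fact k) * cnj v ^ k"
  have f: "summable (\<lambda>k. norm (?f k))" and g: "summable (\<lambda>k. norm (?g k))"
    using summable_neg_binomial[OF assms(1)] assms(2) by auto
  have q_eq: "q n = (\<Sum>i\<le>n. ?f i * ?g (n - i))" for n
    unfolding q_def by (intro sum.cong) (auto simp: mult_ac)
  have F: "suminf ?f = (1 - v) powr of_real (- a)"
    using complex_neg_binomial_sums[OF assms(2)] by (simp add: sums_iff)
  have "(\<lambda>k. cnj (?f k)) sums cnj ((1 - v) powr of_real (- a))"
    using complex_neg_binomial_sums[OF assms(2)] by (simp only: sums_cnj)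
  then have G: "suminf ?g = cnj ((1 - v) powr of_real (- a))" by (simp add: sums_iff)
  have "(suminf ?f) * (suminf ?g) = of_real ((cmod ((1 - v) powr of_real (- a)))\<^sup>2)"
    unfolding F G by (rule complex_norm_square[symmetric])
  also have "(cmod ((1 - v) powr of_real (- a)))\<^sup>2 = (cmod (1 - v) powr (- a))\<^sup>2"
    by (subst norm_powr_real_powr') auto
  also have "\<dots> = cmod (1 - v) powr (- (2 * a))"
    by (simp add: power2_eq_square powr_add[symmetric])
  finally show "q sums of_real (cmod (1 - v) powr (- (2 * a)))"
    using Cauchy_product_sums[OF f g] unfolding q_eq[abs_def] by simp
  have "summable (\<lambda>n. \<Sum>i\<le>n. norm (?f i) * norm (?g (n - i)))"
    using f g by (intro summable_Cauchy_product) simp_all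
  then show "summable (\<lambda>n. norm (q n))"
  proof (rule summable_comparison_test')
    show "norm (norm (q n)) \<le> (\<Sum>i\<le>n. norm (?f i) * norm (?g (n - i)))" for n
      unfolding q_eq real_norm_def abs_norm_cancel norm_mult[symmetric] by (rule norm_sum)
  qed
qed

text \<open>The series is written in powers of \<open>r\<close> with vanishing odd terms, so that
  its degrees add up correctly with those of the other factor in a Cauchy product.\<close>

lemma one_minus_square_powr_sums:
  fixes r :: real
  assumes "0 \<le> r" "r < 1" "0 < a"
  defines "p \<equiv> \<lambda>n. if even n then pochhammer a (n div 2) / fact (n div 2) * r ^ n else 0"
  shows "p sums ((1 - r\<^sup>2) powr (- a))" and "summable (\<lambda>n. norm (p n))"
proof -
  have "(\<lambda>k. p (2 * k)) sums ((1 - r\<^sup>2) powr (- a))"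
    using neg_binomial_sums[of "r\<^sup>2" a] assms(1,2) by (simp add: p_def power_mult abs_square_less_1)
  then show s: "p sums ((1 - r\<^sup>2) powr (- a))"
    by (subst (asm) sums_mono_reindex) (auto simp: strict_mono_def p_def elim!: evenE)
  have "norm (p n) = p n" for n using assms by (auto simp: p_def pochhammer_nonneg)
  then show "summable (\<lambda>n. norm (p n))" using s by (simp add: sums_iff)
qed

text \<open>The coefficient of \<open>cnj w ^ a * w ^ b\<close> in
  \<open>(1 - (cmod w)\<^sup>2) powr (s - 1) * cmod (1 - cnj w * x) powr (- 2 * s)\<close> is \<open>riesz_monomial s a b x\<close>;
  here \<open>w = r * u\<close>.\<close>

lemma riesz_monomial_generating:
  assumes s: "0 < s" "s < 1" and x: "cmod x < 1" and u: "cmod u = 1" and r: "0 \<le> r" "r < 1"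
  shows "(\<lambda>N. (\<Sum>a\<le>N. riesz_monomial s a (N - a) x * (cnj u ^ a * u ^ (N - a))) * of_real r ^ N) sums
    of_real ((1 - r\<^sup>2) powr (s - 1) * cmod (1 - cnj (of_real r * u) * x) powr (- (2 * s)))"
proof -
  define v where "v = cnj (of_real r * u) * x"
  define al where "al k = pochhammer (1 - s) k / fact k" for k
  define be where "be k = pochhammer s k / fact k" for k
  define p where "p n = (if even n then al (n div 2) * r ^ n else 0)" for n
  define q where "q n = (\<Sum>i\<le>n. of_real (be i * be (n - i)) * v ^ i * cnj v ^ (n - i))" for n
  have v: "cmod v < 1"
    using r x u mult_left_le[of "cmod x" r] by (auto simp: v_def norm_mult)
  have P: "p sums ((1 - r\<^sup>2) powr (s - 1))" "summable (\<lambda>n. norm (p n))"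
    unfolding p_def[abs_def] al_def using one_minus_square_powr_sums[OF r, of "1 - s"] s by simp_all
  have Q: "q sums of_real (cmod (1 - v) powr (- (2 * s)))" "summable (\<lambda>n. norm (q n))"
    using norm_neg_binomial_square_sums[OF s(1) v] by (simp_all add: q_def[abs_def] be_def)
  have uu: "cnj u * u = 1" using u by (metis complex_norm_square mult.commute of_real_1 one_power2)
  have "(\<lambda>N. \<Sum>k\<le>N. of_real (p k) * q (N - k)) sums ((\<Sum>k. of_real (p k)) * (\<Sum>k. q k))"
    using P(2) Q(2) by (intro Cauchy_product_sums) simp_all
  also have "(\<Sum>k. of_real (p k)) = complex_of_real ((1 - r\<^sup>2) powr (s - 1))"
    using P(1) by (intro sums_unique[symmetric] sums_of_real)
  also have "(\<Sum>k. q k) = of_real (cmod (1 - v) powr (- (2 * s)))"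
    using Q(1) by (rule sums_unique[symmetric])
  finally have S: "(\<lambda>N. \<Sum>k\<le>N. of_real (p k) * q (N - k)) sums
      of_real ((1 - r\<^sup>2) powr (s - 1) * cmod (1 - v) powr (- (2 * s)))"
    by (simp del: of_real_diff)
  have "(\<Sum>k\<le>N. of_real (p k) * q (N - k)) = (\<Sum>a\<le>N. riesz_monomial s a (N - a) x * (cnj u ^ a * u ^ (N - a))) * of_real r ^ N" for N
  proof -
    define t where "t k i = of_real (p k) * (of_real (be i * be (N - k - i)) * v ^ i * cnj v ^ (N - k - i))" for k i
    define h where "h a j = of_real (al j * (be (a - j) * be (N - a - j))) * x ^ (a - j) * cnj x ^ (N - a - j) * (cnj u ^ a * u ^ (N - a)) * of_real r ^ N" for a j
    have "(\<Sum>k\<le>N. of_real (p k) * q (N - k)) = (\<Sum>(k, i)\<in>Sigma {..N} (\<lambda>k. {..N - k}). t k i)"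
      unfolding q_def sum_distrib_left t_def by (rule sum.Sigma) auto
    also have "\<dots> = (\<Sum>(k, i)\<in>{(k, i). even k \<and> k + i \<le> N}. t k i)"
      by (rule sum.mono_neutral_right) (auto simp: t_def p_def split: if_splits)
    also have "\<dots> = (\<Sum>(a, j)\<in>Sigma {..N} (\<lambda>a. {..min a (N - a)}). h a j)"
    \<comment> \<open>The factor \<open>(1 - r\<^sup>2) powr (s - 1)\<close> contributes
      \<open>r ^ (2 * j)\<close>, which stands for \<open>j\<close> factors \<open>cnj w\<close> and
      \<open>j\<close> factors \<open>w\<close>. Together with \<open>i\<close> factors
      \<open>cnj w * x\<close> this gives the exponent \<open>a = i + j\<close> of
      \<open>cnj w\<close>.\<close>
    proof (rule sum.reindex_bij_witness[of _ "\<lambda>(a, j). (2 * j, a - j)" "\<lambda>(k, i). (i + k div 2, k div 2)"])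
      fix z assume "z \<in> {(k, i). even k \<and> k + i \<le> N}"
      then obtain j i where z: "z = (2 * j, i)" and ji: "2 * j + i \<le> N" by (auto elim!: evenE)
      define l where "l = N - 2 * j - i"
      have N: "N = 2 * j + i + l" using ji by (simp add: l_def)
      show "(case z of (k, i) \<Rightarrow> (i + k div 2, k div 2)) \<in> Sigma {..N} (\<lambda>a. {..min a (N - a)})"
        using ji by (auto simp: z)
      show "(case case z of (k, i) \<Rightarrow> (i + k div 2, k div 2) of (a, j) \<Rightarrow> (2 * j, a - j)) = z" by (simp add: z)
      have uj: "cnj u ^ j * u ^ j = 1" by (simp flip: power_mult_distrib add: uu)
      have "h (i + j) j = of_real (al j * (be i * be l)) * x ^ i * cnj x ^ l * (cnj u ^ i * u ^ l * (cnj u ^ j * u ^ j)) * of_real r ^ (2 * j + i + l)"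
        by (simp add: h_def N power_add mult_ac)
      also have "\<dots> = t (2 * j) i"
        unfolding uj by (simp add: t_def p_def N v_def power_mult_distrib power_add mult_ac)
      finally show "(case case z of (k, i) \<Rightarrow> (i + k div 2, k div 2) of (a, j) \<Rightarrow> h a j) = (case z of (k, i) \<Rightarrow> t k i)"
        by (simp add: z)
    next
      fix z assume "z \<in> Sigma {..N} (\<lambda>a. {..min a (N - a)})"
      then obtain a j where z: "z = (a, j)" "a \<le> N" "j \<le> a" "j \<le> N - a" by auto
      then show "(case z of (a, j) \<Rightarrow> (2 * j, a - j)) \<in> {(k, i). even k \<and> k + i \<le> N}" by auto
      show "(case case z of (a, j) \<Rightarrow> (2 * j, a - j) of (k, i) \<Rightarrow> (i + k div 2, k div 2)) = z" using z by auto
    qed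
    also have "\<dots> = (\<Sum>a\<le>N. \<Sum>j\<le>min a (N - a). h a j)"
      by (rule sum.Sigma[symmetric]) auto
    also have "\<dots> = (\<Sum>a\<le>N. riesz_monomial s a (N - a) x * (cnj u ^ a * u ^ (N - a))) * of_real r ^ N"
      unfolding riesz_monomial_def h_def al_def be_def sum_distrib_right by (simp add: mult.assoc)
    finally show ?thesis .
  qed
  with S show ?thesis unfolding v_def by simp
qed

text \<open>Both sides have the same generating function in \<open>w\<close>. On each ray
  \<open>w = r * u\<close>, comparing powers of \<open>r\<close> isolates the total degree; letting
  \<open>u\<close> run over the circle then separates the exponents \<open>a\<close> and
  \<open>b\<close>.\<close>

lemma riesz_kernel_monomial:
  assumes s: "0 < s" "s < 1" and x: "cmod x < 1"
  shows "integrable disk_measure (\<lambda>z. of_real (riesz_kernel s x z) * (z ^ a * cnj z ^ b))"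
    and "(\<integral>z. of_real (riesz_kernel s x z) * (z ^ a * cnj z ^ b) \<partial>disk_measure)
      = of_real (pi * Gamma s * Gamma (1 - s)) * riesz_monomial s a b x"
proof -
  define C where "C = pi * Gamma s * Gamma (1 - s)"
  define K where "K = riesz_kernel s x"
  have [measurable]: "K \<in> borel_measurable borel" unfolding K_def by measurable
  have K: "integrable disk_measure K"
    using riesz_kernel_generating_function(1)[OF s x, of 0] by (simp add: K_def)
  have int: "integrable disk_measure (\<lambda>z. of_real (K z) * (z ^ a * cnj z ^ b))" for a b
  proof (rule Bochner_Integration.integrable_bound[OF K])
    show "AE z in disk_measure. norm (of_real (K z) * (z ^ a * cnj z ^ b)) \<le> norm (K z)"
      using AE_disk_measure
      by eventually_elim (auto simp: norm_mult norm_power intro!: mult_left_le mult_le_one power_le_one)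
  qed measurable
  then show "integrable disk_measure (\<lambda>z. of_real (riesz_kernel s x z) * (z ^ a * cnj z ^ b))"
    unfolding K_def .
  define mom where "mom a b = (\<integral>z. of_real (K z) * (z ^ a * cnj z ^ b) \<partial>disk_measure)" for a b
  define d where "d N a = mom a (N - a) - of_real C * riesz_monomial s a (N - a) x" for N a
  have series: "(\<lambda>N. (\<Sum>a\<le>N. d N a * (cnj u ^ a * u ^ (N - a))) * of_real r ^ N) sums 0"
    if u: "cmod u = 1" and r: "0 \<le> r" "r < 1" for u r
  proof -
    define w where "w = of_real r * u"
    have w: "cmod w = r" using u r by (simp add: w_def norm_mult)
    define g where "g N z = (\<Sum>i\<le>N. (cnj w * z) ^ i * (w * cnj z) ^ (N - i))" for N z
    define B where "B N = (\<Sum>i\<le>N. r ^ i * r ^ (N - i))" for N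
    have gm: "g N \<in> borel_measurable borel" for N unfolding g_def by measurable
    have B: "summable B" unfolding B_def using r by (intro summable_Cauchy_product) auto
    have wz: "cmod (cnj w * z) \<le> r" "cmod (w * cnj z) \<le> r" "cmod (cnj w * z) < 1" "cmod (w * cnj z) < 1" if "cmod z < 1" for z
      using that r w mult_left_le[of "cmod z" r] by (auto simp: norm_mult)
    have bound: "cmod (g N z) \<le> B N" if "cmod z < 1" for N z
      unfolding g_def B_def using wz[OF that] r
      by (intro order.trans[OF norm_sum] sum_mono) (auto simp: norm_mult[of "_ ^ _"] norm_power intro!: mult_mono power_mono)
    have sums: "(\<lambda>N. g N z) sums of_real (1 / (cmod (1 - cnj w * z))\<^sup>2)" if "cmod z < 1" for z
    proof -
      have n: "summable (\<lambda>n. norm ((cnj w * z) ^ n))" "summable (\<lambda>n. norm ((w * cnj z) ^ n))"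
        using wz[OF that] by (auto simp: norm_power intro!: summable_geometric)
      have "(\<lambda>N. g N z) sums ((1 / (1 - cnj w * z)) * (1 / (1 - w * cnj z)))"
        using Cauchy_product_sums[OF n] wz[OF that] unfolding g_def by (simp add: suminf_geometric)
      also have "(1 / (1 - cnj w * z)) * (1 / (1 - w * cnj z)) = of_real (1 / (cmod (1 - cnj w * z))\<^sup>2)"
        by (simp add: complex_norm_square del: of_real_power)
      finally show ?thesis .
    qed
    have "(\<lambda>N. \<integral>z. of_real (K z) * g N z \<partial>disk_measure) sums
        (\<integral>z. of_real (K z) * of_real (1 / (cmod (1 - cnj w * z))\<^sup>2) \<partial>disk_measure)"
      by (rule disk_measure_sums(3)[OF K gm bound B sums]) measurable
    also have "(\<integral>z. of_real (K z) * of_real (1 / (cmod (1 - cnj w * z))\<^sup>2) \<partial>disk_measure)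
        = complex_of_real (\<integral>z. K z / (cmod (1 - cnj w * z))\<^sup>2 \<partial>disk_measure)"
      unfolding integral_complex_of_real[symmetric] by simp
    also have "\<dots> = of_real C * of_real ((1 - r\<^sup>2) powr (s - 1) * cmod (1 - cnj w * x) powr (- (2 * s)))"
      using riesz_kernel_generating_function(2)[OF s x, of w] w r by (simp add: K_def C_def)
    finally have 1: "(\<lambda>N. \<integral>z. of_real (K z) * g N z \<partial>disk_measure) sums
        (of_real C * of_real ((1 - r\<^sup>2) powr (s - 1) * cmod (1 - cnj w * x) powr (- (2 * s))))" .
    have 2: "(\<integral>z. of_real (K z) * g N z \<partial>disk_measure) = (\<Sum>a\<le>N. mom a (N - a) * (cnj u ^ a * u ^ (N - a))) * of_real r ^ N" for N
    proof -
      have "of_real (K z) * g N z = (\<Sum>a\<le>N. (of_real (K z) * (z ^ a * cnj z ^ (N - a))) * (cnj u ^ a * u ^ (N - a) * of_real r ^ N))" for z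
        unfolding g_def sum_distrib_left
      proof (rule sum.cong[OF refl])
        fix a assume "a \<in> {..N}"
        then have "of_real r ^ N = of_real r ^ a * (of_real r ^ (N - a) :: complex)" by (simp flip: power_add)
        then show "of_real (K z) * ((cnj w * z) ^ a * (w * cnj z) ^ (N - a)) = (of_real (K z) * (z ^ a * cnj z ^ (N - a))) * (cnj u ^ a * u ^ (N - a) * of_real r ^ N)"
          by (simp add: w_def power_mult_distrib mult_ac)
      qed
      then have "(\<integral>z. of_real (K z) * g N z \<partial>disk_measure) = (\<Sum>a\<le>N. \<integral>z. (of_real (K z) * (z ^ a * cnj z ^ (N - a))) * (cnj u ^ a * u ^ (N - a) * of_real r ^ N) \<partial>disk_measure)"
        using int by (simp only:) (intro Bochner_Integration.integral_sum integrable_mult_left, simp)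
      also have "\<dots> = (\<Sum>a\<le>N. mom a (N - a) * (cnj u ^ a * u ^ (N - a) * of_real r ^ N))"
        unfolding mom_def integral_mult_left_zero ..
      finally show ?thesis by (simp add: sum_distrib_right mult.assoc)
    qed
    have "(\<lambda>N. (\<Sum>a\<le>N. mom a (N - a) * (cnj u ^ a * u ^ (N - a))) * of_real r ^ N
        - of_real C * ((\<Sum>a\<le>N. riesz_monomial s a (N - a) x * (cnj u ^ a * u ^ (N - a))) * of_real r ^ N)) sums 0"
      using sums_diff[OF 1[unfolded 2] sums_mult[OF riesz_monomial_generating[OF s x u r], of "of_real C"]]
      by (simp add: w_def)
    moreover have "(\<Sum>a\<le>N. mom a (N - a) * (cnj u ^ a * u ^ (N - a))) * of_real r ^ N
        - of_real C * ((\<Sum>a\<le>N. riesz_monomial s a (N - a) x * (cnj u ^ a * u ^ (N - a))) * of_real r ^ N)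
      = (\<Sum>a\<le>N. d N a * (cnj u ^ a * u ^ (N - a))) * of_real r ^ N" for N
      by (simp add: d_def left_diff_distrib sum_subtractf sum_distrib_left sum_distrib_right mult.assoc)
    ultimately show ?thesis by simp
  qed
  have "(\<Sum>a\<le>N. d N a * (cnj u ^ a * u ^ (N - a))) = 0" if "cmod u = 1" for u N
    using power_series_zero_on_reals[of "\<lambda>N. \<Sum>a\<le>N. d N a * (cnj u ^ a * u ^ (N - a))"] series[OF that] by blast
  then have "d (a + b) a = 0" 
    by (rule homogeneous_zero_on_circle[where N = "a + b"]) auto
  then show "(\<integral>z. of_real (riesz_kernel s x z) * (z ^ a * cnj z ^ b) \<partial>disk_measure)
      = of_real (pi * Gamma s * Gamma (1 - s)) * riesz_monomial s a b x"
    unfolding d_def mom_def K_def C_def by simp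
qed

lemma measurable_zernike [measurable]: "zernike \<sigma> a b \<in> borel_measurable borel"
  unfolding zernike_def[abs_def] by measurable

lemma riesz_kernel_zernike:
  assumes s: "0 < s" "s < 1" and x: "cmod x < 1"
  shows "integrable disk_measure (\<lambda>z. of_real (riesz_kernel s x z) * zernike (s - 1) a b z)"
    and "(\<integral>z. of_real (riesz_kernel s x z) * zernike (s - 1) a b z \<partial>disk_measure)
      = of_real (pi * Gamma (1 - s) / Gamma s * (Gamma (s + real a) * Gamma (s + real b) / (fact a * fact b))) * zernike (s - 1) a b x"
proof -
  let ?K = "\<lambda>z. complex_of_real (riesz_kernel s x z)"
  note M = riesz_kernel_monomial[OF s x]
  have eq: "?K z * zernike (s - 1) a b z = (\<Sum>j\<le>a. of_real (zernike_coeff (s - 1) a b j) * (?K z * (z ^ (a - j) * cnj z ^ (b - j))))" for z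
    by (simp add: zernike_def sum_distrib_left mult_ac)
  show "integrable disk_measure (\<lambda>z. ?K z * zernike (s - 1) a b z)"
    unfolding eq by (intro Bochner_Integration.integrable_sum integrable_mult_right M(1))
  have "(\<integral>z. ?K z * zernike (s - 1) a b z \<partial>disk_measure)
     = (\<Sum>j\<le>a. of_real (zernike_coeff (s - 1) a b j) * (of_real (pi * Gamma s * Gamma (1 - s)) * riesz_monomial s (a - j) (b - j) x))"
    unfolding eq by (subst Bochner_Integration.integral_sum)
      (intro integrable_mult_right M(1), simp only: integral_mult_right_zero M(2))
  also have "\<dots> = of_real (pi * Gamma s * Gamma (1 - s)) * (\<Sum>j\<le>a. of_real (zernike_coeff (s - 1) a b j) * riesz_monomial s (a - j) (b - j) x)"
    by (simp add: sum_distrib_left mult_ac)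
  also have "\<dots> = of_real (pi * Gamma s * Gamma (1 - s) * (pochhammer s a * pochhammer s b / (fact a * fact b))) * zernike (s - 1) a b x"
    unfolding zernike_riesz_monomial[OF s] by simp
  also have "pi * Gamma s * Gamma (1 - s) * (pochhammer s a * pochhammer s b / (fact a * fact b))
     = pi * Gamma (1 - s) / Gamma s * (Gamma (s + real a) * Gamma (s + real b) / (fact a * fact b))"
  proof -
    have p: "pochhammer s n = Gamma (s + real n) / Gamma s" for n
      using s by (intro pochhammer_Gamma) (auto elim!: nonpos_Ints_cases)
    have "Gamma s > 0" using s by (intro Gamma_real_pos)
    then show ?thesis unfolding p by (simp add: field_simps)
  qed
  finally show "(\<integral>z. ?K z * zernike (s - 1) a b z \<partial>disk_measure)
      = of_real (pi * Gamma (1 - s) / Gamma s * (Gamma (s + real a) * Gamma (s + real b) / (fact a * fact b))) * zernike (s - 1) a b x" .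
qed

section \<open>Passage to real functions on the plane\<close>

lemma lborel_distr_minus:
  fixes x :: "'a::euclidean_space"
  shows "distr lborel borel (\<lambda>y. x - y) = lborel"
  using lborel_affine[of "-1" x] by (simp add: density_1)

lemma riesz_potential_disk:
  assumes [measurable]: "h \<in> borel_measurable borel"
    and g: "\<And>y. g y = (if y \<in> unit_disk then h (to_complex y) else 0)"
  shows "riesz_potential \<alpha> g x
     = 1 / riesz_const \<alpha> * (\<integral>z. h z * cmod (to_complex x - z) powr (- \<alpha>) \<partial>disk_measure)"
proof -
  let ?F = "\<lambda>y. g (x - y) / norm y powr \<alpha>"
  let ?H = "\<lambda>z. h z * cmod (to_complex x - z) powr (- \<alpha>)"
  have tc: "to_complex (x - y) = to_complex x - to_complex y" for y
    by (rule linear_diff[OF bounded_linear.linear[OF bounded_linear_to_complex]])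
  have [measurable]: "(\<lambda>y. h (to_complex y)) \<in> borel_measurable borel" by measurable
  have [measurable]: "g \<in> borel_measurable borel"
    unfolding g[abs_def] by (rule measurable_If_set) auto
  have "integral\<^sup>L lebesgue ?F = integral\<^sup>L lborel ?F" by (rule integral_completion) measurable
  also have "\<dots> = integral\<^sup>L (distr lborel borel (\<lambda>y. x - y)) ?F" by (simp only: lborel_distr_minus)
  also have "\<dots> = integral\<^sup>L lborel (\<lambda>y. ?F (x - y))" by (rule integral_distr) measurable
  also have "\<dots> = integral\<^sup>L lborel (\<lambda>y. indicator unit_disk y *\<^sub>R ?H (to_complex y))"
    by (intro Bochner_Integration.integral_cong)
      (auto simp: g powr_minus_divide tc[symmetric] split: split_indicator)
  also have "\<dots> = integral\<^sup>L lebesgue (\<lambda>y. indicator unit_disk y *\<^sub>R ?H (to_complex y))"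
  proof (rule integral_completion[symmetric])
    have "(\<lambda>y. ?H (to_complex y)) \<in> borel_measurable borel"
      by (rule measurable_compose[OF measurable_to_complex]) measurable
    then show "(\<lambda>y. indicator unit_disk y *\<^sub>R ?H (to_complex y)) \<in> borel_measurable lborel"
      unfolding measurable_lborel1 by (intro borel_measurable_scaleR borel_measurable_indicator) auto
  qed
  also have "\<dots> = integral\<^sup>L disk_measure ?H"
    using set_integral_disk_eq[of ?H] by (simp add: set_lebesgue_integral_def)
  finally show ?thesis unfolding riesz_potential_def by simp
qed

text \<open>The map \<open>p\<close> is only real linear, so that multiples of real and imaginary
  parts are treated at once. Agreement on the open disk suffices because differentiation is
  local.\<close>

lemma partial_eqI:
  assumes "x \<in> unit_disk" and F: "(F has_derivative D) (at (to_complex x))"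
    and p: "bounded_linear p" and g: "\<And>y. y \<in> unit_disk \<Longrightarrow> g y = p (F (to_complex y))"
  shows "partial i g x = p (D (to_complex (axis i 1)))"
proof -
  interpret p: bounded_linear p by fact
  interpret D: bounded_linear D using F by (rule has_derivative_bounded_linear)
  interpret tc: bounded_linear to_complex by (rule bounded_linear_to_complex)
  have 1: "((\<lambda>t. x + t *\<^sub>R axis i 1) has_derivative (\<lambda>t. t *\<^sub>R axis i 1)) (at (0::real))"
    by (auto intro!: derivative_eq_intros)
  have "((\<lambda>t. p (F (to_complex (x + t *\<^sub>R axis i 1)))) has_derivative (\<lambda>t. p (D (to_complex (t *\<^sub>R axis i 1))))) (at 0)"
    by (intro p.has_derivative has_derivative_compose[OF tc.has_derivative[OF 1]]) (simp add: F)
  also have "(\<lambda>t. p (D (to_complex (t *\<^sub>R axis i 1)))) = (*) (p (D (to_complex (axis i 1))))"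
    by (simp add: tc.scaleR D.scaleR p.scaleR mult.commute fun_eq_iff)
  finally have "((\<lambda>t. p (F (to_complex (x + t *\<^sub>R axis i 1)))) has_real_derivative p (D (to_complex (axis i 1)))) (at 0)"
    unfolding has_field_derivative_def .
  moreover have "\<forall>\<^sub>F t in nhds 0. p (F (to_complex (x + t *\<^sub>R axis i 1))) = g (x + t *\<^sub>R axis i 1)"
  proof -
    have "((\<lambda>t. x + t *\<^sub>R axis i 1) \<longlongrightarrow> x + 0 *\<^sub>R axis i 1) (nhds (0::real))"
      by (intro tendsto_intros filterlim_ident)
    then have "\<forall>\<^sub>F t in nhds (0::real). x + t *\<^sub>R axis i 1 \<in> unit_disk"
      by (rule topological_tendstoD) (use assms(1) in auto)
    then show ?thesis by eventually_elim (simp add: g)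
  qed
  ultimately have "((\<lambda>t. g (x + t *\<^sub>R axis i 1)) has_real_derivative p (D (to_complex (axis i 1)))) (at 0)"
    using DERIV_cong_ev[of 0 0 "\<lambda>t. p (F (to_complex (x + t *\<^sub>R axis i 1)))" "\<lambda>t. g (x + t *\<^sub>R axis i 1)"] by auto
  then show ?thesis unfolding partial_def by (rule DERIV_imp_deriv)
qed

definition riesz_eigenvalue :: "real \<Rightarrow> nat \<Rightarrow> nat \<Rightarrow> real" where
  "riesz_eigenvalue s a b = 4 powr (s - 1) * Gamma (s + real a) * Gamma (s + real b) / (fact a * fact b)"

lemma riesz_const_eigenvalue:
  assumes s: "0 < s" "s < 1"
  shows "1 / riesz_const (2 * s) * (pi * Gamma (1 - s) / Gamma s * (Gamma (s + real a) * Gamma (s + real b) / (fact a * fact b)))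
     = riesz_eigenvalue s a b"
proof -
  have G: "Gamma s > 0" "Gamma (1 - s) > 0" using s by (auto intro!: Gamma_real_pos)
  have "(4::real) powr (s - 1) = (2 powr 2) powr (s - 1)" by (simp add: powr_numeral)
  also have "\<dots> = 1 / 2 powr (2 - 2 * s)"
    unfolding powr_powr by (simp add: powr_minus_divide[symmetric] algebra_simps)
  finally show ?thesis
    unfolding riesz_const_def riesz_eigenvalue_def using G by (simp add: field_simps)
qed

text \<open>Two terms appear because each component of a gradient mixes the derivatives in
  \<open>z\<close> and \<open>cnj z\<close>. Being real linear, \<open>p\<close> commutes with the
  integral and with the real kernel.\<close>

lemma riesz_potential_weighted_zernike:
  assumes s: "0 < s" "s < 1" and x: "x \<in> unit_disk" and p: "bounded_linear (p :: complex \<Rightarrow> real)"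
    and g: "\<And>y. y \<in> unit_disk \<Longrightarrow> g y = p (c * (of_real ((1 - (norm y)\<^sup>2) powr (s - 1)) * zernike (s - 1) a b (to_complex y))
        + c' * (of_real ((1 - (norm y)\<^sup>2) powr (s - 1)) * zernike (s - 1) a' b' (to_complex y)))"
    and g0: "\<And>y. y \<notin> unit_disk \<Longrightarrow> g y = 0"
  shows "riesz_potential (2 * s) g x = p (c * of_real (riesz_eigenvalue s a b) * zernike (s - 1) a b (to_complex x)
      + c' * of_real (riesz_eigenvalue s a' b') * zernike (s - 1) a' b' (to_complex x))"
proof -
  interpret p: bounded_linear p by fact
  have [measurable]: "p \<in> borel_measurable borel"
    by (intro borel_measurable_continuous_onI p.continuous_on continuous_on_id)
  define h where "h z = p (c * (of_real ((1 - (cmod z)\<^sup>2) powr (s - 1)) * zernike (s - 1) a b z)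
        + c' * (of_real ((1 - (cmod z)\<^sup>2) powr (s - 1)) * zernike (s - 1) a' b' z))" for z
  have [measurable]: "h \<in> borel_measurable borel" unfolding h_def by measurable
  have x': "cmod (to_complex x) < 1" using x by simp
  let ?K = "\<lambda>z. complex_of_real (riesz_kernel s (to_complex x) z)"
  note R = riesz_kernel_zernike[OF s x']
  have hK: "h z * cmod (to_complex x - z) powr (- (2 * s)) = p (c * (?K z * zernike (s - 1) a b z) + c' * (?K z * zernike (s - 1) a' b' z))" for z
  proof -
    have "h z * cmod (to_complex x - z) powr (- (2 * s)) = cmod (to_complex x - z) powr (- (2 * s)) *\<^sub>R h z"
      by simp
    also have "\<dots> = p (cmod (to_complex x - z) powr (- (2 * s)) *\<^sub>R (c * (of_real ((1 - (cmod z)\<^sup>2) powr (s - 1)) * zernike (s - 1) a b z)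
        + c' * (of_real ((1 - (cmod z)\<^sup>2) powr (s - 1)) * zernike (s - 1) a' b' z)))"
      unfolding h_def p.scaleR ..
    also have "\<dots> = p (c * (?K z * zernike (s - 1) a b z) + c' * (?K z * zernike (s - 1) a' b' z))"
      by (rule arg_cong[of _ _ p]) (simp add: riesz_kernel_def scaleR_conv_of_real algebra_simps)
    finally show ?thesis .
  qed
  have "riesz_potential (2 * s) g x = 1 / riesz_const (2 * s) * (\<integral>z. h z * cmod (to_complex x - z) powr (- (2 * s)) \<partial>disk_measure)"
    by (rule riesz_potential_disk) (auto simp: h_def g g0)
  also have "(\<integral>z. h z * cmod (to_complex x - z) powr (- (2 * s)) \<partial>disk_measure)
     = p (\<integral>z. c * (?K z * zernike (s - 1) a b z) + c' * (?K z * zernike (s - 1) a' b' z) \<partial>disk_measure)"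
    unfolding hK by (intro integral_bounded_linear[OF p] Bochner_Integration.integrable_add integrable_mult_right R(1))
  also have "(\<integral>z. c * (?K z * zernike (s - 1) a b z) + c' * (?K z * zernike (s - 1) a' b' z) \<partial>disk_measure)
     = c * (\<integral>z. ?K z * zernike (s - 1) a b z \<partial>disk_measure) + c' * (\<integral>z. ?K z * zernike (s - 1) a' b' z \<partial>disk_measure)"
    by (subst Bochner_Integration.integral_add) (intro integrable_mult_right R(1), intro integrable_mult_right R(1), simp only: integral_mult_right_zero)
  also have "1 / riesz_const (2 * s) * p \<dots> = p (of_real (1 / riesz_const (2 * s)) * \<dots>)"
    unfolding scaleR_conv_of_real[symmetric] p.scaleR by simp
  also have "of_real (1 / riesz_const (2 * s)) * (c * (\<integral>z. ?K z * zernike (s - 1) a b z \<partial>disk_measure) + c' * (\<integral>z. ?K z * zernike (s - 1) a' b' z \<partial>disk_measure))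
     = c * of_real (riesz_eigenvalue s a b) * zernike (s - 1) a b (to_complex x)
      + c' * of_real (riesz_eigenvalue s a' b') * zernike (s - 1) a' b' (to_complex x)"
    unfolding R(2) riesz_const_eigenvalue[OF s, symmetric] of_real_mult by (simp add: algebra_simps)
  finally show ?thesis .
qed

text \<open>The gradient raises an index, the potential multiplies by an eigenvalue, the divergence
  lowers an index. If different indices are raised and lowered, a neighbour of \<open>(a, b)\<close>
  results; its factor is \<open>k1 - k2\<close>, since the axis directions 1 and \<open>\<i>\<close>
  enter squared. If the same index is raised and lowered, the result is \<open>(a, b)\<close> again,
  with factor \<open>k1 + k2\<close>.\<close>

lemma frac_diffusion_weighted_zernike:
  assumes s: "0 < s" "s < 1" and x: "x \<in> unit_disk" and p: "bounded_linear (p :: complex \<Rightarrow> real)"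
    and K: "K = vector [vector [k1, 0], vector [0, k2]]"
    and w: "\<And>y. y \<in> unit_disk \<Longrightarrow> w y = p (of_real ((1 - (norm y)\<^sup>2) powr s) * zernike s a b (to_complex y))"
  defines "ga \<equiv> Gamma (s + real a + 1)" and "gb \<equiv> Gamma (s + real b + 1)"
  shows "frac_diffusion (2 * s) K w x = 4 powr (s - 1) * p (
      of_real (2 * (k1 + k2) * (ga * gb / (fact a * fact b))) * zernike s a b (to_complex x)
      + of_real (k1 - k2) * (of_real (real a * (ga * gb / (fact a * fact (b + 1)))) * zernike s (a - 1) (b + 1) (to_complex x)
          + of_real (real b * (ga * gb / (fact (a + 1) * fact b))) * zernike s (a + 1) (b - 1) (to_complex x)))"
proof -
  interpret p: bounded_linear p by fact
  define A where "A y = of_real ((1 - (norm y)\<^sup>2) powr (s - 1)) * zernike (s - 1) a (Suc b) (to_complex y)" for y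
  define B where "B y = of_real ((1 - (norm y)\<^sup>2) powr (s - 1)) * zernike (s - 1) (Suc a) b (to_complex y)" for y
  have grad: "partial i w y = p (- of_real (s + real a) * to_complex (axis i 1) * A y - of_real (s + real b) * cnj (to_complex (axis i 1)) * B y)"
    if y: "y \<in> unit_disk" for i y
  proof -
    have z: "cmod (to_complex y) < 1" using y by simp
    show ?thesis
      by (subst partial_eqI[OF y weighted_zernike_has_derivative[OF s(1) z, of a b] p])
        (simp_all add: w A_def B_def mult_ac)
  qed
  define c where "c i = (if i = 1 then k1 else k2)" for i :: 2
  have Kmv: "(K *v v) $ i = c i * v $ i" for v i
    using exhaust_2[of i] by (auto simp: K matrix_vector_mult_def sum_2 c_def)
  define ea eb where "ea = riesz_eigenvalue s a (Suc b)" and "eb = riesz_eigenvalue s (Suc a) b"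
  define R where "R i z = - of_real (c i * (s + real a) * ea) * to_complex (axis i 1) * zernike (s - 1) a (Suc b) z
      - of_real (c i * (s + real b) * eb) * cnj (to_complex (axis i 1)) * zernike (s - 1) (Suc a) b z" for i z
  have rp: "riesz_potential (2 * s) (\<lambda>y. (K *v disk_grad w y) $ i) y = p (R i (to_complex y))" if y: "y \<in> unit_disk" for i y
  proof -
    have "riesz_potential (2 * s) (\<lambda>y. (K *v disk_grad w y) $ i) y
      = p ((- of_real (c i * (s + real a)) * to_complex (axis i 1)) * of_real (riesz_eigenvalue s a (Suc b)) * zernike (s - 1) a (Suc b) (to_complex y)
         + (- of_real (c i * (s + real b)) * cnj (to_complex (axis i 1))) * of_real (riesz_eigenvalue s (Suc a) b) * zernike (s - 1) (Suc a) b (to_complex y))"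
    proof (rule riesz_potential_weighted_zernike[OF s y p])
      fix v assume v: "v \<in> unit_disk"
      have "(K *v disk_grad w v) $ i = c i * partial i w v" using v by (simp add: Kmv disk_grad_def)
      also have "\<dots> = p (of_real (c i) * (- of_real (s + real a) * to_complex (axis i 1) * A v - of_real (s + real b) * cnj (to_complex (axis i 1)) * B v))"
        unfolding grad[OF v] scaleR_conv_of_real[symmetric] p.scaleR by simp
      also have "of_real (c i) * (- of_real (s + real a) * to_complex (axis i 1) * A v - of_real (s + real b) * cnj (to_complex (axis i 1)) * B v)
         = (- of_real (c i * (s + real a)) * to_complex (axis i 1)) * A v + (- of_real (c i * (s + real b)) * cnj (to_complex (axis i 1))) * B v"
        by (simp add: algebra_simps)
      finally show "(K *v disk_grad w v) $ i = p ((- of_real (c i * (s + real a)) * to_complex (axis i 1)) *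
           (of_real ((1 - (norm v)\<^sup>2) powr (s - 1)) * zernike (s - 1) a (Suc b) (to_complex v))
         + (- of_real (c i * (s + real b)) * cnj (to_complex (axis i 1))) *
           (of_real ((1 - (norm v)\<^sup>2) powr (s - 1)) * zernike (s - 1) (Suc a) b (to_complex v)))"
        unfolding A_def B_def .
    next
      fix v :: "real^2" assume "v \<notin> unit_disk"
      then show "(K *v disk_grad w v) $ i = 0" by (simp add: Kmv disk_grad_def)
    qed
    also have "\<dots> = p (R i (to_complex y))"
      by (rule arg_cong[of _ _ p]) (simp add: R_def ea_def eb_def algebra_simps)
    finally show ?thesis .
  qed
  let ?zx = "to_complex x"
  let ?P = "\<lambda>a b. zernike s a b ?zx"
  have dR: "(R i has_derivative (\<lambda>h. - of_real (c i * (s + real a) * ea) * to_complex (axis i 1) * (of_nat a * ?P (a - 1) (Suc b) * h + of_nat (Suc b) * ?P a b * cnj h)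
      - of_real (c i * (s + real b) * eb) * cnj (to_complex (axis i 1)) * (of_nat (Suc a) * ?P a b * h + of_nat b * ?P (Suc a) (b - 1) * cnj h))) (at ?zx)" for i
    unfolding R_def[abs_def]
    using zernike_has_derivative[of "s - 1" a "Suc b" ?zx] zernike_has_derivative[of "s - 1" "Suc a" b ?zx]
    by (intro has_derivative_diff has_derivative_mult_right) simp_all
  have "partial i (\<lambda>z. (\<chi> i. riesz_potential (2 * s) (\<lambda>y. (K *v disk_grad w y) $ i) z) $ i) x
    = p (- of_real (c i * (s + real a) * ea) * to_complex (axis i 1) * (of_nat a * ?P (a - 1) (Suc b) * to_complex (axis i 1) + of_nat (Suc b) * ?P a b * cnj (to_complex (axis i 1)))
      - of_real (c i * (s + real b) * eb) * cnj (to_complex (axis i 1)) * (of_nat (Suc a) * ?P a b * to_complex (axis i 1) + of_nat b * ?P (Suc a) (b - 1) * cnj (to_complex (axis i 1))))" for i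
    by (rule partial_eqI[OF x dR p]) (simp add: rp)
  then have "frac_diffusion (2 * s) K w x = - (\<Sum>i\<in>UNIV. p (- of_real (c i * (s + real a) * ea) * to_complex (axis i 1) * (of_nat a * ?P (a - 1) (Suc b) * to_complex (axis i 1) + of_nat (Suc b) * ?P a b * cnj (to_complex (axis i 1)))
      - of_real (c i * (s + real b) * eb) * cnj (to_complex (axis i 1)) * (of_nat (Suc a) * ?P a b * to_complex (axis i 1) + of_nat b * ?P (Suc a) (b - 1) * cnj (to_complex (axis i 1)))))"
    unfolding frac_diffusion_def div2_def by simp
  also have "\<dots> = p (of_real ((s + real a) * ea) * (of_real (k1 - k2) * of_nat a * ?P (a - 1) (Suc b) + of_real (k1 + k2) * of_nat (Suc b) * ?P a b)
      + of_real ((s + real b) * eb) * (of_real (k1 + k2) * of_nat (Suc a) * ?P a b + of_real (k1 - k2) * of_nat b * ?P (Suc a) (b - 1)))"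
    unfolding sum_2 to_complex_axis p.add[symmetric] p.neg[symmetric]
    by (rule arg_cong[of _ _ p]) (simp add: c_def algebra_simps)
  also have "(s + real a) * ea = 4 powr (s - 1) * (ga * gb / (fact a * fact (b + 1)))"
  proof -
    have "ga = (s + real a) * Gamma (s + real a)"
      unfolding ga_def using s by (intro Gamma_plus1) (auto elim!: nonpos_Ints_cases)
    then show ?thesis by (simp add: ea_def riesz_eigenvalue_def gb_def add_ac)
  qed
  also have "(s + real b) * eb = 4 powr (s - 1) * (ga * gb / (fact (a + 1) * fact b))"
  proof -
    have "gb = (s + real b) * Gamma (s + real b)"
      unfolding gb_def using s by (intro Gamma_plus1) (auto elim!: nonpos_Ints_cases)
    then show ?thesis by (simp add: eb_def riesz_eigenvalue_def ga_def add_ac)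
  qed
  also have "of_real (4 powr (s - 1) * (ga * gb / (fact a * fact (b + 1)))) * (of_real (k1 - k2) * of_nat a * ?P (a - 1) (Suc b) + of_real (k1 + k2) * of_nat (Suc b) * ?P a b)
      + of_real (4 powr (s - 1) * (ga * gb / (fact (a + 1) * fact b))) * (of_real (k1 + k2) * of_nat (Suc a) * ?P a b + of_real (k1 - k2) * of_nat b * ?P (Suc a) (b - 1))
    = of_real (4 powr (s - 1)) * (of_real (2 * (k1 + k2) * (ga * gb / (fact a * fact b))) * ?P a b
      + of_real (k1 - k2) * (of_real (real a * (ga * gb / (fact a * fact (b + 1)))) * ?P (a - 1) (b + 1)
          + of_real (real b * (ga * gb / (fact (a + 1) * fact b))) * ?P (a + 1) (b - 1)))"
  proof -
    \<comment> \<open>Both routes back to \<open>(a, b)\<close> carry the same factor, whence the 2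
      on the diagonal.\<close>
    have f: "ga * gb / (fact a * fact b) = real (Suc b) * (ga * gb / (fact a * fact (b + 1)))"
      "ga * gb / (fact a * fact b) = real (Suc a) * (ga * gb / (fact (a + 1) * fact b))"
    proof -
      have f1: "(fact (n + 1) :: real) = real (Suc n) * fact n" for n by simp
      show "ga * gb / (fact a * fact b) = real (Suc b) * (ga * gb / (fact a * fact (b + 1)))"
        "ga * gb / (fact a * fact b) = real (Suc a) * (ga * gb / (fact (a + 1) * fact b))"
        unfolding f1 by (simp_all del: of_nat_Suc)
    qed
    have "2 * (k1 + k2) * (ga * gb / (fact a * fact b)) = (k1 + k2) * (real (Suc b) * (ga * gb / (fact a * fact (b + 1)))) + (k1 + k2) * (real (Suc a) * (ga * gb / (fact (a + 1) * fact b)))"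
      unfolding f[symmetric] by (simp only: mult_2 distrib_right)
    moreover define X1 X2 where "X1 = ga * gb / (fact a * fact (b + 1))" and "X2 = ga * gb / (fact (a + 1) * fact b)"
    ultimately have X: "2 * (k1 + k2) * (ga * gb / (fact a * fact b)) = (k1 + k2) * (real (Suc b) * X1) + (k1 + k2) * (real (Suc a) * X2)"
      by (simp only:)
    show ?thesis
      unfolding X1_def[symmetric] X2_def[symmetric] X by (simp add: algebra_simps)
  qed
  finally show ?thesis
    unfolding scaleR_conv_of_real[symmetric] p.scaleR by simp
qed

section \<open>The orthogonal basis\<close>

text \<open>An \<open>n\<close>-th finite difference of a polynomial of degree \<open>m\<close> in
  \<open>k\<close>: each difference lowers the degree by one, by Pascal's rule. The bound
  \<open>n \<le> a\<close> keeps all natural subtractions exact.\<close>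

lemma alternating_choose_sum:
  assumes "n \<le> a"
  shows "(\<Sum>k\<le>n. real (n choose k) * ((-1) ^ k * real ((a + m - k) choose m)))
     = (if m < n then 0 else real ((a + m - n) choose (m - n)))"
  using assms
proof (induction n arbitrary: m)
  case (Suc n)
  have step: "(-1) ^ k * real ((a + m - k) choose m) + (-1) ^ Suc k * real ((a + m - Suc k) choose m)
     = (case m of 0 \<Rightarrow> 0 | Suc m' \<Rightarrow> (-1) ^ k * real ((a + m' - k) choose m'))" if "k \<le> n" for k
  proof (cases m)
    case (Suc m')
    have "a + m - k = Suc (a + m' - k)" "a + m - Suc k = a + m' - k" using that Suc.prems Suc by auto
    then show ?thesis by (simp add: Suc algebra_simps)
  qed simp
  have "(\<Sum>k\<le>Suc n. real (Suc n choose k) * ((-1) ^ k * real ((a + m - k) choose m)))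
     = (\<Sum>k\<le>n. real (n choose k) * (case m of 0 \<Rightarrow> 0 | Suc m' \<Rightarrow> (-1) ^ k * real ((a + m' - k) choose m')))"
    unfolding sum_choose_Suc by (intro sum.cong refl) (simp only: step atMost_iff)
  also have "\<dots> = (if m < Suc n then 0 else real ((a + m - Suc n) choose (m - Suc n)))"
    using Suc.IH Suc.prems by (cases m) auto
  finally show ?case .
qed simp

lemma set_integral_linear_combination:
  fixes B :: "'i \<Rightarrow> 'a \<Rightarrow> real"
  assumes "\<And>k. k \<in> I \<Longrightarrow> set_integrable M A (B k)"
  shows "set_integrable M A (\<lambda>t. \<Sum>k\<in>I. c k * B k t)"
    and "set_lebesgue_integral M A (\<lambda>t. \<Sum>k\<in>I. c k * B k t) = (\<Sum>k\<in>I. c k * set_lebesgue_integral M A (B k))"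
proof -
  have eq: "indicator A t *\<^sub>R (\<Sum>k\<in>I. c k * B k t) = (\<Sum>k\<in>I. c k * (indicator A t *\<^sub>R B k t))" for t
    by (simp add: sum_distrib_left mult_ac)
  show "set_integrable M A (\<lambda>t. \<Sum>k\<in>I. c k * B k t)"
    using assms unfolding set_integrable_def eq
    by (intro Bochner_Integration.integrable_sum integrable_mult_right)
  show "set_lebesgue_integral M A (\<lambda>t. \<Sum>k\<in>I. c k * B k t) = (\<Sum>k\<in>I. c k * set_lebesgue_integral M A (B k))"
    using assms unfolding set_integrable_def set_lebesgue_integral_def eq
    by (subst Bochner_Integration.integral_sum) (auto intro!: integrable_mult_right)
qed

text \<open>Every term of \<open>jacobi_poly\<close> times the weight is a Beta integrand. Once the
  common Gamma quotient is taken out, an alternating binomial sum remains, and it vanishes for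
  \<open>m < n\<close>.\<close>

lemma jacobi_poly_moment:
  fixes \<beta> :: real
  assumes \<beta>: "-1 < \<beta>"
  shows "set_integrable lborel {0<..<1} (\<lambda>t. (1 - t) powr \<beta> * t ^ l * (jacobi_poly n \<beta> (real l) (2 * t - 1) * t ^ m))"
    and "set_lebesgue_integral lborel {0<..<1} (\<lambda>t. (1 - t) powr \<beta> * t ^ l * (jacobi_poly n \<beta> (real l) (2 * t - 1) * t ^ m))
       = (if m < n then 0 else real ((l + m) choose (m - n)) * Gamma (real n + \<beta> + 1) * fact (n + l) * fact m
             / (fact n * Gamma (\<beta> + real n + real l + real m + 2)))"
proof -
  define c where "c k = ((real n + \<beta>) gchoose (n - k)) * real ((n + l) choose k) * (-1) ^ k" for k
  define B where "B k t = t powr (real (l + m + n - k) + 1 - 1) * (1 - t) powr (\<beta> + real k + 1 - 1)" for k and t :: real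
  have int: "set_integrable lborel {0<..<1} (B k)" 
    and val: "set_lebesgue_integral lborel {0<..<1} (B k) = Beta (real (l + m + n - k) + 1) (\<beta> + real k + 1)" for k
    unfolding B_def using set_integral_Beta[of "real (l + m + n - k) + 1" "\<beta> + real k + 1"] \<beta> by auto
  have eq: "(1 - t) powr \<beta> * t ^ l * (jacobi_poly n \<beta> (real l) (2 * t - 1) * t ^ m) = (\<Sum>k\<le>n. c k * B k t)"
    if "t \<in> {0<..<1}" for t
    unfolding jacobi_poly_def sum_distrib_left sum_distrib_right
  proof (rule sum.cong[OF refl])
    fix k assume "k \<in> {..n}"
    then have k: "k \<le> n" by simp
    have 1: "t powr (real (l + m + n - k) + 1 - 1) = t ^ (l + m + n - k)"
      using that by (simp add: powr_realpow[symmetric])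
    have 2: "(1 - t) powr (\<beta> + real k + 1 - 1) = (1 - t) powr \<beta> * (1 - t) ^ k"
      using that by (simp add: powr_realpow[symmetric] powr_add)
    have 3: "((2 * t - 1 - 1) / 2) ^ k = (-1) ^ k * (1 - t) ^ k"
    proof -
      have "(2 * t - 1 - 1) / 2 = (-1) * (1 - t)" by (simp add: field_simps)
      then show ?thesis by (simp only: power_mult_distrib)
    qed
    have 4: "t ^ (l + m + n - k) = t ^ l * t ^ (n - k) * t ^ m"
    proof -
      have "l + m + n - k = l + (n - k) + m" using k by simp
      then show ?thesis by (simp only: power_add)
    qed
    have 5: "(real n + real l) gchoose k = real ((n + l) choose k)" by (simp add: binomial_gbinomial)
    have 6: "(2 * t - 1 + 1) / 2 = t" by simp
    show "(1 - t) powr \<beta> * t ^ l * ((real n + \<beta> gchoose (n - k)) * (real n + real l gchoose k) * ((2 * t - 1 - 1) / 2) ^ k * ((2 * t - 1 + 1) / 2) ^ (n - k) * t ^ m)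
       = c k * B k t"
      unfolding B_def c_def 1 2 3 4 5 6 by (simp add: mult_ac)
  qed
  have ints: "set_integrable lborel {0<..<1} (\<lambda>t. \<Sum>k\<le>n. c k * B k t)"
    using int by (intro set_integral_linear_combination(1))
  have "set_integrable lborel {0<..<1} (\<lambda>t. (1 - t) powr \<beta> * t ^ l * (jacobi_poly n \<beta> (real l) (2 * t - 1) * t ^ m))
     \<longleftrightarrow> set_integrable lborel {0<..<1} (\<lambda>t. \<Sum>k\<le>n. c k * B k t)"
    by (rule set_integrable_cong) (auto simp: eq)
  then show "set_integrable lborel {0<..<1} (\<lambda>t. (1 - t) powr \<beta> * t ^ l * (jacobi_poly n \<beta> (real l) (2 * t - 1) * t ^ m))"
    using ints by simp
  have "set_lebesgue_integral lborel {0<..<1} (\<lambda>t. (1 - t) powr \<beta> * t ^ l * (jacobi_poly n \<beta> (real l) (2 * t - 1) * t ^ m))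
      = set_lebesgue_integral lborel {0<..<1} (\<lambda>t. \<Sum>k\<le>n. c k * B k t)"
    by (rule set_lebesgue_integral_cong) (auto simp: eq)
  also have "\<dots> = (\<Sum>k\<le>n. c k * Beta (real (l + m + n - k) + 1) (\<beta> + real k + 1))"
    using int by (subst set_integral_linear_combination(2)) (auto simp: val)
  also have "\<dots> = (\<Sum>k\<le>n. Gamma (real n + \<beta> + 1) * fact (n + l) * fact m / (fact n * Gamma (\<beta> + real n + real l + real m + 2))
      * (real (n choose k) * ((-1) ^ k * real ((n + l + m - k) choose m))))"
  proof (rule sum.cong[OF refl])
    fix k assume "k \<in> {..n}"
    then have k: "k \<le> n" by simp
    have Gk: "Gamma (\<beta> + real k + 1) > 0" using \<beta> by (intro Gamma_real_pos) linarith
    have g: "(real n + \<beta>) gchoose (n - k) = Gamma (real n + \<beta> + 1) / (fact (n - k) * Gamma (\<beta> + real k + 1))"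
    proof -
      have "(real n + \<beta>) gchoose (n - k) = pochhammer (\<beta> + real k + 1) (n - k) / fact (n - k)"
        using k by (simp add: gbinomial_pochhammer' of_nat_diff algebra_simps)
      also have "pochhammer (\<beta> + real k + 1) (n - k) = Gamma (\<beta> + real k + 1 + real (n - k)) / Gamma (\<beta> + real k + 1)"
        using \<beta> by (intro pochhammer_Gamma) (auto elim!: nonpos_Ints_cases)
      finally show ?thesis using k by (simp add: of_nat_diff algebra_simps)
    qed
    have f: "Gamma (real (l + m + n - k) + 1) = fact (l + m + n - k)"
      by (metis Gamma_fact add.commute)
    have s: "real (l + m + n - k) + 1 + (\<beta> + real k + 1) = \<beta> + real n + real l + real m + 2"
      using k by (simp add: of_nat_diff)
    have b: "real ((n + l + m - k) choose m) = fact (l + m + n - k) / (fact m * fact (n + l - k))"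
      using k by (subst binomial_fact) (auto simp: add_ac)
    show "c k * Beta (real (l + m + n - k) + 1) (\<beta> + real k + 1)
       = Gamma (real n + \<beta> + 1) * fact (n + l) * fact m / (fact n * Gamma (\<beta> + real n + real l + real m + 2))
      * (real (n choose k) * ((-1) ^ k * real ((n + l + m - k) choose m)))"
      unfolding c_def Beta_def f s g b using k Gk by (simp add: binomial_fact field_simps)
  qed
  also have "\<dots> = Gamma (real n + \<beta> + 1) * fact (n + l) * fact m / (fact n * Gamma (\<beta> + real n + real l + real m + 2))
      * (if m < n then 0 else real ((n + l + m - n) choose (m - n)))"
    unfolding sum_distrib_left[symmetric] using alternating_choose_sum[of n "n + l" m] by (simp add: add.assoc)
  finally show "set_lebesgue_integral lborel {0<..<1} (\<lambda>t. (1 - t) powr \<beta> * t ^ l * (jacobi_poly n \<beta> (real l) (2 * t - 1) * t ^ m))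
       = (if m < n then 0 else real ((l + m) choose (m - n)) * Gamma (real n + \<beta> + 1) * fact (n + l) * fact m
             / (fact n * Gamma (\<beta> + real n + real l + real m + 2)))"
    by simp
qed

text \<open>The squared norm of the Jacobi polynomial in the variable \<open>2 * t - 1\<close>, for
  the weight \<open>(1 - t) powr \<beta> * t ^ l\<close> on the unit interval.\<close>

definition jacobi_norm2 :: "real \<Rightarrow> nat \<Rightarrow> nat \<Rightarrow> real" where
  "jacobi_norm2 \<beta> l n = Gamma (real n + \<beta> + 1) * fact (n + l)
     / ((2 * real n + real l + \<beta> + 1) * fact n * Gamma (real n + real l + \<beta> + 1))"

lemma jacobi_norm2_pos: "-1 < \<beta> \<Longrightarrow> 0 < jacobi_norm2 \<beta> l n"
  unfolding jacobi_norm2_def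
  by (intro divide_pos_pos mult_pos_pos Gamma_real_pos) (auto intro!: add_nonneg_pos)

text \<open>Powers below \<open>n\<close> are orthogonal to the polynomial of index
  \<open>n\<close>, so expanding the factor of smaller index in powers leaves at most its leading
  coefficient \<open>v 0\<close>.\<close>

lemma jacobi_poly_orthogonal:
  fixes \<beta> :: real
  assumes \<beta>: "-1 < \<beta>"
  shows "set_lebesgue_integral lborel {0<..<1} (\<lambda>t. (1 - t) powr \<beta> * t ^ l * (jacobi_poly n \<beta> (real l) (2 * t - 1) * jacobi_poly n' \<beta> (real l) (2 * t - 1)))
       = (if n = n' then jacobi_norm2 \<beta> l n else 0)"
proof -
  have le: "set_lebesgue_integral lborel {0<..<1} (\<lambda>t. (1 - t) powr \<beta> * t ^ l * (jacobi_poly n \<beta> (real l) (2 * t - 1) * jacobi_poly n' \<beta> (real l) (2 * t - 1)))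
       = (if n = n' then jacobi_norm2 \<beta> l n else 0)" if "n' \<le> n" for n n'
  proof -
    define v where "v j = (-1) ^ j * real ((n' + l) choose j) * ((\<beta> + 2 * real n' + real l - real j) gchoose (n' - j))" for j
    note M = jacobi_poly_moment[OF \<beta>, of l n]
    have "set_lebesgue_integral lborel {0<..<1} (\<lambda>t. (1 - t) powr \<beta> * t ^ l * (jacobi_poly n \<beta> (real l) (2 * t - 1) * jacobi_poly n' \<beta> (real l) (2 * t - 1)))
       = set_lebesgue_integral lborel {0<..<1} (\<lambda>t. \<Sum>j\<le>n'. v j * ((1 - t) powr \<beta> * t ^ l * (jacobi_poly n \<beta> (real l) (2 * t - 1) * t ^ (n' - j))))"
      unfolding jacobi_poly_power_sum[of n'] v_def by (simp add: sum_distrib_left mult_ac)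
    also have "\<dots> = (\<Sum>j\<le>n'. v j * set_lebesgue_integral lborel {0<..<1} (\<lambda>t. (1 - t) powr \<beta> * t ^ l * (jacobi_poly n \<beta> (real l) (2 * t - 1) * t ^ (n' - j))))"
      using M(1) by (subst set_integral_linear_combination(2)) auto
    also have "\<dots> = (\<Sum>j\<le>n'. if j = 0 \<and> n = n' then v 0 * (Gamma (real n + \<beta> + 1) * fact (n + l)
             / Gamma (\<beta> + real n + real l + real n + 2)) else 0)"
      unfolding M(2) using that by (intro sum.cong) auto
    also have "\<dots> = (if n = n' then v 0 * (Gamma (real n + \<beta> + 1) * fact (n + l)
             / Gamma (\<beta> + real n + real l + real n + 2)) else 0)"
      by (cases "n = n'") auto
    also have "\<dots> = (if n = n' then jacobi_norm2 \<beta> l n else 0)"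
    proof (cases "n = n'")
      case True
      have pos: "\<beta> + real n + real l + 1 > 0" "2 * real n + real l + \<beta> + 1 > 0" using \<beta> by linarith+
      have "v 0 = pochhammer (\<beta> + real n + real l + 1) n / fact n"
        by (simp add: v_def True[symmetric] gbinomial_pochhammer' algebra_simps)
      also have "pochhammer (\<beta> + real n + real l + 1) n = Gamma (\<beta> + real n + real l + 1 + real n) / Gamma (\<beta> + real n + real l + 1)"
        using pos by (intro pochhammer_Gamma) (auto elim!: nonpos_Ints_cases)
      finally have v0: "v 0 = Gamma (2 * real n + real l + \<beta> + 1) / (fact n * Gamma (real n + real l + \<beta> + 1))"
        by (simp add: algebra_simps)
      have "Gamma (2 * real n + real l + \<beta> + 1 + 1) = (2 * real n + real l + \<beta> + 1) * Gamma (2 * real n + real l + \<beta> + 1)"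
        using pos by (intro Gamma_plus1) (auto elim!: nonpos_Ints_cases)
      then have G: "Gamma (\<beta> + real n + real l + real n + 2) = (2 * real n + real l + \<beta> + 1) * Gamma (2 * real n + real l + \<beta> + 1)"
        by (simp add: algebra_simps)
      have "Gamma (2 * real n + real l + \<beta> + 1) > 0" using pos by (intro Gamma_real_pos)
      then show ?thesis using True unfolding v0 G jacobi_norm2_def by (simp add: divide_simps)
    qed simp
    finally show ?thesis .
  qed
  show ?thesis
  proof (cases "n' \<le> n")
    case False
    then show ?thesis using le[of n n'] by (simp add: mult.commute[of "jacobi_poly n _ _ _"])
  qed (rule le)
qed

section \<open>Real basis functions\<close>

definition part :: "int \<Rightarrow> complex \<Rightarrow> real" where
  "part \<mu> z = (if \<mu> = 1 then Re z else Im z)"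

lemma bounded_linear_part: "bounded_linear (part \<mu>)"
  by (cases "\<mu> = 1") (simp_all add: part_def[abs_def] bounded_linear_Re bounded_linear_Im)

lemma part_of_real_mult: "part \<mu> (of_real r * z) = r * part \<mu> z"
  by (simp add: part_def)

lemma solid_harmonic_eq: "solid_harmonic l \<mu> x = part \<mu> (to_complex x ^ l)"
proof -
  have "to_complex x = rcis (norm x) (polar_angle x)"
    using rcis_cmod_Arg[of "to_complex x"] by (simp add: polar_angle_def to_complex_def[symmetric])
  then show ?thesis by (simp add: solid_harmonic_def part_def DeMoivre2)
qed

definition disk_basis_complex :: "real \<Rightarrow> nat \<times> nat \<times> int \<Rightarrow> complex \<Rightarrow> real" where
  "disk_basis_complex \<beta> = (\<lambda>(l, n, \<mu>) z. part \<mu> (z ^ l) * jacobi_poly n \<beta> (real l) (2 * (cmod z)\<^sup>2 - 1))"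

lemma disk_basis_eq: "disk_basis \<beta> i x = disk_basis_complex \<beta> i (to_complex x)"
  by (simp add: disk_basis_def disk_basis_complex_def solid_harmonic_eq split: prod.split)

lemma disk_basis_eq_zernike:
  assumes "-1 < \<beta>"
  shows "disk_basis \<beta> (l, n, \<mu>) x = part \<mu> (zernike \<beta> (n + l) n (to_complex x)) / (fact n * Gamma (\<beta> + real n + real l + 1))"
proof -
  have "disk_basis \<beta> (l, n, \<mu>) x = part \<mu> (of_real (jacobi_poly n \<beta> (real l) (2 * (cmod (to_complex x))\<^sup>2 - 1)) * to_complex x ^ l)"
    unfolding part_of_real_mult by (simp add: disk_basis_eq disk_basis_complex_def)
  also have "of_real (jacobi_poly n \<beta> (real l) (2 * (cmod (to_complex x))\<^sup>2 - 1)) * to_complex x ^ l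
     = of_real (1 / (fact n * Gamma (\<beta> + real n + real l + 1))) * zernike \<beta> (n + l) n (to_complex x)"
    unfolding mult.commute[of "of_real _" "_ ^ _"] jacobi_poly_eq_zernike[OF assms] by simp
  finally show ?thesis unfolding part_of_real_mult by simp
qed

lemma continuous_jacobi_poly [continuous_intros]:
  "continuous_on S f \<Longrightarrow> continuous_on S (\<lambda>x. jacobi_poly n a b (f x))"
  unfolding jacobi_poly_def by (intro continuous_intros) auto

lemma continuous_disk_basis_complex: "continuous_on S (disk_basis_complex \<beta> i)"
  by (cases i) (auto simp: disk_basis_complex_def intro!: continuous_intros
      linear_continuous_on_compose[OF _ bounded_linear.linear[OF bounded_linear_part], unfolded o_def]
      bounded_linear.continuous_on[OF bounded_linear_part])

lemma measurable_disk_basis_complex [measurable]: "disk_basis_complex \<beta> i \<in> borel_measurable borel"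
  by (intro borel_measurable_continuous_onI continuous_disk_basis_complex)

lemma integrable_disk_weight:
  assumes "-1 < \<beta>"
  shows "integrable disk_measure (\<lambda>z. (1 - (cmod z)\<^sup>2) powr \<beta>)"
proof -
  have "set_integrable lborel {0<..<1} (\<lambda>t::real. (1 - t) powr \<beta>)
     \<longleftrightarrow> set_integrable lborel {0<..<1} (\<lambda>t::real. t powr (1 - 1) * (1 - t) powr (\<beta> + 1 - 1))"
    by (rule set_integrable_cong) auto
  then have "set_integrable lborel {0<..<1} (\<lambda>t::real. (1 - t) powr \<beta>)"
    using set_integral_Beta(1)[of 1 "\<beta> + 1"] assms by simp
  then show ?thesis using integrable_radial_iff[of "\<lambda>t. (1 - t) powr \<beta>"] by simp
qed

lemma integrable_disk_weight_mult:
  fixes g :: "complex \<Rightarrow> 'b::{banach, second_countable_topology}"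
  assumes "-1 < \<beta>" and g: "continuous_on UNIV g"
  shows "integrable disk_measure (\<lambda>z. (1 - (cmod z)\<^sup>2) powr \<beta> *\<^sub>R g z)"
proof -
  have [measurable]: "g \<in> borel_measurable borel" using g by (rule borel_measurable_continuous_onI)
  have "compact (g ` cball 0 1)"
    using g by (intro compact_continuous_image continuous_on_subset[OF g]) auto
  then have "bounded (g ` cball 0 1)" by (rule compact_imp_bounded)
  then obtain C where "\<forall>x\<in>g ` cball 0 1. norm x \<le> C" unfolding bounded_iff by blast
  then have C: "norm (g z) \<le> C" if "cmod z \<le> 1" for z using that by simp
  show ?thesis
  proof (rule Bochner_Integration.integrable_bound)
    show "integrable disk_measure (\<lambda>z. (1 - (cmod z)\<^sup>2) powr \<beta> * C)"
      using integrable_disk_weight[OF assms(1)] by simp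
    show "AE z in disk_measure. norm ((1 - (cmod z)\<^sup>2) powr \<beta> *\<^sub>R g z) \<le> norm ((1 - (cmod z)\<^sup>2) powr \<beta> * C)"
      using AE_disk_measure
    proof eventually_elim
      fix z assume "cmod z < 1"
      then have "norm (g z) \<le> \<bar>C\<bar>" using C[of z] by linarith
      then show "norm ((1 - (cmod z)\<^sup>2) powr \<beta> *\<^sub>R g z) \<le> norm ((1 - (cmod z)\<^sup>2) powr \<beta> * C)"
        by (simp add: abs_mult mult_left_mono)
    qed
  qed measurable
qed

text \<open>\<open>pi\<close> is the density of the squared radius; the factor 1/2 is the mean
  square of cosine and sine, which is replaced by 1 for the constant harmonic.\<close>

definition basis_norm2 :: "real \<Rightarrow> nat \<times> nat \<times> int \<Rightarrow> real" where
  "basis_norm2 \<beta> = (\<lambda>(l, n, \<mu>). (if l = 0 then 1 else 1 / 2) * pi * jacobi_norm2 \<beta> l n)"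

lemma basis_norm2_pos: "-1 < \<beta> \<Longrightarrow> 0 < basis_norm2 \<beta> i"
  using jacobi_norm2_pos by (simp add: basis_norm2_def split: prod.split)

text \<open>A product of two real parts is half the real part of \<open>a * cnj b + a * b\<close>,
  so two harmonics combine to the frequencies \<open>l - l'\<close> and \<open>l + l'\<close>. The
  second survives only for \<open>l = l' = 0\<close>, where it doubles the norm.\<close>

lemma disk_basis_complex_orthogonal:
  assumes \<beta>: "-1 < \<beta>" and i: "i \<in> basis_index" and j: "j \<in> basis_index"
  shows "(\<integral>z. (1 - (cmod z)\<^sup>2) powr \<beta> * (disk_basis_complex \<beta> i z * disk_basis_complex \<beta> j z) \<partial>disk_measure)
     = (if i = j then basis_norm2 \<beta> i else 0)"
proof -
  obtain l n \<mu> where i_eq: "i = (l, n, \<mu>)" by (cases i)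
  obtain l' n' \<mu>' where j_eq: "j = (l', n', \<mu>')" by (cases j)
  \<comment> \<open>This turns both parts into real parts:
    \<open>Im z = Re (- \<i> * z)\<close>.\<close>
  define k where "k \<mu> = (if \<mu> = 1 then 1 else - \<i>)" for \<mu> :: int
  have part_k: "part \<mu> z = Re (k \<mu> * z)" for \<mu> z by (simp add: part_def k_def)
  define F where "F t = jacobi_poly n \<beta> (real l) (2 * t - 1) * jacobi_poly n' \<beta> (real l') (2 * t - 1)" for t
  have contF: "continuous_on UNIV (\<lambda>z. F ((cmod z)\<^sup>2))" unfolding F_def by (intro continuous_intros)
  have [measurable]: "F \<in> borel_measurable borel"
    unfolding F_def by (intro borel_measurable_continuous_onI continuous_intros)
  let ?w = "\<lambda>z. (1 - (cmod z)\<^sup>2) powr \<beta>"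
  let ?G = "\<lambda>p q z. ?w z *\<^sub>R (of_real (F ((cmod z)\<^sup>2)) * z ^ p * cnj z ^ q)"
  have int: "integrable disk_measure (?G p q)" for p q
    by (intro integrable_disk_weight_mult[OF \<beta>] continuous_intros contF)
  have zero: "integral\<^sup>L disk_measure (?G p q) = 0" if "p \<noteq> q" for p q
    using integral_disk_angular[of "\<lambda>t. of_real ((1 - t) powr \<beta> * F t)" p q] that
    by (simp add: scaleR_conv_of_real mult.assoc)
  have diag: "integral\<^sup>L disk_measure (?G p p) = of_real (pi * set_lebesgue_integral lborel {0<..<1} (\<lambda>t. (1 - t) powr \<beta> * F t * t ^ p))" for p
  proof -
    have "?G p p z = of_real ((1 - (cmod z)\<^sup>2) powr \<beta> * F ((cmod z)\<^sup>2) * ((cmod z)\<^sup>2) ^ p)" for z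
    proof -
      have "complex_of_real (((cmod z)\<^sup>2) ^ p) = z ^ p * cnj z ^ p"
        by (metis complex_norm_square of_real_power power_mult_distrib)
      then show ?thesis unfolding of_real_mult scaleR_conv_of_real by (simp only: mult.assoc)
    qed
    then have "integral\<^sup>L disk_measure (?G p p) = of_real (\<integral>z. (1 - (cmod z)\<^sup>2) powr \<beta> * F ((cmod z)\<^sup>2) * ((cmod z)\<^sup>2) ^ p \<partial>disk_measure)"
      by (simp only: integral_complex_of_real)
    also have "(\<integral>z. (1 - (cmod z)\<^sup>2) powr \<beta> * F ((cmod z)\<^sup>2) * ((cmod z)\<^sup>2) ^ p \<partial>disk_measure)
       = pi * set_lebesgue_integral lborel {0<..<1} (\<lambda>t. (1 - t) powr \<beta> * F t * t ^ p)"
      using integral_radial[of "\<lambda>t. (1 - t) powr \<beta> * F t * t ^ p"] by simp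
    finally show ?thesis .
  qed
  define c1 c2 where "c1 = k \<mu> * cnj (k \<mu>') / 2" and "c2 = k \<mu> * k \<mu>' / 2"
  have eq: "?w z * (disk_basis_complex \<beta> i z * disk_basis_complex \<beta> j z) = Re (c1 * ?G l l' z + c2 * ?G (l + l') 0 z)" for z
  proof -
    have re: "Re a * Re b = Re (a * cnj b / 2 + a * b / 2)" for a b by (simp add: field_simps)
    have "(k \<mu> * z ^ l) * cnj (k \<mu>' * z ^ l') / 2 + (k \<mu> * z ^ l) * (k \<mu>' * z ^ l') / 2
       = c1 * (z ^ l * cnj z ^ l') + c2 * z ^ (l + l')"
      by (simp add: c1_def c2_def power_add mult_ac)
    then have "part \<mu> (z ^ l) * part \<mu>' (z ^ l') = Re (c1 * (z ^ l * cnj z ^ l') + c2 * z ^ (l + l'))"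
      unfolding part_k re by (simp only:)
    moreover have "Re (of_real r * u) = r * Re u" for r u by simp
    ultimately have "(?w z * F ((cmod z)\<^sup>2)) * (part \<mu> (z ^ l) * part \<mu>' (z ^ l'))
       = Re (of_real (?w z * F ((cmod z)\<^sup>2)) * (c1 * (z ^ l * cnj z ^ l') + c2 * z ^ (l + l')))" by (simp only:)
    also have "of_real (?w z * F ((cmod z)\<^sup>2)) * (c1 * (z ^ l * cnj z ^ l') + c2 * z ^ (l + l')) = c1 * ?G l l' z + c2 * ?G (l + l') 0 z"
      by (simp add: scaleR_conv_of_real algebra_simps)
    finally show ?thesis by (simp add: disk_basis_complex_def i_eq j_eq F_def mult_ac)
  qed
  have "(\<integral>z. ?w z * (disk_basis_complex \<beta> i z * disk_basis_complex \<beta> j z) \<partial>disk_measure)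
     = Re (\<integral>z. c1 * ?G l l' z + c2 * ?G (l + l') 0 z \<partial>disk_measure)"
    unfolding eq by (intro integral_Re Bochner_Integration.integrable_add integrable_mult_right int)
  also have "(\<integral>z. c1 * ?G l l' z + c2 * ?G (l + l') 0 z \<partial>disk_measure)
     = c1 * integral\<^sup>L disk_measure (?G l l') + c2 * integral\<^sup>L disk_measure (?G (l + l') 0)"
    by (subst Bochner_Integration.integral_add) (intro integrable_mult_right int, intro integrable_mult_right int, simp only: integral_mult_right_zero)
  finally have main: "(\<integral>z. ?w z * (disk_basis_complex \<beta> i z * disk_basis_complex \<beta> j z) \<partial>disk_measure)
     = Re (c1 * integral\<^sup>L disk_measure (?G l l') + c2 * integral\<^sup>L disk_measure (?G (l + l') 0))" .
  show ?thesis
  proof (cases "l = l'")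
    case False
    then have "integral\<^sup>L disk_measure (?G l l') = 0" "integral\<^sup>L disk_measure (?G (l + l') 0) = 0"
      by (intro zero, linarith)+
    then show ?thesis using False unfolding main by (simp add: i_eq j_eq)
  next
    case True
    have J: "set_lebesgue_integral lborel {0<..<1} (\<lambda>t. (1 - t) powr \<beta> * F t * t ^ l) = (if n = n' then jacobi_norm2 \<beta> l n else 0)"
      using jacobi_poly_orthogonal[OF \<beta>, of l n n'] by (simp add: F_def True mult_ac)
    have I1: "integral\<^sup>L disk_measure (?G l l') = of_real (pi * (if n = n' then jacobi_norm2 \<beta> l n else 0))"
      using diag[of l] unfolding J by (simp only: True)
    show ?thesis
    proof (cases "l = 0")
      case l0: True
      then have mu: "\<mu> = 1" "\<mu>' = 1" using i j True by (auto simp: basis_index_def i_eq j_eq)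
      have I2: "integral\<^sup>L disk_measure (?G (l + l') 0) = of_real (pi * (if n = n' then jacobi_norm2 \<beta> l n else 0))"
        using I1 l0 True by simp
      show ?thesis unfolding main I1 I2 using mu l0 True
        by (simp add: c1_def c2_def k_def i_eq j_eq basis_norm2_def)
    next
      case l0: False
      then have I2: "integral\<^sup>L disk_measure (?G (l + l') 0) = 0" by (intro zero) simp
      have mu: "\<mu> \<in> {1, -1}" "\<mu>' \<in> {1, -1}" using i j by (auto simp: basis_index_def i_eq j_eq)
      show ?thesis unfolding main I1 I2 using mu l0 True
        by (auto simp: c1_def c2_def k_def i_eq j_eq basis_norm2_def)
    qed
  qed
qed

section \<open>Square-integrable functions and orthogonal families\<close>

definition square_integrable :: "'a measure \<Rightarrow> ('a \<Rightarrow> real) \<Rightarrow> bool" where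
  "square_integrable M f \<longleftrightarrow> f \<in> borel_measurable M \<and> integrable M (\<lambda>x. (f x)\<^sup>2)"

lemma square_integrable_mult:
  assumes "square_integrable M f" "square_integrable M g"
  shows "integrable M (\<lambda>x. f x * g x)"
proof (rule Bochner_Integration.integrable_bound)
  have [measurable]: "f \<in> borel_measurable M" "g \<in> borel_measurable M"
    using assms by (auto simp: square_integrable_def)
  show "integrable M (\<lambda>x. (f x)\<^sup>2 + (g x)\<^sup>2)" using assms by (auto simp: square_integrable_def)
  show "(\<lambda>x. f x * g x) \<in> borel_measurable M" by measurable
  have "\<bar>a * b\<bar> \<le> a\<^sup>2 + b\<^sup>2" for a b :: real
  proof -
    have "0 \<le> (\<bar>a\<bar> - \<bar>b\<bar>)\<^sup>2" by simp
    then have "2 * \<bar>a * b\<bar> \<le> a\<^sup>2 + b\<^sup>2" by (simp add: power2_diff abs_mult)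
    then show ?thesis by linarith
  qed
  then show "AE x in M. norm (f x * g x) \<le> norm ((f x)\<^sup>2 + (g x)\<^sup>2)" by auto
qed

lemma square_integrable_cmult: "square_integrable M f \<Longrightarrow> square_integrable M (\<lambda>x. c * f x)"
  by (auto simp: square_integrable_def power_mult_distrib)

lemma square_integrable_add:
  assumes "square_integrable M f" "square_integrable M g"
  shows "square_integrable M (\<lambda>x. f x + g x)"
proof -
  have "integrable M (\<lambda>x. (f x)\<^sup>2 + 2 * (f x * g x) + (g x)\<^sup>2)"
    using assms square_integrable_mult[OF assms] by (auto simp: square_integrable_def)
  then have "integrable M (\<lambda>x. (f x + g x)\<^sup>2)"
    by (simp add: power2_sum algebra_simps)
  then show ?thesis using assms by (auto simp: square_integrable_def)
qed

lemma square_integrable_diff: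
  assumes "square_integrable M f" "square_integrable M g"
  shows "square_integrable M (\<lambda>x. f x - g x)"
  using square_integrable_add[OF assms(1) square_integrable_cmult[OF assms(2), of "-1"]] by simp

lemma square_integrable_zero: "square_integrable M (\<lambda>x. 0)"
  by (simp add: square_integrable_def)

lemma square_integrable_sum:
  assumes "\<And>i. i \<in> F \<Longrightarrow> square_integrable M (f i)"
  shows "square_integrable M (\<lambda>x. \<Sum>i\<in>F. f i x)"
  using assms by (induction F rule: infinite_finite_induct)
    (auto intro: square_integrable_zero square_integrable_add)

lemma integral_Cauchy_Schwarz:
  assumes f: "square_integrable M f" and g: "square_integrable M g"
  shows "(\<integral>x. f x * g x \<partial>M)\<^sup>2 \<le> (\<integral>x. (f x)\<^sup>2 \<partial>M) * (\<integral>x. (g x)\<^sup>2 \<partial>M)"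
proof -
  define a b c where "a = (\<integral>x. (f x)\<^sup>2 \<partial>M)" and "b = (\<integral>x. f x * g x \<partial>M)" and "c = (\<integral>x. (g x)\<^sup>2 \<partial>M)"
  have fi: "integrable M (\<lambda>x. (f x)\<^sup>2)" and gi: "integrable M (\<lambda>x. (g x)\<^sup>2)"
    using f g by (auto simp: square_integrable_def)
  have fg: "integrable M (\<lambda>x. f x * g x)" by (rule square_integrable_mult[OF f g])
  have [measurable]: "f \<in> borel_measurable M" "g \<in> borel_measurable M"
    using f g by (auto simp: square_integrable_def)
  show ?thesis
  proof (cases "a = 0")
    case True
    then have "AE x in M. (f x)\<^sup>2 = 0"
      using integral_nonneg_eq_0_iff_AE[OF fi] by (simp add: a_def)
    then have "AE x in M. f x * g x = 0" by eventually_elim simp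
    then have "b = (\<integral>x. 0 \<partial>M)" unfolding b_def by (intro integral_cong_AE) auto
    then show ?thesis unfolding a_def[symmetric] b_def[symmetric] True by simp
  next
    case False
    have "a \<ge> 0" unfolding a_def by simp
    with False have a: "a > 0" by simp
    define t where "t = b / a"
    have "0 \<le> (\<integral>x. (g x - t * f x)\<^sup>2 \<partial>M)" by simp
    also have "(\<integral>x. (g x - t * f x)\<^sup>2 \<partial>M) = (\<integral>x. (g x)\<^sup>2 - 2 * t * (f x * g x) + t\<^sup>2 * (f x)\<^sup>2 \<partial>M)"
      by (intro Bochner_Integration.integral_cong) (auto simp: power2_diff power_mult_distrib algebra_simps)
    also have "\<dots> = c - 2 * t * b + t\<^sup>2 * a"
      unfolding a_def b_def c_def using fi gi fg by simp
    also have "\<dots> = c - b\<^sup>2 / a" using a by (simp add: t_def field_simps power2_eq_square)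
    finally have "b\<^sup>2 / a \<le> c" by simp
    then show ?thesis unfolding a_def[symmetric] b_def[symmetric] c_def[symmetric] using a by (simp add: field_simps)
  qed
qed

locale orthogonal_family =
  fixes M :: "'a measure" and I :: "'i set" and e :: "'i \<Rightarrow> 'a \<Rightarrow> real" and H :: "'i \<Rightarrow> real"
  assumes L2: "\<And>i. i \<in> I \<Longrightarrow> square_integrable M (e i)"
    and orthogonal: "\<And>i j. i \<in> I \<Longrightarrow> j \<in> I \<Longrightarrow> (\<integral>x. e i x * e j x \<partial>M) = (if i = j then H i else 0)"
begin

lemma square_integrable_combination:
  "F \<subseteq> I \<Longrightarrow> square_integrable M (\<lambda>x. \<Sum>i\<in>F. a i * e i x)"
  by (intro square_integrable_sum square_integrable_cmult L2) auto

lemma integral_combination_mult: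
  assumes "F \<subseteq> I" "finite F" "j \<in> I"
  shows "(\<integral>x. (\<Sum>i\<in>F. a i * e i x) * e j x \<partial>M) = (if j \<in> F then a j * H j else 0)"
proof -
  have "(\<integral>x. (\<Sum>i\<in>F. a i * e i x) * e j x \<partial>M) = (\<integral>x. (\<Sum>i\<in>F. a i * (e i x * e j x)) \<partial>M)"
    by (simp add: sum_distrib_right mult.assoc)
  also have "\<dots> = (\<Sum>i\<in>F. a i * (\<integral>x. e i x * e j x \<partial>M))"
    using assms by (subst Bochner_Integration.integral_sum) (auto intro!: square_integrable_mult L2)
  also have "\<dots> = (\<Sum>i\<in>F. if i = j then a j * H j else 0)"
    using assms by (intro sum.cong) (auto simp: orthogonal)
  also have "\<dots> = (if j \<in> F then a j * H j else 0)" using assms(2) by simp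
  finally show ?thesis .
qed

lemma integral_combination_square:
  assumes "F \<subseteq> I" "finite F"
  shows "(\<integral>x. (\<Sum>i\<in>F. a i * e i x)\<^sup>2 \<partial>M) = (\<Sum>i\<in>F. (a i)\<^sup>2 * H i)"
proof -
  have "(\<integral>x. (\<Sum>i\<in>F. a i * e i x)\<^sup>2 \<partial>M) = (\<integral>x. (\<Sum>j\<in>F. a j * ((\<Sum>i\<in>F. a i * e i x) * e j x)) \<partial>M)"
    by (simp add: power2_eq_square sum_distrib_left mult_ac)
  also have "\<dots> = (\<Sum>j\<in>F. a j * (\<integral>x. (\<Sum>i\<in>F. a i * e i x) * e j x \<partial>M))"
    using assms by (subst Bochner_Integration.integral_sum)
      (auto intro!: square_integrable_mult L2 square_integrable_combination)
  also have "\<dots> = (\<Sum>j\<in>F. (a j)\<^sup>2 * H j)"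
    using assms by (intro sum.cong refl) (auto simp: integral_combination_mult[OF assms] power2_eq_square)
  finally show ?thesis .
qed

text \<open>Indices in both sets cancel, and the signs of the others disappear on squaring.\<close>

lemma combination_diff_square:
  assumes "F \<subseteq> I" "finite F" "G \<subseteq> I" "finite G"
  shows "(\<integral>x. ((\<Sum>i\<in>G. a i * e i x) - (\<Sum>i\<in>F. a i * e i x))\<^sup>2 \<partial>M) = (\<Sum>i\<in>(G - F) \<union> (F - G). (a i)\<^sup>2 * H i)"
proof -
  define b where "b i = (if i \<in> G then a i else - a i)" for i
  have "(\<Sum>i\<in>G. a i * e i x) - (\<Sum>i\<in>F. a i * e i x) = (\<Sum>i\<in>(G - F) \<union> (F - G). b i * e i x)" for x
  proof -
    have 1: "(\<Sum>i\<in>(G - F) \<union> (F - G). b i * e i x) = (\<Sum>i\<in>G - F. a i * e i x) - (\<Sum>i\<in>F - G. a i * e i x)"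
      using assms by (subst sum.union_disjoint) (auto simp: b_def sum_negf)
    have "(\<Sum>i\<in>G. a i * e i x) = (\<Sum>i\<in>G - F. a i * e i x) + (\<Sum>i\<in>G \<inter> F. a i * e i x)"
      using sum.Int_Diff[OF assms(4), of "\<lambda>i. a i * e i x" F] by simp
    moreover have "(\<Sum>i\<in>F. a i * e i x) = (\<Sum>i\<in>F - G. a i * e i x) + (\<Sum>i\<in>G \<inter> F. a i * e i x)"
      using sum.Int_Diff[OF assms(2), of "\<lambda>i. a i * e i x" G] by (simp add: Int_commute)
    ultimately show ?thesis unfolding 1 by simp
  qed
  then have "(\<integral>x. ((\<Sum>i\<in>G. a i * e i x) - (\<Sum>i\<in>F. a i * e i x))\<^sup>2 \<partial>M) = (\<integral>x. (\<Sum>i\<in>(G - F) \<union> (F - G). b i * e i x)\<^sup>2 \<partial>M)"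
    by simp
  also have "\<dots> = (\<Sum>i\<in>(G - F) \<union> (F - G). (b i)\<^sup>2 * H i)"
    using assms by (intro integral_combination_square) auto
  also have "\<dots> = (\<Sum>i\<in>(G - F) \<union> (F - G). (a i)\<^sup>2 * H i)"
    by (intro sum.cong) (auto simp: b_def)
  finally show ?thesis .
qed

lemma H_nonneg: "i \<in> I \<Longrightarrow> 0 \<le> H i"
  using orthogonal[of i i] Bochner_Integration.integral_nonneg[of M "\<lambda>x. e i x * e i x"] by simp

text \<open>Once \<open>F\<close> contains \<open>j\<close>, the error of the coefficient is the
  inner product of \<open>e j\<close> with the remainder, which Cauchy-Schwarz bounds by the norm of
  the remainder.\<close>

lemma coefficient_of_limit:
  assumes u: "square_integrable M u" and j: "j \<in> I"
    and lim: "((\<lambda>F. \<integral>x. (u x - (\<Sum>i\<in>F. a i * e i x))\<^sup>2 \<partial>M) \<longlongrightarrow> 0) (finite_subsets_at_top I)"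
  shows "(\<integral>x. u x * e j x \<partial>M) = a j * H j"
proof -
  let ?S = "\<lambda>F x. \<Sum>i\<in>F. a i * e i x"
  define d where "d = (\<integral>x. u x * e j x \<partial>M) - a j * H j"
  have "\<forall>\<^sub>F F in finite_subsets_at_top I. d\<^sup>2 \<le> (\<integral>x. (u x - ?S F x)\<^sup>2 \<partial>M) * H j"
  proof -
    have "\<forall>\<^sub>F F in finite_subsets_at_top I. finite F \<and> {j} \<subseteq> F \<and> F \<subseteq> I"
      unfolding eventually_finite_subsets_at_top using j by (intro exI[of _ "{j}"]) auto
    then show ?thesis
    proof eventually_elim
      case (elim F)
      have S: "square_integrable M (?S F)" using elim by (intro square_integrable_combination) auto
      have "d = (\<integral>x. (u x - ?S F x) * e j x \<partial>M)"
        using elim j integral_combination_mult[of F j a] square_integrable_mult[OF u L2[OF j]] square_integrable_mult[OF S L2[OF j]]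
        by (simp add: d_def left_diff_distrib)
      then have "d\<^sup>2 \<le> (\<integral>x. (u x - ?S F x)\<^sup>2 \<partial>M) * (\<integral>x. (e j x)\<^sup>2 \<partial>M)"
        using integral_Cauchy_Schwarz[OF square_integrable_diff[OF u S] L2[OF j]] by simp
      then show ?case using orthogonal[OF j j] by (simp add: power2_eq_square)
    qed
  qed
  moreover have "((\<lambda>F. (\<integral>x. (u x - ?S F x)\<^sup>2 \<partial>M) * H j) \<longlongrightarrow> 0 * H j) (finite_subsets_at_top I)"
    by (intro tendsto_mult lim tendsto_const)
  ultimately have "d\<^sup>2 \<le> 0 * H j"
    by (intro tendsto_lowerbound[where F = "finite_subsets_at_top I"]) auto
  then have "d = 0" by simp
  then show ?thesis by (simp add: d_def)
qed

lemma limit_unique: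
  assumes u: "square_integrable M u" and v: "square_integrable M v"
    and limu: "((\<lambda>F. \<integral>x. (u x - (\<Sum>i\<in>F. a i * e i x))\<^sup>2 \<partial>M) \<longlongrightarrow> 0) (finite_subsets_at_top I)"
    and limv: "((\<lambda>F. \<integral>x. (v x - (\<Sum>i\<in>F. a i * e i x))\<^sup>2 \<partial>M) \<longlongrightarrow> 0) (finite_subsets_at_top I)"
  shows "AE x in M. u x = v x"
proof -
  let ?S = "\<lambda>F x. \<Sum>i\<in>F. a i * e i x"
  have uv: "square_integrable M (\<lambda>x. u x - v x)" by (rule square_integrable_diff[OF u v])
  have "\<forall>\<^sub>F F in finite_subsets_at_top I. (\<integral>x. (u x - v x)\<^sup>2 \<partial>M) \<le> 2 * (\<integral>x. (u x - ?S F x)\<^sup>2 \<partial>M) + 2 * (\<integral>x. (v x - ?S F x)\<^sup>2 \<partial>M)"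
  proof (rule eventually_finite_subsets_at_top_weakI)
    fix F assume "finite F" "F \<subseteq> I"
    then have S: "square_integrable M (?S F)" by (intro square_integrable_combination)
    have i: "integrable M (\<lambda>x. (u x - ?S F x)\<^sup>2)" "integrable M (\<lambda>x. (v x - ?S F x)\<^sup>2)" "integrable M (\<lambda>x. (u x - v x)\<^sup>2)"
      using square_integrable_diff[OF u S] square_integrable_diff[OF v S] uv by (auto simp: square_integrable_def)
    have "(p - q)\<^sup>2 \<le> 2 * (p - r)\<^sup>2 + 2 * (q - r)\<^sup>2" for p q r :: real
    proof -
      have "0 \<le> ((p - r) + (q - r))\<^sup>2" by simp
      then show ?thesis by (simp add: power2_eq_square algebra_simps)
    qed
    then have "(\<integral>x. (u x - v x)\<^sup>2 \<partial>M) \<le> (\<integral>x. 2 * (u x - ?S F x)\<^sup>2 + 2 * (v x - ?S F x)\<^sup>2 \<partial>M)"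
      using i by (intro integral_mono) auto
    then show "(\<integral>x. (u x - v x)\<^sup>2 \<partial>M) \<le> 2 * (\<integral>x. (u x - ?S F x)\<^sup>2 \<partial>M) + 2 * (\<integral>x. (v x - ?S F x)\<^sup>2 \<partial>M)"
      using i by simp
  qed
  moreover have "((\<lambda>F. 2 * (\<integral>x. (u x - ?S F x)\<^sup>2 \<partial>M) + 2 * (\<integral>x. (v x - ?S F x)\<^sup>2 \<partial>M)) \<longlongrightarrow> 2 * 0 + 2 * 0) (finite_subsets_at_top I)"
    by (intro tendsto_add tendsto_mult limu limv tendsto_const)
  ultimately have "(\<integral>x. (u x - v x)\<^sup>2 \<partial>M) \<le> 2 * 0 + 2 * 0"
    by (intro tendsto_lowerbound[where F = "finite_subsets_at_top I"]) auto
  moreover have "(\<integral>x. (u x - v x)\<^sup>2 \<partial>M) \<ge> 0" by simp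
  ultimately have "(\<integral>x. (u x - v x)\<^sup>2 \<partial>M) = 0" by linarith
  then have "AE x in M. (u x - v x)\<^sup>2 = 0"
    using integral_nonneg_eq_0_iff_AE[of M "\<lambda>x. (u x - v x)\<^sup>2"] uv by (auto simp: square_integrable_def)
  then show ?thesis by eventually_elim simp
qed

text \<open>Partial sums along a nested sequence of finite sets converge almost everywhere, since
  their differences are summable in the L1 norm. The pointwise limit is \<open>u\<close>, and
  Fatou's lemma gives L2 convergence along the whole net of finite sets.\<close>

theorem Riesz_Fischer:
  assumes fin: "finite_measure M" and summable: "(\<lambda>i. (a i)\<^sup>2 * H i) summable_on I"
  obtains u where "square_integrable M u"
    "((\<lambda>F. \<integral>x. (u x - (\<Sum>i\<in>F. a i * e i x))\<^sup>2 \<partial>M) \<longlongrightarrow> 0) (finite_subsets_at_top I)"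
proof -
  interpret finite_measure M by fact
  let ?S = "\<lambda>F x. \<Sum>i\<in>F. a i * e i x"
  let ?q = "\<lambda>i. (a i)\<^sup>2 * H i"
  have q0: "0 \<le> ?q i" if "i \<in> I" for i using H_nonneg[OF that] by simp
  \<comment> \<open>The bound \<open>(1 / 4) ^ k\<close> on squared norms becomes
    \<open>(1 / 2) ^ k\<close> on norms, which is summable.\<close>
  have "\<exists>F0. finite F0 \<and> F0 \<subseteq> I \<and> (\<forall>F. finite F \<and> F \<subseteq> I - F0 \<longrightarrow> sum ?q F < (1 / 4) ^ k)" for k :: nat
  proof -
    define T where "T = infsum ?q I"
    have "(?q has_sum T) I" unfolding T_def by (rule has_sum_infsum[OF summable])
    then have "\<forall>\<^sub>F F in finite_subsets_at_top I. T - (1 / 4) ^ k < sum ?q F"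
      unfolding has_sum_def by (rule order_tendstoD) simp
    then obtain F0 where F0: "finite F0" "F0 \<subseteq> I"
        and F0': "\<forall>F. finite F \<and> F0 \<subseteq> F \<and> F \<subseteq> I \<longrightarrow> T - (1 / 4) ^ k < sum ?q F"
      unfolding eventually_finite_subsets_at_top by (elim exE conjE)
    have "sum ?q F < (1 / 4) ^ k" if F: "finite F" "F \<subseteq> I - F0" for F
    proof -
      have "sum ?q F + sum ?q F0 = sum ?q (F \<union> F0)" using F F0 by (intro sum.union_disjoint[symmetric]) auto
      also have "\<dots> \<le> T" unfolding T_def using F F0 q0 by (intro finite_sum_le_infsum summable) auto
      finally show ?thesis using F0'[rule_format, of F0] F0 by simp
    qed
    then show ?thesis using F0 by blast
  qed
  then obtain F0 where F0: "\<And>k. finite (F0 k)" "\<And>k. F0 k \<subseteq> I"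
      "\<And>k F. finite F \<Longrightarrow> F \<subseteq> I - F0 k \<Longrightarrow> sum ?q F < (1 / 4) ^ k"
    by metis
  define G where "G k = (\<Union>j\<le>k. F0 j)" for k
  have G: "finite (G k)" "G k \<subseteq> I" for k using F0 by (auto simp: G_def)
  have G_mono: "G j \<subseteq> G k" if "j \<le> k" for j k
    unfolding G_def using that by (intro UN_mono) auto
  have tail: "sum ?q F \<le> (1 / 4) ^ k" if "finite F" "F \<subseteq> I - G k" for F k
  proof -
    have "F \<subseteq> I - F0 k" using that(2) by (auto simp: G_def)
    from F0(3)[OF that(1) this] show ?thesis by (rule less_imp_le)
  qed
  define D where "D k x = ?S (G (Suc k)) x - ?S (G k) x" for k x
  have S_L2: "square_integrable M (?S F)" if "F \<subseteq> I" for F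
    using that by (rule square_integrable_combination)
  have D_L2: "square_integrable M (D k)" for k
    unfolding D_def by (intro square_integrable_diff S_L2 G)
  have [measurable]: "D k \<in> borel_measurable M" for k using D_L2 by (simp add: square_integrable_def)
  have S_meas [measurable]: "?S (G k) \<in> borel_measurable M" for k using S_L2[OF G(2)] by (simp add: square_integrable_def)
  have D2: "(\<integral>x. (D k x)\<^sup>2 \<partial>M) \<le> (1 / 4) ^ k" for k
    unfolding D_def using G by (subst combination_diff_square) (auto intro!: tail simp: G_mono[of k "Suc k", THEN subsetD])
  define c where "c = sqrt (measure M (space M))"
  \<comment> \<open>Cauchy-Schwarz against the constant 1; the finiteness of the measure enters
    here.\<close>
  have D1: "(\<integral>\<^sup>+x. ennreal \<bar>D k x\<bar> \<partial>M) \<le> ennreal ((1 / 2) ^ k * c)" for k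
  proof -
    have Dabs: "square_integrable M (\<lambda>x. \<bar>D k x\<bar>)" using D_L2[of k] by (auto simp: square_integrable_def)
    have one: "square_integrable M (\<lambda>x. 1)" by (simp add: square_integrable_def)
    have int: "integrable M (\<lambda>x. \<bar>D k x\<bar>)" using square_integrable_mult[OF Dabs one] by simp
    have "(\<integral>x. \<bar>D k x\<bar> \<partial>M)\<^sup>2 \<le> (\<integral>x. (D k x)\<^sup>2 \<partial>M) * measure M (space M)"
      using integral_Cauchy_Schwarz[OF Dabs one] by simp
    also have "\<dots> \<le> (1 / 4) ^ k * measure M (space M)" by (intro mult_right_mono D2) simp
    also have "\<dots> = ((1 / 2) ^ k * c)\<^sup>2"
      by (simp add: c_def power_mult_distrib power_divide power2_eq_square flip: power_mult_distrib)
    finally have "(\<integral>x. \<bar>D k x\<bar> \<partial>M) \<le> (1 / 2) ^ k * c"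
      by (rule power2_le_imp_le) (simp add: c_def)
    then show ?thesis using int by (subst nn_integral_eq_integral) (auto intro: ennreal_leI)
  qed
  have "(\<integral>\<^sup>+x. (\<Sum>k. ennreal \<bar>D k x\<bar>) \<partial>M) = (\<Sum>k. \<integral>\<^sup>+x. ennreal \<bar>D k x\<bar> \<partial>M)"
    by (intro nn_integral_suminf) measurable
  also have "\<dots> \<le> (\<Sum>k. ennreal ((1 / 2) ^ k * c))" by (intro suminf_le D1 summableI)
  also have "\<dots> < \<infinity>"
  proof -
    have "summable (\<lambda>k. (1 / 2) ^ k * c)" by (intro summable_mult2 summable_geometric) simp
    then show ?thesis by (subst suminf_ennreal2) (auto simp: c_def)
  qed
  finally have "AE x in M. (\<Sum>k. ennreal \<bar>D k x\<bar>) \<noteq> \<infinity>"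
    by (intro nn_integral_PInf_AE) auto
  then have conv: "AE x in M. convergent (\<lambda>k. ?S (G k) x)"
  proof eventually_elim
    fix x assume "(\<Sum>k. ennreal \<bar>D k x\<bar>) \<noteq> \<infinity>"
    then have "summable (\<lambda>k. \<bar>D k x\<bar>)" by (intro summable_suminf_not_top) auto
    then have "summable (\<lambda>k. D k x)" by (rule summable_rabs_cancel)
    then have "(\<lambda>n. \<Sum>k<n. D k x) \<longlonglongrightarrow> (\<Sum>k. D k x)" by (rule summable_LIMSEQ)
    moreover have "(\<Sum>k<n. D k x) = ?S (G n) x - ?S (G 0) x" for n
      unfolding D_def by (rule sum_lessThan_telescope)
    ultimately have "(\<lambda>n. ?S (G n) x - ?S (G 0) x) \<longlonglongrightarrow> (\<Sum>k. D k x)" by simp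
    from tendsto_add[OF this tendsto_const[of "?S (G 0) x"]]
    show "convergent (\<lambda>k. ?S (G k) x)" unfolding convergent_def by auto
  qed
  define u where "u x = lim (\<lambda>k. ?S (G k) x)" for x
  have [measurable]: "u \<in> borel_measurable M" unfolding u_def by measurable
  \<comment> \<open>Fatou in \<open>j\<close> with \<open>F\<close> fixed. The bound holds for every
    finite \<open>F\<close> above \<open>G k\<close>, not only for members of the sequence, as
    convergence of the net demands.\<close>
  have close: "integrable M (\<lambda>x. (u x - ?S F x)\<^sup>2)" "(\<integral>x. (u x - ?S F x)\<^sup>2 \<partial>M) \<le> (1 / 4) ^ k"
    if F: "finite F" "F \<subseteq> I" "G k \<subseteq> F" for F k
  proof -
    have [measurable]: "?S F \<in> borel_measurable M" using S_L2[OF F(2)] by (simp add: square_integrable_def)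
    have "(\<integral>\<^sup>+x. ennreal ((u x - ?S F x)\<^sup>2) \<partial>M) \<le> (\<integral>\<^sup>+x. liminf (\<lambda>j. ennreal ((?S (G j) x - ?S F x)\<^sup>2)) \<partial>M)"
    proof (rule nn_integral_mono_AE)
      show "AE x in M. ennreal ((u x - ?S F x)\<^sup>2) \<le> liminf (\<lambda>j. ennreal ((?S (G j) x - ?S F x)\<^sup>2))"
        using conv
      proof eventually_elim
        fix x assume "convergent (\<lambda>k. ?S (G k) x)"
        then have "(\<lambda>k. ?S (G k) x) \<longlonglongrightarrow> u x" unfolding u_def by (simp add: convergent_LIMSEQ_iff)
        then have "(\<lambda>j. ennreal ((?S (G j) x - ?S F x)\<^sup>2)) \<longlonglongrightarrow> ennreal ((u x - ?S F x)\<^sup>2)"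
          by (intro tendsto_ennrealI tendsto_intros)
        then have "liminf (\<lambda>j. ennreal ((?S (G j) x - ?S F x)\<^sup>2)) = ennreal ((u x - ?S F x)\<^sup>2)"
          by (rule lim_imp_Liminf[OF trivial_limit_sequentially])
        then show "ennreal ((u x - ?S F x)\<^sup>2) \<le> liminf (\<lambda>j. ennreal ((?S (G j) x - ?S F x)\<^sup>2))"
          by (simp only: order_refl)
      qed
    qed
    also have "\<dots> \<le> liminf (\<lambda>j. \<integral>\<^sup>+x. ennreal ((?S (G j) x - ?S F x)\<^sup>2) \<partial>M)"
      by (intro nn_integral_liminf) measurable
    also have "\<dots> \<le> ennreal ((1 / 4) ^ k)"
    proof (rule Liminf_le)
      show "\<forall>\<^sub>F j in sequentially. (\<integral>\<^sup>+x. ennreal ((?S (G j) x - ?S F x)\<^sup>2) \<partial>M) \<le> ennreal ((1 / 4) ^ k)"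
        using eventually_ge_at_top[of k]
      proof eventually_elim
        fix j assume j: "k \<le> j"
        have "integrable M (\<lambda>x. (?S (G j) x - ?S F x)\<^sup>2)"
          using square_integrable_diff[OF S_L2[OF G(2)] S_L2[OF F(2)]] by (simp add: square_integrable_def)
        then have "(\<integral>\<^sup>+x. ennreal ((?S (G j) x - ?S F x)\<^sup>2) \<partial>M) = ennreal (\<integral>x. (?S (G j) x - ?S F x)\<^sup>2 \<partial>M)"
          by (intro nn_integral_eq_integral) auto
        also have "(\<integral>x. (?S (G j) x - ?S F x)\<^sup>2 \<partial>M) \<le> (1 / 4) ^ k"
        proof -
          have "(G j - F) \<union> (F - G j) \<subseteq> I - G k" using F G(2)[of j] G_mono[OF j] by blast
          moreover have "finite ((G j - F) \<union> (F - G j))" using F(1) G(1) by simp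
          ultimately show ?thesis
            unfolding combination_diff_square[OF F(2,1) G(2,1)] by (intro tail)
        qed
        finally show "(\<integral>\<^sup>+x. ennreal ((?S (G j) x - ?S F x)\<^sup>2) \<partial>M) \<le> ennreal ((1 / 4) ^ k)"
          by (simp add: ennreal_leI)
      qed
    qed simp
    finally have le: "(\<integral>\<^sup>+x. ennreal ((u x - ?S F x)\<^sup>2) \<partial>M) \<le> ennreal ((1 / 4) ^ k)" .
    then have "(\<integral>\<^sup>+x. ennreal ((u x - ?S F x)\<^sup>2) \<partial>M) < \<infinity>" by (rule le_less_trans) simp
    then show int: "integrable M (\<lambda>x. (u x - ?S F x)\<^sup>2)"
      by (intro integrableI_nonneg) auto
    show "(\<integral>x. (u x - ?S F x)\<^sup>2 \<partial>M) \<le> (1 / 4) ^ k"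
      using le int by (subst (asm) nn_integral_eq_integral) auto
  qed
  have uS: "square_integrable M (\<lambda>x. u x - ?S (G 0) x)"
    using close(1)[of "G 0" 0] G by (simp add: square_integrable_def)
  have "square_integrable M u"
    using square_integrable_add[OF uS S_L2[OF G(2), of 0]] by simp
  moreover have "((\<lambda>F. \<integral>x. (u x - ?S F x)\<^sup>2 \<partial>M) \<longlongrightarrow> 0) (finite_subsets_at_top I)"
  proof (rule tendstoI)
    fix r :: real assume "0 < r"
    then obtain k where k: "(1 / 4) ^ k < r" using real_arch_pow_inv[of r "1 / 4"] by auto
    have "\<forall>\<^sub>F F in finite_subsets_at_top I. finite F \<and> G k \<subseteq> F \<and> F \<subseteq> I"
      unfolding eventually_finite_subsets_at_top using G by (intro exI[of _ "G k"]) auto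
    then show "\<forall>\<^sub>F F in finite_subsets_at_top I. dist (\<integral>x. (u x - ?S F x)\<^sup>2 \<partial>M) 0 < r"
    proof eventually_elim
      case (elim F)
      then show ?case using close(2)[of F k] k by (simp add: abs_of_nonneg)
    qed
  qed
  ultimately show thesis by (rule that)
qed

end

section \<open>The weighted space as an L2 space\<close>

definition weighted_measure :: "real \<Rightarrow> (real^2) measure" where
  "weighted_measure \<beta> = density (restrict_space lebesgue unit_disk) (\<lambda>x. ennreal (disk_weight \<beta> x))"

lemma unit_disk_in_sets: "unit_disk \<inter> space lebesgue \<in> sets lebesgue"
  by simp

lemma measurable_disk_weight [measurable]: "disk_weight \<beta> \<in> borel_measurable (restrict_space lebesgue unit_disk)"
proof -
  have "disk_weight \<beta> \<in> borel_measurable borel" unfolding disk_weight_def[abs_def] by measurable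
  then show ?thesis by (intro measurable_restrict_space1 measurable_completion) simp
qed

lemma sets_weighted_measure [measurable_cong]: "sets (weighted_measure \<beta>) = sets (restrict_space lebesgue unit_disk)"
  by (simp add: weighted_measure_def)

lemma borel_measurable_weighted_measure_iff:
  fixes f :: "real^2 \<Rightarrow> real"
  shows "f \<in> borel_measurable (weighted_measure \<beta>) \<longleftrightarrow> set_borel_measurable lebesgue unit_disk f"
  unfolding measurable_cong_sets[OF sets_weighted_measure refl] set_borel_measurable_def
  by (rule borel_measurable_restrict_space_iff[OF unit_disk_in_sets])

lemma weighted_measure_integral:
  fixes f :: "real^2 \<Rightarrow> real"
  assumes "f \<in> borel_measurable (weighted_measure \<beta>)"
  shows "integrable (weighted_measure \<beta>) f \<longleftrightarrow> set_integrable lebesgue unit_disk (\<lambda>x. disk_weight \<beta> x * f x)"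
    and "integral\<^sup>L (weighted_measure \<beta>) f = set_lebesgue_integral lebesgue unit_disk (\<lambda>x. disk_weight \<beta> x * f x)"
proof -
  have [measurable]: "f \<in> borel_measurable (restrict_space lebesgue unit_disk)"
    using assms unfolding measurable_cong_sets[OF sets_weighted_measure refl] .
  have nn: "AE x in restrict_space lebesgue unit_disk. 0 \<le> disk_weight \<beta> x" by (simp add: disk_weight_def)
  show "integrable (weighted_measure \<beta>) f \<longleftrightarrow> set_integrable lebesgue unit_disk (\<lambda>x. disk_weight \<beta> x * f x)"
    unfolding weighted_measure_def set_integrable_def
    by (subst integrable_density[OF _ _ nn], measurable) (simp add: integrable_restrict_space[OF unit_disk_in_sets])
  show "integral\<^sup>L (weighted_measure \<beta>) f = set_lebesgue_integral lebesgue unit_disk (\<lambda>x. disk_weight \<beta> x * f x)"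
    unfolding weighted_measure_def set_lebesgue_integral_def
    by (subst integral_density[OF _ _ nn], measurable) (simp add: integral_restrict_space[OF unit_disk_in_sets])
qed

lemma weighted_L2_iff: "g \<in> weighted_L2 \<beta> \<longleftrightarrow> square_integrable (weighted_measure \<beta>) g"
proof -
  have "integrable (weighted_measure \<beta>) (\<lambda>x. (g x)\<^sup>2) \<longleftrightarrow> set_integrable lebesgue unit_disk (\<lambda>x. disk_weight \<beta> x * (g x)\<^sup>2)"
    if "g \<in> borel_measurable (weighted_measure \<beta>)"
    using that by (intro weighted_measure_integral(1) borel_measurable_power)
  then show ?thesis
    unfolding weighted_L2_def square_integrable_def mem_Collect_eq borel_measurable_weighted_measure_iff
    by blast
qed

lemma weighted_norm_eq:
  "g \<in> borel_measurable (weighted_measure \<beta>) \<Longrightarrow> weighted_norm \<beta> g = sqrt (\<integral>x. (g x)\<^sup>2 \<partial>weighted_measure \<beta>)"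
  unfolding weighted_norm_def by (subst weighted_measure_integral(2)) auto

lemma finite_weighted_measure:
  assumes "-1 < \<beta>"
  shows "finite_measure (weighted_measure \<beta>)"
proof -
  have "set_integrable lebesgue unit_disk (\<lambda>x. disk_weight \<beta> x * 1)"
    using integrable_disk_weight[OF assms] set_integrable_disk_iff[of "\<lambda>z. (1 - (cmod z)\<^sup>2) powr \<beta>"]
    by (simp add: disk_weight_def)
  then have "integrable (weighted_measure \<beta>) (\<lambda>x. 1 :: real)"
    by (subst weighted_measure_integral(1)) auto
  then show ?thesis
    by (intro finite_measureI) (auto simp: integrable_iff_bounded less_top)
qed

text \<open>The density is positive on the open disk, so null sets of the weighted measure are
  Lebesgue null sets there.\<close>

lemma AE_weighted_measure:
  assumes "AE x in weighted_measure \<beta>. P x"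
  shows "AE x in lebesgue. x \<in> unit_disk \<longrightarrow> P x"
proof -
  have "AE x in restrict_space lebesgue unit_disk. 0 < ennreal (disk_weight \<beta> x) \<longrightarrow> P x"
    using assms unfolding weighted_measure_def by (subst (asm) AE_density) auto
  then have "AE x in lebesgue. x \<in> unit_disk \<longrightarrow> 0 < ennreal (disk_weight \<beta> x) \<longrightarrow> P x"
    by (subst (asm) AE_restrict_space_iff) auto
  then show ?thesis
    by eventually_elim (auto simp: disk_weight_def abs_square_eq_1 abs_square_less_1 dest: one_minus_cmod_square_pos)
qed

lemma measurable_disk_basis: "disk_basis \<beta> i \<in> borel_measurable (weighted_measure \<gamma>)"
proof -
  have "(\<lambda>x. disk_basis_complex \<beta> i (to_complex x)) \<in> borel_measurable borel"
    by (rule measurable_compose[OF measurable_to_complex measurable_disk_basis_complex])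
  then have "disk_basis \<beta> i \<in> borel_measurable borel" by (simp add: disk_basis_eq[abs_def])
  then have "disk_basis \<beta> i \<in> borel_measurable (restrict_space lebesgue unit_disk)"
    by (intro measurable_restrict_space1 measurable_completion) simp
  then show ?thesis unfolding measurable_cong_sets[OF sets_weighted_measure refl] .
qed

lemma square_integrable_disk_basis:
  assumes "-1 < \<beta>"
  shows "square_integrable (weighted_measure \<beta>) (disk_basis \<beta> i)"
proof -
  have [measurable]: "disk_basis \<beta> i \<in> borel_measurable (weighted_measure \<beta>)" by (rule measurable_disk_basis)
  have "integrable disk_measure (\<lambda>z. (1 - (cmod z)\<^sup>2) powr \<beta> *\<^sub>R (disk_basis_complex \<beta> i z)\<^sup>2)"
    by (intro integrable_disk_weight_mult assms continuous_intros continuous_disk_basis_complex)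
  then have "set_integrable lebesgue unit_disk (\<lambda>x. disk_weight \<beta> x * (disk_basis \<beta> i x)\<^sup>2)"
    using set_integrable_disk_iff[of "\<lambda>z. (1 - (cmod z)\<^sup>2) powr \<beta> *\<^sub>R (disk_basis_complex \<beta> i z)\<^sup>2"]
    by (simp add: disk_basis_eq disk_weight_def)
  then show ?thesis unfolding square_integrable_def
    by (subst weighted_measure_integral(1)) (auto simp: measurable_disk_basis)
qed

lemma disk_basis_orthogonal:
  assumes "-1 < \<beta>" "i \<in> basis_index" "j \<in> basis_index"
  shows "(\<integral>x. disk_basis \<beta> i x * disk_basis \<beta> j x \<partial>weighted_measure \<beta>) = (if i = j then basis_norm2 \<beta> i else 0)"
proof -
  have [measurable]: "disk_basis \<beta> i \<in> borel_measurable (weighted_measure \<beta>)" for i by (rule measurable_disk_basis)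
  have "(\<integral>x. disk_basis \<beta> i x * disk_basis \<beta> j x \<partial>weighted_measure \<beta>)
     = set_lebesgue_integral lebesgue unit_disk (\<lambda>x. disk_weight \<beta> x * (disk_basis \<beta> i x * disk_basis \<beta> j x))"
    by (rule weighted_measure_integral(2)) measurable
  also have "\<dots> = (\<integral>z. (1 - (cmod z)\<^sup>2) powr \<beta> * (disk_basis_complex \<beta> i z * disk_basis_complex \<beta> j z) \<partial>disk_measure)"
    using set_integral_disk_eq[of "\<lambda>z. (1 - (cmod z)\<^sup>2) powr \<beta> * (disk_basis_complex \<beta> i z * disk_basis_complex \<beta> j z)"]
    by (simp add: disk_basis_eq disk_weight_def)
  also have "\<dots> = (if i = j then basis_norm2 \<beta> i else 0)" by (rule disk_basis_complex_orthogonal[OF assms])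
  finally show ?thesis .
qed

lemma orthogonal_family_disk_basis:
  "-1 < \<beta> \<Longrightarrow> orthogonal_family (weighted_measure \<beta>) basis_index (disk_basis \<beta>) (basis_norm2 \<beta>)"
  by unfold_locales (auto intro: square_integrable_disk_basis simp: disk_basis_orthogonal)

lemma weighted_norm_disk_basis:
  assumes "-1 < \<beta>" "i \<in> basis_index"
  shows "(weighted_norm \<beta> (disk_basis \<beta> i))\<^sup>2 = basis_norm2 \<beta> i"
  using disk_basis_orthogonal[OF assms assms(2)] basis_norm2_pos[OF assms(1), of i]
  by (simp add: weighted_norm_eq measurable_disk_basis power2_eq_square[of "disk_basis _ _ _"])

lemma basis_coeff_eq:
  assumes "-1 < \<beta>" "i \<in> basis_index" "v \<in> borel_measurable (weighted_measure \<beta>)"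
  shows "basis_coeff \<beta> v i = (\<integral>x. v x * disk_basis \<beta> i x \<partial>weighted_measure \<beta>) / basis_norm2 \<beta> i"
proof -
  have [measurable]: "disk_basis \<beta> i \<in> borel_measurable (weighted_measure \<beta>)" for i by (rule measurable_disk_basis)
  note [measurable] = assms(3)
  show ?thesis
    unfolding basis_coeff_def weighted_norm_disk_basis[OF assms(1,2)]
    by (subst weighted_measure_integral(2)) auto
qed

lemma has_expansion_iff:
  assumes "-1 < \<beta>"
  shows "has_expansion \<beta> a v \<longleftrightarrow> square_integrable (weighted_measure \<beta>) v \<and>
     ((\<lambda>F. \<integral>x. (v x - (\<Sum>i\<in>F. a i * disk_basis \<beta> i x))\<^sup>2 \<partial>weighted_measure \<beta>) \<longlongrightarrow> 0) (finite_subsets_at_top basis_index)"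
proof (cases "square_integrable (weighted_measure \<beta>) v")
  case True
  have [measurable]: "disk_basis \<beta> i \<in> borel_measurable (weighted_measure \<beta>)" for i by (rule measurable_disk_basis)
  have [measurable]: "v \<in> borel_measurable (weighted_measure \<beta>)" using True by (simp add: square_integrable_def)
  let ?g = "\<lambda>F. \<integral>x. (v x - (\<Sum>i\<in>F. a i * disk_basis \<beta> i x))\<^sup>2 \<partial>weighted_measure \<beta>"
  have norm: "weighted_norm \<beta> (\<lambda>x. v x - (\<Sum>i\<in>F. a i * disk_basis \<beta> i x)) = sqrt (?g F)" for F
    by (rule weighted_norm_eq) measurable
  have "((\<lambda>F. sqrt (?g F)) \<longlongrightarrow> 0) G \<longleftrightarrow> (?g \<longlongrightarrow> 0) G" for G
  proof
    assume "((\<lambda>F. sqrt (?g F)) \<longlongrightarrow> 0) G"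
    then have "((\<lambda>F. (sqrt (?g F))\<^sup>2) \<longlongrightarrow> 0\<^sup>2) G" by (intro tendsto_power)
    then show "(?g \<longlongrightarrow> 0) G" by simp
  next
    assume "(?g \<longlongrightarrow> 0) G"
    then have "((\<lambda>F. sqrt (?g F)) \<longlongrightarrow> sqrt 0) G" by (rule tendsto_real_sqrt)
    then show "((\<lambda>F. sqrt (?g F)) \<longlongrightarrow> 0) G" by simp
  qed
  then show ?thesis using True unfolding has_expansion_def weighted_L2_iff norm by simp
qed (simp add: has_expansion_def weighted_L2_iff)

lemma has_expansion_coeff:
  assumes "-1 < \<beta>" "has_expansion \<beta> a v" "i \<in> basis_index"
  shows "basis_coeff \<beta> v i = a i"
proof -
  interpret orthogonal_family "weighted_measure \<beta>" basis_index "disk_basis \<beta>" "basis_norm2 \<beta>"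
    by (rule orthogonal_family_disk_basis[OF assms(1)])
  have v: "square_integrable (weighted_measure \<beta>) v" using assms by (simp add: has_expansion_iff)
  then have "v \<in> borel_measurable (weighted_measure \<beta>)" by (simp add: square_integrable_def)
  moreover have "(\<integral>x. v x * disk_basis \<beta> i x \<partial>weighted_measure \<beta>) = a i * basis_norm2 \<beta> i"
    using assms by (intro coefficient_of_limit[OF v]) (auto simp: has_expansion_iff)
  ultimately show ?thesis using basis_norm2_pos[OF assms(1), of i] assms by (simp add: basis_coeff_eq)
qed

lemma has_expansion_unique:
  assumes "-1 < \<beta>" "has_expansion \<beta> a v" "has_expansion \<beta> a' v'" and eq: "\<And>i. i \<in> basis_index \<Longrightarrow> a i = a' i"
  shows "AE x in lebesgue. x \<in> unit_disk \<longrightarrow> v x = v' x"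
proof (rule AE_weighted_measure)
  interpret orthogonal_family "weighted_measure \<beta>" basis_index "disk_basis \<beta>" "basis_norm2 \<beta>"
    by (rule orthogonal_family_disk_basis[OF assms(1)])
  have "((\<lambda>F. \<integral>x. (v' x - (\<Sum>i\<in>F. a i * disk_basis \<beta> i x))\<^sup>2 \<partial>weighted_measure \<beta>) \<longlongrightarrow> 0) (finite_subsets_at_top basis_index)
     \<longleftrightarrow> ((\<lambda>F. \<integral>x. (v' x - (\<Sum>i\<in>F. a' i * disk_basis \<beta> i x))\<^sup>2 \<partial>weighted_measure \<beta>) \<longlongrightarrow> 0) (finite_subsets_at_top basis_index)"
  proof (rule tendsto_cong, rule eventually_finite_subsets_at_top_weakI)
    fix F assume "finite F" "F \<subseteq> basis_index"
    then have "(\<Sum>i\<in>F. a i * disk_basis \<beta> i x) = (\<Sum>i\<in>F. a' i * disk_basis \<beta> i x)" for x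
      using eq by (intro sum.cong) auto
    then show "(\<integral>x. (v' x - (\<Sum>i\<in>F. a i * disk_basis \<beta> i x))\<^sup>2 \<partial>weighted_measure \<beta>) = (\<integral>x. (v' x - (\<Sum>i\<in>F. a' i * disk_basis \<beta> i x))\<^sup>2 \<partial>weighted_measure \<beta>)"
      by simp
  qed
  then show "AE x in weighted_measure \<beta>. v x = v' x"
    using assms by (intro limit_unique[of v v' a]) (auto simp: has_expansion_iff)
qed

lemma has_expansion_exists:
  assumes "-1 < \<beta>" "(\<lambda>i. (a i)\<^sup>2 * basis_norm2 \<beta> i) summable_on basis_index"
  obtains u where "has_expansion \<beta> a u"
proof -
  interpret orthogonal_family "weighted_measure \<beta>" basis_index "disk_basis \<beta>" "basis_norm2 \<beta>"
    by (rule orthogonal_family_disk_basis[OF assms(1)])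
  obtain u where "square_integrable (weighted_measure \<beta>) u"
    "((\<lambda>F. \<integral>x. (u x - (\<Sum>i\<in>F. a i * disk_basis \<beta> i x))\<^sup>2 \<partial>weighted_measure \<beta>) \<longlongrightarrow> 0) (finite_subsets_at_top basis_index)"
    by (rule Riesz_Fischer[OF finite_weighted_measure[OF assms(1)] assms(2)])
  then show thesis using that assms(1) by (auto simp: has_expansion_iff)
qed

lemma B_space_iff:
  assumes "-1 < \<beta>"
  shows "v \<in> B_space \<beta> s1 s2 \<longleftrightarrow> square_integrable (weighted_measure \<beta>) v \<and>
     (\<lambda>(l, n, \<mu>). (real l powr (2 * s1) + real n powr (2 * s2)) * ((basis_coeff \<beta> v (l, n, \<mu>))\<^sup>2 * basis_norm2 \<beta> (l, n, \<mu>)))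
       summable_on basis_index"
proof -
  have "(\<lambda>(l, n, \<mu>). (real l powr (2 * s1) + real n powr (2 * s2))
        * (basis_coeff \<beta> v (l, n, \<mu>))\<^sup>2 * (weighted_norm \<beta> (disk_basis \<beta> (l, n, \<mu>)))\<^sup>2) summable_on basis_index
    \<longleftrightarrow> (\<lambda>(l, n, \<mu>). (real l powr (2 * s1) + real n powr (2 * s2)) * ((basis_coeff \<beta> v (l, n, \<mu>))\<^sup>2 * basis_norm2 \<beta> (l, n, \<mu>)))
       summable_on basis_index"
    by (rule summable_on_cong) (auto simp: weighted_norm_disk_basis[OF assms])
  then show ?thesis unfolding B_space_def weighted_L2_iff by simp
qed

text \<open>Agreement on the disk is enough, since the coefficient integral does not see the rest of
  the plane. This is the form in which the values of the operator are known.\<close>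

lemma basis_coeff_combination:
  assumes "-1 < \<beta>" and F: "finite F" "F \<subseteq> basis_index" and j: "j \<in> basis_index"
    and v: "\<And>x. x \<in> unit_disk \<Longrightarrow> v x = (\<Sum>i\<in>F. a i * disk_basis \<beta> i x)"
  shows "basis_coeff \<beta> v j = (if j \<in> F then a j else 0)"
proof -
  interpret orthogonal_family "weighted_measure \<beta>" basis_index "disk_basis \<beta>" "basis_norm2 \<beta>"
    by (rule orthogonal_family_disk_basis[OF assms(1)])
  have [measurable]: "disk_basis \<beta> i \<in> borel_measurable (weighted_measure \<beta>)" for i by (rule measurable_disk_basis)
  have "basis_coeff \<beta> v j = basis_coeff \<beta> (\<lambda>x. \<Sum>i\<in>F. a i * disk_basis \<beta> i x) j"
    unfolding basis_coeff_def
    by (intro arg_cong2[where f = "(/)"] refl set_lebesgue_integral_cong) (auto simp: v)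
  also have "\<dots> = (if j \<in> F then a j else 0)"
    using basis_norm2_pos[OF assms(1), of j]
    by (subst basis_coeff_eq[OF assms(1) j]) (auto simp: integral_combination_mult[OF F(2,1) j])
  finally show ?thesis .
qed

section \<open>Tridiagonal systems\<close>

text \<open>Extension by zero gives the first and the last equation the same form as the others;
  integer positions allow \<open>p - 1\<close> to leave the range.\<close>

definition tridiagonal_solution :: "real \<Rightarrow> int \<Rightarrow> (int \<Rightarrow> real) \<Rightarrow> (int \<Rightarrow> real) \<Rightarrow> bool" where
  "tridiagonal_solution k N g X \<longleftrightarrow> (\<forall>p. p \<notin> {0..N} \<longrightarrow> X p = 0) \<and>
     (\<forall>p\<in>{0..N}. X p + k * (X (p + 1) + X (p - 1)) = g p)"

text \<open>Neumann series: the neighbour sum \<open>A\<close> has norm at most 2 for the supremum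
  norm, and \<open>\<bar>k\<bar> < 1 / 2\<close>.\<close>

lemma tridiagonal_solution_exists:
  assumes k: "\<bar>k\<bar> < 1 / 2"
  obtains X where "tridiagonal_solution k N g X"
proof -
  define A where "A Y p = (if p \<in> {0..N} then Y (p + 1) + Y (p - 1) else (0::real))" for Y p
  define g0 where "g0 p = (if p \<in> {0..N} then g p else 0)" for p
  define Y where "Y n = (A ^^ n) g0" for n
  define M where "M = (\<Sum>p\<in>{0..N}. \<bar>g p\<bar>)"
  have M0: "0 \<le> M" unfolding M_def by (intro sum_nonneg) auto
  have Y_bound: "\<bar>Y n p\<bar> \<le> 2 ^ n * M" for n p
  proof (induction n arbitrary: p)
    case 0
    have "\<bar>g p\<bar> \<le> M" if "p \<in> {0..N}" unfolding M_def using that by (intro member_le_sum) auto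
    then show ?case using M0 by (auto simp: Y_def g0_def)
  next
    case (Suc n)
    have "\<bar>Y (Suc n) p\<bar> \<le> \<bar>Y n (p + 1)\<bar> + \<bar>Y n (p - 1)\<bar>" by (simp add: Y_def A_def abs_triangle_ineq)
    also have "\<dots> \<le> 2 ^ n * M + 2 ^ n * M" using Suc.IH by (intro add_mono)
    finally show ?case by (simp add: algebra_simps)
  qed
  have summable: "summable (\<lambda>n. (- k) ^ n * Y n p)" for p
  proof (rule summable_comparison_test')
    show "summable (\<lambda>n. (2 * \<bar>k\<bar>) ^ n * M)" using k by (intro summable_mult2 summable_geometric) auto
    show "norm ((- k) ^ n * Y n p) \<le> (2 * \<bar>k\<bar>) ^ n * M" for n
      using mult_left_mono[OF Y_bound[of n p], of "\<bar>k\<bar> ^ n"]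
      by (simp add: abs_mult power_abs power_mult_distrib mult_ac)
  qed
  define X where "X p = (\<Sum>n. (- k) ^ n * Y n p)" for p
  have "X p = 0" if "p \<notin> {0..N}" for p
  proof -
    have "Y n p = 0" for n using that by (cases n) (auto simp: Y_def A_def g0_def)
    then show ?thesis by (simp add: X_def)
  qed
  moreover have "X p + k * (X (p + 1) + X (p - 1)) = g p" if p: "p \<in> {0..N}" for p
  proof -
    have "X p = Y 0 p + (\<Sum>n. (- k) ^ Suc n * Y (Suc n) p)"
      unfolding X_def using suminf_split_head[OF summable[of p]] by simp
    also have "(\<Sum>n. (- k) ^ Suc n * Y (Suc n) p) = (\<Sum>n. - k * ((- k) ^ n * Y n (p + 1) + (- k) ^ n * Y n (p - 1)))"
      using p by (simp add: Y_def A_def algebra_simps)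
    also have "\<dots> = - k * (X (p + 1) + X (p - 1))"
      unfolding X_def suminf_add[OF summable summable]
      by (rule suminf_mult) (intro summable_add summable)
    finally show ?thesis using p by (simp add: Y_def g0_def)
  qed
  ultimately show thesis using that unfolding tridiagonal_solution_def by blast
qed

text \<open>Maximum principle: where the difference of two solutions is largest in absolute value,
  its size \<open>m\<close> satisfies \<open>m \<le> 2 * \<bar>k\<bar> * m\<close> with a factor
  below 1.\<close>

lemma tridiagonal_solution_unique:
  assumes k: "\<bar>k\<bar> < 1 / 2" and X: "tridiagonal_solution k N g X" and Z: "tridiagonal_solution k N g' Z"
    and g: "\<And>p. p \<in> {0..N} \<Longrightarrow> g p = g' p"
  shows "X p = Z p"
proof (cases "0 \<le> N")
  case True
  define D where "D p = \<bar>X p - Z p\<bar>" for p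
  define m where "m = Max (D ` {0..N})"
  have le: "D q \<le> m" for q
  proof (cases "q \<in> {0..N}")
    case in_range: True
    then show ?thesis unfolding m_def by (intro Max_ge) auto
  next
    case False
    have "0 \<le> D 0" by (simp add: D_def)
    also have "\<dots> \<le> m" using True unfolding m_def by (intro Max_ge) auto
    finally show ?thesis using False X Z by (simp add: D_def tridiagonal_solution_def)
  qed
  have "m \<in> D ` {0..N}" unfolding m_def using True by (intro Max_in) auto
  then obtain q where q: "q \<in> {0..N}" "m = D q" by auto
  have "X q + k * (X (q + 1) + X (q - 1)) = Z q + k * (Z (q + 1) + Z (q - 1))"
    using X Z g q(1) unfolding tridiagonal_solution_def by metis
  then have "X q - Z q = - k * ((X (q + 1) - Z (q + 1)) + (X (q - 1) - Z (q - 1)))" by (simp add: algebra_simps)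
  then have "m = \<bar>k\<bar> * \<bar>(X (q + 1) - Z (q + 1)) + (X (q - 1) - Z (q - 1))\<bar>"
    unfolding q(2) D_def by (simp only: abs_mult abs_minus_cancel)
  also have "\<dots> \<le> \<bar>k\<bar> * (m + m)"
    using le[of "q + 1"] le[of "q - 1"] unfolding D_def by (intro mult_left_mono) auto
  finally have "m \<le> 2 * \<bar>k\<bar> * m" by simp
  moreover have "0 \<le> m" unfolding q(2) D_def by simp
  ultimately have "m = 0" using k mult_right_mono[of "2 * \<bar>k\<bar>" 1 m] mult_less_cancel_right[of "2 * \<bar>k\<bar>" m 1] by auto
  then show ?thesis using le[of p] by (simp add: D_def)
next
  case False
  then show ?thesis using X Z by (auto simp: tridiagonal_solution_def)
qed

text \<open>A weight changing by a factor of at most \<open>1 + \<delta>\<close> between neighbours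
  keeps the tridiagonal operator diagonally dominant.\<close>

lemma tridiagonal_solution_estimate:
  fixes \<omega> :: "int \<Rightarrow> real"
  assumes X: "tridiagonal_solution k N g X"
    and \<omega>0: "\<And>p. p \<in> {0..N} \<Longrightarrow> 0 \<le> \<omega> p"
    and \<omega>1: "\<And>p. p \<in> {0..N} \<Longrightarrow> p + 1 \<in> {0..N} \<Longrightarrow> \<omega> p \<le> (1 + \<delta>) * \<omega> (p + 1)"
    and \<omega>2: "\<And>p. p \<in> {0..N} \<Longrightarrow> p + 1 \<in> {0..N} \<Longrightarrow> \<omega> (p + 1) \<le> (1 + \<delta>) * \<omega> p"
    and \<delta>: "0 < \<delta>" and q: "(1 + \<delta>)\<^sup>2 * (4 * k\<^sup>2) \<le> q" "q < 1"
  shows "(\<Sum>p\<in>{0..N}. \<omega> p * (X p)\<^sup>2) \<le> (1 + 1 / \<delta>) / (1 - q) * (\<Sum>p\<in>{0..N}. \<omega> p * (g p)\<^sup>2)"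
proof -
  have X0: "X p = 0" if "p \<notin> {0..N}" for p using X that by (auto simp: tridiagonal_solution_def)
  define S T where "S = (\<Sum>p\<in>{0..N}. \<omega> p * (X p)\<^sup>2)" and "T = (\<Sum>p\<in>{0..N}. \<omega> p * (g p)\<^sup>2)"
  have nonneg: "0 \<le> \<omega> p * (X p)\<^sup>2" if "p \<in> {0..N}" for p using \<omega>0[OF that] by simp
  have shift1: "(\<Sum>p\<in>{0..N}. \<omega> p * (X (p + 1))\<^sup>2) \<le> (1 + \<delta>) * S"
  proof -
    have "(\<Sum>p\<in>{0..N}. \<omega> p * (X (p + 1))\<^sup>2) = (\<Sum>p\<in>{p\<in>{0..N}. p + 1 \<in> {0..N}}. \<omega> p * (X (p + 1))\<^sup>2)"
      by (rule sum.mono_neutral_right) (auto simp: X0)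
    also have "\<dots> \<le> (\<Sum>p\<in>{p\<in>{0..N}. p + 1 \<in> {0..N}}. (1 + \<delta>) * (\<omega> (p + 1) * (X (p + 1))\<^sup>2))"
      using \<omega>1 by (intro sum_mono) (auto simp: mult.assoc[symmetric] intro!: mult_right_mono)
    also have "\<dots> = (\<Sum>p\<in>(\<lambda>p. p + 1) ` {p\<in>{0..N}. p + 1 \<in> {0..N}}. (1 + \<delta>) * (\<omega> p * (X p)\<^sup>2))"
      by (subst sum.reindex) (auto simp: inj_on_def)
    also have "\<dots> \<le> (\<Sum>p\<in>{0..N}. (1 + \<delta>) * (\<omega> p * (X p)\<^sup>2))"
      using nonneg \<delta> by (intro sum_mono2) auto
    finally show ?thesis by (simp add: S_def sum_distrib_left)
  qed
  have shift2: "(\<Sum>p\<in>{0..N}. \<omega> p * (X (p - 1))\<^sup>2) \<le> (1 + \<delta>) * S"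
  proof -
    have "(\<Sum>p\<in>{0..N}. \<omega> p * (X (p - 1))\<^sup>2) = (\<Sum>p\<in>{p\<in>{0..N}. p - 1 \<in> {0..N}}. \<omega> p * (X (p - 1))\<^sup>2)"
    proof (rule sum.mono_neutral_right)
      show "\<forall>p\<in>{0..N} - {p\<in>{0..N}. p - 1 \<in> {0..N}}. \<omega> p * (X (p - 1))\<^sup>2 = 0"
      proof
        fix p assume "p \<in> {0..N} - {p\<in>{0..N}. p - 1 \<in> {0..N}}"
        then have "p - 1 \<notin> {0..N}" by auto
        from X0[OF this] show "\<omega> p * (X (p - 1))\<^sup>2 = 0" by simp
      qed
    qed auto
    also have "\<dots> \<le> (\<Sum>p\<in>{p\<in>{0..N}. p - 1 \<in> {0..N}}. (1 + \<delta>) * (\<omega> (p - 1) * (X (p - 1))\<^sup>2))"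
    proof (rule sum_mono)
      fix p assume "p \<in> {p\<in>{0..N}. p - 1 \<in> {0..N}}"
      then have "\<omega> p \<le> (1 + \<delta>) * \<omega> (p - 1)" using \<omega>2[of "p - 1"] by auto
      then show "\<omega> p * (X (p - 1))\<^sup>2 \<le> (1 + \<delta>) * (\<omega> (p - 1) * (X (p - 1))\<^sup>2)"
        by (auto simp: mult.assoc[symmetric] intro!: mult_right_mono)
    qed
    also have "\<dots> = (\<Sum>p\<in>(\<lambda>p. p - 1) ` {p\<in>{0..N}. p - 1 \<in> {0..N}}. (1 + \<delta>) * (\<omega> p * (X p)\<^sup>2))"
      by (subst sum.reindex) (auto simp: inj_on_def)
    also have "\<dots> \<le> (\<Sum>p\<in>{0..N}. (1 + \<delta>) * (\<omega> p * (X p)\<^sup>2))"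
      using nonneg \<delta> by (intro sum_mono2) auto
    finally show ?thesis by (simp add: S_def sum_distrib_left)
  qed
  \<comment> \<open>The parameter \<open>\<delta>\<close> is spent so that the neighbour terms keep
    a factor close to 1, while the large factor \<open>1 + 1 / \<delta>\<close> falls on the
    data.\<close>
  have young: "(u - v)\<^sup>2 \<le> (1 + 1 / \<delta>) * u\<^sup>2 + (1 + \<delta>) * v\<^sup>2" for u v :: real
  proof -
    have "0 \<le> (u / sqrt \<delta> + sqrt \<delta> * v)\<^sup>2" by simp
    also have "\<dots> = u\<^sup>2 / \<delta> + 2 * u * v + \<delta> * v\<^sup>2"
      using \<delta> by (simp add: power2_sum power_divide power_mult_distrib)
    finally show ?thesis by (simp add: power2_eq_square algebra_simps)
  qed
  have pt: "\<omega> p * (X p)\<^sup>2 \<le> (1 + 1 / \<delta>) * (\<omega> p * (g p)\<^sup>2) + (1 + \<delta>) * (2 * k\<^sup>2) * (\<omega> p * (X (p + 1))\<^sup>2 + \<omega> p * (X (p - 1))\<^sup>2)"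
    if p: "p \<in> {0..N}" for p
  proof -
    have "X p = g p - k * (X (p + 1) + X (p - 1))" using X p by (auto simp: tridiagonal_solution_def algebra_simps)
    then have "(X p)\<^sup>2 \<le> (1 + 1 / \<delta>) * (g p)\<^sup>2 + (1 + \<delta>) * (k * (X (p + 1) + X (p - 1)))\<^sup>2"
      using young by simp
    also have "(k * (X (p + 1) + X (p - 1)))\<^sup>2 \<le> 2 * k\<^sup>2 * ((X (p + 1))\<^sup>2 + (X (p - 1))\<^sup>2)"
    proof -
      have "0 \<le> k\<^sup>2 * (X (p + 1) - X (p - 1))\<^sup>2" by simp
      then show ?thesis by (simp add: power2_eq_square algebra_simps)
    qed
    finally have "(X p)\<^sup>2 \<le> (1 + 1 / \<delta>) * (g p)\<^sup>2 + (1 + \<delta>) * (2 * k\<^sup>2 * ((X (p + 1))\<^sup>2 + (X (p - 1))\<^sup>2))"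
      using \<delta> by simp
    then have "\<omega> p * (X p)\<^sup>2 \<le> \<omega> p * ((1 + 1 / \<delta>) * (g p)\<^sup>2 + (1 + \<delta>) * (2 * k\<^sup>2 * ((X (p + 1))\<^sup>2 + (X (p - 1))\<^sup>2)))"
      using \<omega>0[OF p] by (intro mult_left_mono)
    then show ?thesis by (simp add: algebra_simps)
  qed
  have "S \<le> (\<Sum>p\<in>{0..N}. (1 + 1 / \<delta>) * (\<omega> p * (g p)\<^sup>2) + (1 + \<delta>) * (2 * k\<^sup>2) * (\<omega> p * (X (p + 1))\<^sup>2 + \<omega> p * (X (p - 1))\<^sup>2))"
    unfolding S_def by (intro sum_mono pt)
  also have "\<dots> = (1 + 1 / \<delta>) * T + (1 + \<delta>) * (2 * k\<^sup>2) * ((\<Sum>p\<in>{0..N}. \<omega> p * (X (p + 1))\<^sup>2) + (\<Sum>p\<in>{0..N}. \<omega> p * (X (p - 1))\<^sup>2))"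
    by (simp only: T_def sum.distrib sum_distrib_left[symmetric])
  \<comment> \<open>One factor \<open>1 + \<delta>\<close> comes from Young's inequality, the other
    from shifting the weight; with two neighbours the total is
    \<open>(1 + \<delta>)\<^sup>2 * (4 * k\<^sup>2)\<close>, below 1, and is absorbed on the
    left.\<close>
  also have "\<dots> \<le> (1 + 1 / \<delta>) * T + (1 + \<delta>) * (2 * k\<^sup>2) * ((1 + \<delta>) * S + (1 + \<delta>) * S)"
    using \<delta> shift1 shift2 by (intro add_left_mono mult_left_mono add_mono) auto
  also have "(1 + \<delta>) * (2 * k\<^sup>2) * ((1 + \<delta>) * S + (1 + \<delta>) * S) = (1 + \<delta>)\<^sup>2 * (4 * k\<^sup>2) * S"
    by (simp add: power2_eq_square algebra_simps)
  also have "\<dots> \<le> q * S"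
    using nonneg q(1) unfolding S_def by (intro mult_right_mono sum_nonneg) auto
  finally have "(1 - q) * S \<le> (1 + 1 / \<delta>) * T" by (simp add: algebra_simps)
  then show ?thesis unfolding S_def[symmetric] T_def[symmetric] using q(2) by (simp add: field_simps)
qed

lemma slowly_varying_powr:
  fixes x y h a b :: real
  assumes "0 < x" "0 < y" "y \<le> (1 + h) * x" "0 \<le> h" "0 \<le> a" "a \<le> b"
  shows "y powr a \<le> (1 + h) powr b * x powr a"
proof -
  have "y powr a \<le> ((1 + h) * x) powr a" using assms by (intro powr_mono2) auto
  also have "\<dots> = (1 + h) powr a * x powr a" using assms by (intro powr_mult)
  also have "\<dots> \<le> (1 + h) powr b * x powr a" using assms by (intro mult_right_mono powr_mono) auto
  finally show ?thesis .
qed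

section \<open>Growth of the Gamma quotients\<close>

definition gamma_ratio :: "real \<Rightarrow> nat \<Rightarrow> real" where
  "gamma_ratio s n = Gamma (s + real n + 1) / fact n"

lemma gamma_ratio_pos: "0 < s \<Longrightarrow> 0 < gamma_ratio s n"
  unfolding gamma_ratio_def by (intro divide_pos_pos Gamma_real_pos) auto

lemma Gamma_log_convex:
  fixes x y t :: real
  assumes "0 < x" "0 < y" "0 \<le> t" "t \<le> 1"
  shows "Gamma ((1 - t) * x + t * y) \<le> Gamma x powr (1 - t) * Gamma y powr t"
proof -
  have pos: "0 < (1 - t) * x + t * y"
  proof (cases "t = 0")
    case False
    then have "0 < t * y" using assms by simp
    moreover have "0 \<le> (1 - t) * x" using assms by simp
    ultimately show ?thesis by linarith
  qed (use assms in simp)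
  have G: "0 < Gamma x" "0 < Gamma y" "0 < Gamma ((1 - t) * x + t * y)" using assms pos by (auto intro!: Gamma_real_pos)
  have "ln (Gamma ((1 - t) * x + t * y)) \<le> (1 - t) * ln (Gamma x) + t * ln (Gamma y)"
    using convex_onD[OF log_convex_Gamma_real, of t x y] assms by simp
  also have "\<dots> = ln (Gamma x powr (1 - t) * Gamma y powr t)"
    using G by (simp add: ln_mult ln_powr)
  finally show ?thesis using G by simp
qed

text \<open>Both bounds are log-convexity of Gamma between arguments at distance 1. The factor 2
  pays for replacing \<open>s + n + 1\<close> by \<open>2 * (n + 1)\<close>.\<close>

lemma gamma_ratio_bounds:
  assumes s: "0 < s" "s < 1"
  shows "gamma_ratio s n \<le> (real n + 1) powr s" and "(real n + 1) powr s \<le> 2 * gamma_ratio s n"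
proof -
  have F: "Gamma (real n + 1) = fact n" by (metis Gamma_fact add.commute)
  have F2: "Gamma (real n + 2) = (real n + 1) * fact n"
  proof -
    have "Gamma (real n + 1 + 1) = (real n + 1) * Gamma (real n + 1)"
      by (rule Gamma_plus1) (auto elim!: nonpos_Ints_cases)
    then show ?thesis unfolding F by (simp add: add.assoc)
  qed
  have "Gamma (s + real n + 1) \<le> Gamma (real n + 1) powr (1 - s) * Gamma (real n + 2) powr s"
    using Gamma_log_convex[of "real n + 1" "real n + 2" s] s by (simp add: algebra_simps)
  also have "\<dots> = fact n * (real n + 1) powr s"
    unfolding F F2 by (simp add: powr_mult powr_diff)
  finally show "gamma_ratio s n \<le> (real n + 1) powr s"
    by (simp add: gamma_ratio_def field_simps)
  define g where "g = Gamma (s + real n + 1)"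
  have g: "0 < g" unfolding g_def using s by (intro Gamma_real_pos) auto
  have g2: "Gamma (s + real n + 2) = (s + real n + 1) * g"
  proof -
    have "Gamma (s + real n + 1 + 1) = (s + real n + 1) * Gamma (s + real n + 1)"
      using s by (intro Gamma_plus1) (auto elim!: nonpos_Ints_cases)
    then show ?thesis by (simp add: g_def add.assoc)
  qed
  \<comment> \<open>\<open>n + 2\<close> is the convex combination of \<open>s + n + 1\<close> and
    \<open>s + n + 2\<close> with weights \<open>s\<close> and \<open>1 - s\<close>.\<close>
  have "Gamma (real n + 2) \<le> g powr s * Gamma (s + real n + 2) powr (1 - s)"
    using Gamma_log_convex[of "s + real n + 1" "s + real n + 2" "1 - s"] s by (simp add: g_def algebra_simps)
  also have "\<dots> = g * (s + real n + 1) powr (1 - s)"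
    unfolding g2 using g s by (simp add: powr_mult powr_diff)
  also have "\<dots> \<le> g * (2 * (real n + 1)) powr (1 - s)"
    using g s by (intro mult_left_mono powr_mono2) auto
  also have "(2 * (real n + 1)) powr (1 - s) \<le> 2 * (real n + 1) powr (1 - s)"
  proof -
    have "(2::real) powr (1 - s) \<le> 2 powr 1" using s by (intro powr_mono) auto
    then show ?thesis by (subst powr_mult) (auto intro!: mult_right_mono)
  qed
  finally have "(real n + 1) * fact n \<le> g * (2 * (real n + 1) powr (1 - s))"
    unfolding F2 using g by (simp add: mult_left_mono)
  then have "(real n + 1) * fact n * (real n + 1) powr s \<le> g * (2 * (real n + 1) powr (1 - s)) * (real n + 1) powr s"
    by (intro mult_right_mono) auto
  also have "g * (2 * (real n + 1) powr (1 - s)) * (real n + 1) powr s = (real n + 1) * (2 * g)"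
  proof -
    have "(real n + 1) powr (1 - s) * (real n + 1) powr s = real n + 1" by (simp add: powr_add[symmetric])
    then show ?thesis by (simp add: mult_ac)
  qed
  finally have "(real n + 1) * (fact n * (real n + 1) powr s) \<le> (real n + 1) * (2 * g)"
    by (simp add: mult_ac)
  then have "fact n * (real n + 1) powr s \<le> 2 * g" by (rule mult_left_le_imp_le) simp
  then show "(real n + 1) powr s \<le> 2 * gamma_ratio s n"
    unfolding gamma_ratio_def g_def by (simp add: field_simps)
qed

section \<open>The operator in the basis\<close>

definition parity :: "int \<Rightarrow> real" where
  "parity \<mu> = (if \<mu> = 1 then 1 else - 1)"

lemma part_cnj: "part \<mu> (cnj z) = parity \<mu> * part \<mu> z"
  by (simp add: part_def parity_def)

text \<open>The move \<open>(a, b)\<close> to \<open>(a - 1, b + 1)\<close> lowers the signed order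
  \<open>a - b\<close> from \<open>l\<close> to \<open>l - 2\<close>. For \<open>l = 1\<close> and
  \<open>l = 0\<close> the new order is -1 and -2; conjugation folds it back to 1 and 2, at the
  price of the sign \<open>parity \<mu>\<close> in \<open>lower_coeff\<close>.\<close>

fun lower_index :: "nat \<times> nat \<times> int \<Rightarrow> nat \<times> nat \<times> int" where
  "lower_index (l, n, \<mu>) = (if 2 \<le> l then (l - 2, n + 1, \<mu>) else if l = 1 then (1, n, \<mu>) else (2, n - 1, \<mu>))"

fun lower_coeff :: "real \<Rightarrow> nat \<times> nat \<times> int \<Rightarrow> real" where
  "lower_coeff s (l, n, \<mu>) = (if 2 \<le> l then gamma_ratio s n * gamma_ratio s (n + l - 1)
     else if l = 1 then parity \<mu> * gamma_ratio s n * gamma_ratio s (n + 1)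
     else if n = 0 then 0 else parity \<mu> * gamma_ratio s n * gamma_ratio s (n + 1))"

fun upper_index :: "nat \<times> nat \<times> int \<Rightarrow> nat \<times> nat \<times> int" where
  "upper_index (l, n, \<mu>) = (l + 2, n - 1, \<mu>)"

fun upper_coeff :: "real \<Rightarrow> nat \<times> nat \<times> int \<Rightarrow> real" where
  "upper_coeff s (l, n, \<mu>) = (if n = 0 then 0 else gamma_ratio s n * gamma_ratio s (n + l + 1))"

fun diagonal_coeff :: "real \<Rightarrow> nat \<times> nat \<times> int \<Rightarrow> real" where
  "diagonal_coeff s (l, n, \<mu>) = gamma_ratio s n * gamma_ratio s (n + l)"

lemma part_zernike_eq:
  assumes "-1 < \<beta>"
  shows "part \<mu> (zernike \<beta> (n + l) n (to_complex x)) = fact n * Gamma (\<beta> + real n + real l + 1) * disk_basis \<beta> (l, n, \<mu>) x"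
proof -
  have "0 < Gamma (\<beta> + real n + real l + 1)" using assms by (intro Gamma_real_pos) linarith
  then show ?thesis unfolding disk_basis_eq_zernike[OF assms] by simp
qed

lemma frac_diffusion_disk_basis:
  assumes s: "0 < s" "s < 1" and x: "x \<in> unit_disk"
    and K: "K = vector [vector [k1, 0], vector [0, k2]]"
  shows "frac_diffusion (2 * s) K (tilde (2 * s) (disk_basis s i)) x
    = 4 powr (s - 1) * (2 * (k1 + k2) * (diagonal_coeff s i * disk_basis s i x)
      + (k1 - k2) * (lower_coeff s i * disk_basis s (lower_index i) x + upper_coeff s i * disk_basis s (upper_index i) x))"
proof -
  obtain l n \<mu> where i: "i = (l, n, \<mu>)" by (cases i)
  have s1: "-1 < s" using s by simp
  define ga where "ga = Gamma (s + real (n + l) + 1)"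
  define gb where "gb = Gamma (s + real n + 1)"
  \<comment> \<open>The normalisation that turns the part of the Zernike polynomial into the basis
    function \<open>i\<close>; it multiplies the linear map to which the formula above is
    applied.\<close>
  define \<kappa> where "\<kappa> = 1 / (fact n * ga)"
  have g: "0 < ga" "0 < gb" using s unfolding ga_def gb_def by (auto intro!: Gamma_real_pos)
  let ?p = "\<lambda>z. part \<mu> z * \<kappa>"
  let ?P = "\<lambda>a b. part \<mu> (zernike s a b (to_complex x))"
  have p: "bounded_linear ?p"
    by (intro bounded_linear_mult_const bounded_linear_part)
  have add: "part \<mu> (u + v) = part \<mu> u + part \<mu> v" for u v
    by (simp add: part_def)
  have w: "tilde (2 * s) (disk_basis s i) y = ?p (of_real ((1 - (norm y)\<^sup>2) powr s) * zernike s (n + l) n (to_complex y))"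
    if "y \<in> unit_disk" for y
    using that unfolding part_of_real_mult part_zernike_eq[OF s1] i
    using g by (simp add: tilde_def disk_weight_def \<kappa>_def ga_def add.assoc)
  \<comment> \<open>Needed when lowering leads to a pair with the smaller index first, that is for
    \<open>l = 1\<close> and \<open>l = 0\<close>.\<close>
  have flip: "?P a b = parity \<mu> * ?P b a" for a b
    unfolding cnj_zernike[of s b a, symmetric] part_cnj by (simp add: cnj_zernike)
  have main: "frac_diffusion (2 * s) K (tilde (2 * s) (disk_basis s i)) x = 4 powr (s - 1) * ((
      2 * (k1 + k2) * (ga * gb / (fact (n + l) * fact n)) * ?P (n + l) n
      + (k1 - k2) * (real (n + l) * (ga * gb / (fact (n + l) * fact (n + 1))) * ?P (n + l - 1) (n + 1)
          + real n * (ga * gb / (fact (n + l + 1) * fact n)) * ?P (n + l + 1) (n - 1))) * \<kappa>)"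
    using frac_diffusion_weighted_zernike[OF s x p K w]
    unfolding add part_of_real_mult ga_def[symmetric] gb_def[symmetric] by simp
  have t0: "ga * gb / (fact (n + l) * fact n) * ?P (n + l) n * \<kappa> = diagonal_coeff s i * disk_basis s i x"
    unfolding part_zernike_eq[OF s1] i using g
    by (simp add: \<kappa>_def gamma_ratio_def ga_def gb_def add.assoc mult_ac)
  have t1: "real (n + l) * (ga * gb / (fact (n + l) * fact (n + 1))) * ?P (n + l - 1) (n + 1) * \<kappa>
     = lower_coeff s i * disk_basis s (lower_index i) x"
  proof -
    consider (ge2) l' where "l = l' + 2" | (one) "l = 1" | (zero) "l = 0"
      by (metis One_nat_def add_2_eq_Suc' not0_implies_Suc)
    then show ?thesis
    proof cases
      case ge2
      have P: "?P (n + l - 1) (n + 1) = fact (n + 1) * Gamma (s + real (n + 1) + real l' + 1) * disk_basis s (l', n + 1, \<mu>) x"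
        using part_zernike_eq[OF s1, of \<mu> "n + 1" l' x] by (simp add: ge2 add_ac)
      have "(fact (n + l) :: real) = real (n + l) * fact (n + l - 1)" by (rule fact_reduce) (simp add: ge2)
      moreover have "real (n + l) > 0" by (simp add: ge2)
      ultimately have f: "real (n + l) / fact (n + l) = 1 / (fact (n + l - 1) :: real)" by simp
      have G: "Gamma (s + real (n + 1) + real l' + 1) = gamma_ratio s (n + l - 1) * fact (n + l - 1)"
        by (simp add: gamma_ratio_def ge2 add_ac)
      have "real (n + l) * (ga * gb / (fact (n + l) * fact (n + 1))) * ?P (n + l - 1) (n + 1) * \<kappa>
         = (real (n + l) / fact (n + l)) * (gb / fact n) * (Gamma (s + real (n + 1) + real l' + 1) * disk_basis s (l', n + 1, \<mu>) x)"
        unfolding P \<kappa>_def using g by (simp add: field_simps del: fact_Suc of_nat_add)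
      also have "\<dots> = gamma_ratio s n * gamma_ratio s (n + l - 1) * disk_basis s (l', n + 1, \<mu>) x"
        unfolding f G by (simp add: gamma_ratio_def[of s n] gb_def)
      finally show ?thesis by (simp add: i ge2)
    next
      case one
      have P: "?P (n + l - 1) (n + 1) = parity \<mu> * (fact n * ga * disk_basis s (1, n, \<mu>) x)"
        using part_zernike_eq[OF s1, of \<mu> n 1 x] flip[of n "n + 1"] by (simp add: one ga_def add_ac)
      have "real (n + l) * (ga * gb / (fact (n + l) * fact (n + 1))) * ?P (n + l - 1) (n + 1) * \<kappa>
         = parity \<mu> * (gb / fact n) * (ga / fact (n + 1)) * disk_basis s (1, n, \<mu>) x"
      proof -
        define r F where "r = real (n + 1)" and "F = (fact n :: real)"
        have r: "r > 0" "F > 0" by (simp_all add: r_def F_def)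
        have f: "(fact (n + 1) :: real) = r * F" by (simp add: r_def F_def)
        show ?thesis
          unfolding P \<kappa>_def unfolding one f r_def[symmetric] F_def[symmetric] using g r by (simp add: field_simps)
      qed
      then show ?thesis by (simp add: i one gamma_ratio_def ga_def gb_def add_ac)
    next
      case zero
      show ?thesis
      proof (cases n)
        case 0
        then show ?thesis by (simp add: i zero)
      next
        case (Suc m)
        have P: "?P (n + l - 1) (n + 1) = parity \<mu> * (fact m * Gamma (s + real (n + 1) + 1) * disk_basis s (2, m, \<mu>) x)"
          using part_zernike_eq[OF s1, of \<mu> m 2 x] flip[of m "m + 2"] by (simp add: zero Suc add_ac)
        have gg: "gb = ga" by (simp add: ga_def gb_def zero)
        have "real (n + l) * (ga * gb / (fact (n + l) * fact (n + 1))) * ?P (n + l - 1) (n + 1) * \<kappa>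
           = parity \<mu> * (gb / fact n) * (Gamma (s + real (n + 1) + 1) / fact (n + 1)) * disk_basis s (2, m, \<mu>) x"
        proof -
          define r F F1 where "r = real n" and "F = (fact m :: real)" and "F1 = (fact (n + 1) :: real)"
          have r: "r > 0" "F > 0" "F1 > 0" by (simp_all add: r_def F_def F1_def Suc)
          have f: "(fact n :: real) = r * F" by (simp add: r_def F_def Suc)
          have l: "n + l = n" by (simp add: zero)
          show ?thesis
            unfolding P \<kappa>_def gg unfolding l f r_def[symmetric] F_def[symmetric] F1_def[symmetric] using g r by (simp add: field_simps)
        qed
        then show ?thesis by (simp add: i zero Suc gamma_ratio_def gb_def add_ac)
      qed
    qed
  qed
  have t2: "real n * (ga * gb / (fact (n + l + 1) * fact n)) * ?P (n + l + 1) (n - 1) * \<kappa>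
     = upper_coeff s i * disk_basis s (upper_index i) x"
  proof (cases n)
    case 0
    then show ?thesis by (simp add: i)
  next
    case (Suc m)
    have P: "?P (n + l + 1) (n - 1) = fact m * Gamma (s + real (n + l + 1) + 1) * disk_basis s (l + 2, m, \<mu>) x"
      using part_zernike_eq[OF s1, of \<mu> m "l + 2" x] by (simp add: Suc add_ac)
    have "real n * (ga * gb / (fact (n + l + 1) * fact n)) * ?P (n + l + 1) (n - 1) * \<kappa>
       = (gb / fact n) * (Gamma (s + real (n + l + 1) + 1) / fact (n + l + 1)) * disk_basis s (l + 2, m, \<mu>) x"
    proof -
      define r F F1 where "r = real n" and "F = (fact m :: real)" and "F1 = (fact (n + l + 1) :: real)"
      have r: "r > 0" "F > 0" "F1 > 0" by (simp_all add: r_def F_def F1_def Suc)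
      have f: "(fact n :: real) = r * F" by (simp add: r_def F_def Suc)
      show ?thesis
        unfolding P \<kappa>_def unfolding f r_def[symmetric] F_def[symmetric] F1_def[symmetric] using g r by (simp add: field_simps)
    qed
    then show ?thesis by (simp add: i Suc gamma_ratio_def gb_def add_ac)
  qed
  show ?thesis
    unfolding main t0[symmetric] t1[symmetric] t2[symmetric] by (simp only: distrib_right distrib_left mult.assoc)
qed

text \<open>Raising or lowering may lead to \<open>(0, n, -1)\<close>, outside the index set. The
  sine of order 0 is the zero function, so such terms drop out.\<close>

lemma disk_basis_not_index: "i = (l, n, \<mu>) \<Longrightarrow> \<mu> \<in> {1, -1} \<Longrightarrow> i \<notin> basis_index \<Longrightarrow> disk_basis \<beta> i x = 0"
  by (auto simp: basis_index_def disk_basis_def solid_harmonic_def)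

text \<open>The contributions are added rather than distinguished by cases because their targets can
  coincide: lowering fixes an index with \<open>l = 1\<close>, and from \<open>l = 0\<close>
  lowering and raising lead to the same index.\<close>

lemma basis_coeff_frac_diffusion:
  assumes s: "0 < s" "s < 1" and K: "K = vector [vector [k1, 0], vector [0, k2]]"
    and i: "i \<in> basis_index" and j: "j \<in> basis_index"
  shows "basis_coeff s (frac_diffusion (2 * s) K (tilde (2 * s) (disk_basis s i))) j
    = 4 powr (s - 1) * (2 * (k1 + k2) * (if i = j then diagonal_coeff s i else 0)
      + (k1 - k2) * ((if lower_index i = j then lower_coeff s i else 0) + (if upper_index i = j then upper_coeff s i else 0)))"
proof -
  define F where "F = {i, lower_index i, upper_index i} \<inter> basis_index"
  define a where "a m = 4 powr (s - 1) * (2 * (k1 + k2) * (if i = m then diagonal_coeff s i else 0)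
      + (k1 - k2) * ((if lower_index i = m then lower_coeff s i else 0) + (if upper_index i = m then upper_coeff s i else 0)))" for m
  have F: "finite F" "F \<subseteq> basis_index" by (auto simp: F_def)
  have single: "(\<Sum>m\<in>F. (if r = m then c else 0) * disk_basis s m x) = c * disk_basis s r x"
    if "r \<in> {i, lower_index i, upper_index i}" for r c x
  proof (cases "r \<in> basis_index")
    case True
    then have "r \<in> F" using that by (auto simp: F_def)
    have "(\<Sum>m\<in>F. (if r = m then c else 0) * disk_basis s m x) = (\<Sum>m\<in>F. if r = m then c * disk_basis s m x else 0)"
      by (intro sum.cong) auto
    then show ?thesis using F \<open>r \<in> F\<close> by simp
  next
    case False
    obtain l n \<mu> where i_eq: "i = (l, n, \<mu>)" by (cases i)
    have \<mu>: "\<mu> \<in> {1, -1}" using i by (auto simp: i_eq basis_index_def)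
    have "\<exists>l' n'. r = (l', n', \<mu>)" using that by (auto simp: i_eq)
    then have "disk_basis s r x = 0" using False \<mu> disk_basis_not_index by blast
    moreover have "(\<Sum>m\<in>F. (if r = m then c else 0) * disk_basis s m x) = 0"
      using False F by (intro sum.neutral) auto
    ultimately show ?thesis by simp
  qed
  have "basis_coeff s (frac_diffusion (2 * s) K (tilde (2 * s) (disk_basis s i))) j = (if j \<in> F then a j else 0)"
  proof (rule basis_coeff_combination[OF _ F j])
    fix x :: "real^2" assume x: "x \<in> unit_disk"
    have "(\<Sum>m\<in>F. a m * disk_basis s m x) = 4 powr (s - 1) * (2 * (k1 + k2) * (\<Sum>m\<in>F. (if i = m then diagonal_coeff s i else 0) * disk_basis s m x)
      + (k1 - k2) * ((\<Sum>m\<in>F. (if lower_index i = m then lower_coeff s i else 0) * disk_basis s m x)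
          + (\<Sum>m\<in>F. (if upper_index i = m then upper_coeff s i else 0) * disk_basis s m x)))"
      unfolding a_def sum_distrib_left sum.distrib[symmetric] by (intro sum.cong refl) (simp add: algebra_simps)
    then show "frac_diffusion (2 * s) K (tilde (2 * s) (disk_basis s i)) x = (\<Sum>m\<in>F. a m * disk_basis s m x)"
      unfolding frac_diffusion_disk_basis[OF s x K] by (simp add: single)
  qed (use s in simp)
  also have "\<dots> = a j" using j by (auto simp: F_def a_def)
  finally show ?thesis unfolding a_def .
qed

lemma has_sum_single_point:
  assumes "\<And>i. i \<in> A \<Longrightarrow> i \<noteq> a \<Longrightarrow> f i = 0"
  shows "(f has_sum (if a \<in> A then f a else 0)) A"
proof -
  have "(f has_sum (if a \<in> A then f a else 0)) A \<longleftrightarrow> (f has_sum (if a \<in> A then f a else 0)) (A \<inter> {a})"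
    using assms by (intro has_sum_cong_neutral) auto
  moreover have "(f has_sum sum f (A \<inter> {a})) (A \<inter> {a})" by (intro has_sum_finite) simp
  moreover have "sum f (A \<inter> {a}) = (if a \<in> A then f a else 0)" by auto
  ultimately show ?thesis by simp
qed

text \<open>One row of the operator: besides the diagonal, the entries lowered from
  \<open>l + 2\<close>, reflected at \<open>l = 1\<close>, lowered from order 0 through -2 to
  \<open>l = 2\<close>, and raised from \<open>l - 2\<close>. In the row \<open>l = 2\<close>,
  \<open>\<mu> = 1\<close> the index \<open>(0, n + 1, 1)\<close> occurs twice.\<close>

definition operator_coeff :: "real \<Rightarrow> real \<Rightarrow> real \<Rightarrow> (nat \<times> nat \<times> int \<Rightarrow> real) \<Rightarrow> nat \<Rightarrow> nat \<Rightarrow> int \<Rightarrow> real" where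
  "operator_coeff s k1 k2 v l n \<mu> = 4 powr (s - 1) * gamma_ratio s (n + l) * (2 * (k1 + k2) * (gamma_ratio s n * v (l, n, \<mu>))
     + (k1 - k2) * ((if n = 0 then 0 else gamma_ratio s (n - 1) * v (l + 2, n - 1, \<mu>))
        + (if l = 1 then parity \<mu> * gamma_ratio s n * v (l, n, \<mu>) else 0)
        + (if l = 2 \<and> \<mu> = 1 then gamma_ratio s (n + 1) * v (0, n + 1, \<mu>) else 0)
        + (if l > 2 \<or> l = 2 \<and> \<mu> = 1 then gamma_ratio s (n + 1) * v (l - 2, n + 1, \<mu>) else 0)))"

text \<open>Among the indices with \<open>l \<ge> 2\<close>, with \<open>l = 1\<close> and with
  \<open>l = 0\<close>, at most one with nonzero coefficient is lowered to the given index, and at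
  most one is raised to it. The sum thus splits into pieces with at most one nonzero term
  each.\<close>

lemma has_sum_operator_coeff:
  assumes s: "0 < s" "s < 1" and K: "K = vector [vector [k1, 0], vector [0, k2]]"
    and j: "(l, n, \<mu>) \<in> basis_index"
  shows "((\<lambda>i. v i * basis_coeff s (frac_diffusion (2 * s) K (tilde (2 * s) (disk_basis s i))) (l, n, \<mu>))
     has_sum operator_coeff s k1 k2 v l n \<mu>) basis_index"
proof -
  let ?I = "basis_index" and ?j = "(l, n, \<mu>)" and ?g = "gamma_ratio s"
  have \<mu>: "\<mu> \<in> {1, -1}" "l = 0 \<Longrightarrow> \<mu> = 1" using j by (auto simp: basis_index_def)
  define f0 where "f0 i = v i * (if i = ?j then diagonal_coeff s i else 0)" for i
  define f1 where "f1 i = v i * (if 2 \<le> fst i \<and> lower_index i = ?j then lower_coeff s i else 0)" for i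
  define f2 where "f2 i = v i * (if fst i = 1 \<and> lower_index i = ?j then lower_coeff s i else 0)" for i
  define f3 where "f3 i = v i * (if fst i = 0 \<and> lower_index i = ?j then lower_coeff s i else 0)" for i
  define f4 where "f4 i = v i * (if upper_index i = ?j then upper_coeff s i else 0)" for i
  have h0: "(f0 has_sum (if ?j \<in> ?I then f0 ?j else 0)) ?I"
    by (rule has_sum_single_point) (auto simp: f0_def)
  have h1: "(f1 has_sum (if (l + 2, n - 1, \<mu>) \<in> ?I then f1 (l + 2, n - 1, \<mu>) else 0)) ?I"
    by (rule has_sum_single_point) (auto simp: f1_def split: if_splits)
  have h2: "(f2 has_sum (if ?j \<in> ?I then f2 ?j else 0)) ?I"
    by (rule has_sum_single_point) (auto simp: f2_def split: if_splits)
  have h3: "(f3 has_sum (if (0, n + 1, \<mu>) \<in> ?I then f3 (0, n + 1, \<mu>) else 0)) ?I"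
    by (rule has_sum_single_point) (auto simp: f3_def split: if_splits)
  have h4: "(f4 has_sum (if (l - 2, n + 1, \<mu>) \<in> ?I then f4 (l - 2, n + 1, \<mu>) else 0)) ?I"
    by (rule has_sum_single_point) (auto simp: f4_def split: if_splits)
  have v0: "(if ?j \<in> ?I then f0 ?j else 0) = ?g (n + l) * (?g n * v ?j)"
    using j by (simp add: f0_def)
  \<comment> \<open>For \<open>n = 0\<close> the candidate arises from a truncated subtraction only;
    it is lowered to a different index and contributes 0.\<close>
  have v1: "(if (l + 2, n - 1, \<mu>) \<in> ?I then f1 (l + 2, n - 1, \<mu>) else 0) = ?g (n + l) * (if n = 0 then 0 else ?g (n - 1) * v (l + 2, n - 1, \<mu>))"
    using \<mu> by (cases n) (auto simp: f1_def basis_index_def)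
  have v2: "(if ?j \<in> ?I then f2 ?j else 0) = ?g (n + l) * (if l = 1 then parity \<mu> * ?g n * v (l, n, \<mu>) else 0)"
    using j by (auto simp: f2_def)
  have v3: "(if (0, n + 1, \<mu>) \<in> ?I then f3 (0, n + 1, \<mu>) else 0) = ?g (n + l) * (if l = 2 \<and> \<mu> = 1 then ?g (n + 1) * v (0, n + 1, \<mu>) else 0)"
    using \<mu> by (auto simp: f3_def basis_index_def parity_def add_ac)
  have v4: "(if (l - 2, n + 1, \<mu>) \<in> ?I then f4 (l - 2, n + 1, \<mu>) else 0)
     = ?g (n + l) * (if l > 2 \<or> l = 2 \<and> \<mu> = 1 then ?g (n + 1) * v (l - 2, n + 1, \<mu>) else 0)"
  proof (cases "l \<ge> 2")
    case True
    then obtain l' where l': "l = l' + 2" by (metis le_add_diff_inverse2)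
    show ?thesis using \<mu> by (auto simp: l' f4_def basis_index_def add_ac)
  qed (auto simp: f4_def)
  have eq: "v i * basis_coeff s (frac_diffusion (2 * s) K (tilde (2 * s) (disk_basis s i))) ?j
     = 4 powr (s - 1) * (2 * (k1 + k2) * f0 i + (k1 - k2) * (f1 i + f2 i + f3 i + f4 i))" if "i \<in> ?I" for i
  proof -
    have "f1 i + f2 i + f3 i = v i * (if lower_index i = ?j then lower_coeff s i else 0)"
      by (auto simp: f1_def f2_def f3_def)
    then show ?thesis
      unfolding basis_coeff_frac_diffusion[OF s K that j] by (simp add: f0_def f4_def algebra_simps)
  qed
  have "((\<lambda>i. 4 powr (s - 1) * (2 * (k1 + k2) * f0 i + (k1 - k2) * (f1 i + f2 i + f3 i + f4 i))) has_sum
      4 powr (s - 1) * (2 * (k1 + k2) * (?g (n + l) * (?g n * v ?j)) + (k1 - k2) * (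
        ?g (n + l) * (if n = 0 then 0 else ?g (n - 1) * v (l + 2, n - 1, \<mu>))
        + ?g (n + l) * (if l = 1 then parity \<mu> * ?g n * v (l, n, \<mu>) else 0)
        + ?g (n + l) * (if l = 2 \<and> \<mu> = 1 then ?g (n + 1) * v (0, n + 1, \<mu>) else 0)
        + ?g (n + l) * (if l > 2 \<or> l = 2 \<and> \<mu> = 1 then ?g (n + 1) * v (l - 2, n + 1, \<mu>) else 0)))) ?I"
    using h0 h1 h2 h3 h4 unfolding v0 v1 v2 v3 v4
    by (intro has_sum_cmult_right has_sum_add)
  also have "4 powr (s - 1) * (2 * (k1 + k2) * (?g (n + l) * (?g n * v ?j)) + (k1 - k2) * (
        ?g (n + l) * (if n = 0 then 0 else ?g (n - 1) * v (l + 2, n - 1, \<mu>))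
        + ?g (n + l) * (if l = 1 then parity \<mu> * ?g n * v (l, n, \<mu>) else 0)
        + ?g (n + l) * (if l = 2 \<and> \<mu> = 1 then ?g (n + 1) * v (0, n + 1, \<mu>) else 0)
        + ?g (n + l) * (if l > 2 \<or> l = 2 \<and> \<mu> = 1 then ?g (n + 1) * v (l - 2, n + 1, \<mu>) else 0))) = operator_coeff s k1 k2 v l n \<mu>"
    unfolding operator_coeff_def by (simp only: distrib_left mult.assoc mult.left_commute)
  finally show ?thesis
    by (subst has_sum_cong[OF eq])
qed

text \<open>The expansion is unfolded to signed angular orders: position \<open>p\<close> in the block of total degree
  \<open>N = l + 2 * n\<close> carries the function of order \<open>2 * p - N\<close>, so \<open>l = \<bar>2 * p - N\<bar>\<close>.\<close>

definition signed_family :: "int \<Rightarrow> nat \<Rightarrow> (nat \<Rightarrow> nat \<Rightarrow> real) \<Rightarrow> int \<Rightarrow> real" where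
  "signed_family \<mu> N w p = (if p \<notin> {0..int N} then 0
     else if 2 * p = int N then (if \<mu> = 1 then w 0 (nat p) else 0)
     else if 2 * p > int N then w (nat (2 * p - int N)) (nat (int N - p))
     else parity \<mu> * w (nat (int N - 2 * p)) (nat p))"

lemma signed_family_reflect:
  "signed_family \<mu> N w (int N - p) = parity \<mu> * signed_family \<mu> N w p"
  by (auto simp: signed_family_def parity_def intro!: arg_cong2[where f = w])

lemma signed_family_upper:
  assumes "(l, n, \<mu>) \<in> basis_index"
  shows "signed_family \<mu> (l + 2 * n) w (int (n + l)) = w l n"
  using assms by (cases "l = 0") (auto simp: signed_family_def basis_index_def nat_diff_distrib)

text \<open>Coefficients of order 0 enter halved. In the row \<open>l = 2\<close> this compensates
  the double occurrence of \<open>(0, n + 1, 1)\<close>; in the row \<open>l = 0\<close>, where both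
  neighbours agree by reflection, it shows as an overall factor 1/2. So the unfolded matrix is
  constant along its diagonals.\<close>

lemma operator_coeff_signed:
  fixes s k1 k2 :: real and c :: "nat \<times> nat \<times> int \<Rightarrow> real"
  assumes j: "(l, n, \<mu>) \<in> basis_index"
  defines "X \<equiv> signed_family \<mu> (l + 2 * n) (\<lambda>l n. gamma_ratio s n * c (l, n, \<mu>))"
  shows "operator_coeff s k1 k2 (series_coeff c) l n \<mu> = 4 powr (s - 1) * gamma_ratio s (n + l) * (if l = 0 then 1 / 2 else 1)
     * (2 * (k1 + k2) * X (int (n + l)) + (k1 - k2) * (X (int (n + l) + 1) + X (int (n + l) - 1)))"
proof -
  let ?g = "gamma_ratio s"
  have \<mu>: "\<mu> = 1 \<or> \<mu> = -1" "l = 0 \<Longrightarrow> \<mu> = 1" using j by (auto simp: basis_index_def)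
  have X0: "X (int (n + l)) = ?g n * c (l, n, \<mu>)" unfolding X_def by (rule signed_family_upper[OF j])
  have X1: "X (int (n + l) + 1) = (if n = 0 then 0 else ?g (n - 1) * c (l + 2, n - 1, \<mu>))"
  proof -
    have "nat (2 + int l) = Suc (Suc l)" by simp
    then show ?thesis by (cases n) (auto simp: X_def signed_family_def nat_diff_distrib)
  qed
  have X2: "X (int (n + l) - 1) = (if l = 0 then (if n = 0 then 0 else parity \<mu> * (?g (n - 1) * c (2, n - 1, \<mu>)))
     else if l = 1 then parity \<mu> * (?g n * c (1, n, \<mu>))
     else if l = 2 \<and> \<mu> \<noteq> 1 then 0 else ?g (n + 1) * c (l - 2, n + 1, \<mu>))"
  proof -
    consider (zero) "l = 0" | (one) "l = 1" | (two) "l = 2" | (more) l' where "l = l' + 3"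
      by (metis One_nat_def Suc_1 add.commute add_Suc_right numeral_3_eq_3 old.nat.exhaust plus_nat.add_0)
    then show ?thesis
    proof cases
      case zero
      then show ?thesis by (cases n) (auto simp: X_def signed_family_def)
    next
      case one
      then show ?thesis by (auto simp: X_def signed_family_def)
    next
      case two
      have "nat (int n + 1) = Suc n" "nat (1 + int n) = Suc n" by simp_all
      then show ?thesis by (auto simp: two X_def signed_family_def)
    next
      case more
      have "nat (2 * (int n + int l' + 2) - (int l' + 3 + 2 * int n)) = l' + 1" "nat (int l' + 3 + 2 * int n - (int n + int l' + 2)) = n + 1"
        by auto
      then show ?thesis by (auto simp: more X_def signed_family_def add_ac)
    qed
  qed
  show ?thesis
    unfolding operator_coeff_def X0 X1 X2 using \<mu>
    by (auto simp: series_coeff_def parity_def numeral_2_eq_2 algebra_simps)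
qed

lemma solves_coeffs_iff:
  assumes s: "0 < s" "s < 1" and K: "K = vector [vector [k1, 0], vector [0, k2]]"
  shows "solves_coeffs (2 * s) K f c \<longleftrightarrow>
    (\<forall>l n \<mu>. (l, n, \<mu>) \<in> basis_index \<longrightarrow> operator_coeff s k1 k2 (series_coeff c) l n \<mu> = basis_coeff s f (l, n, \<mu>))"
proof -
  have half: "2 * s / 2 = s" by simp
  show ?thesis
    unfolding solves_coeffs_def half
  proof (intro iffI allI impI ballI)
    fix l n \<mu> assume "\<forall>j\<in>basis_index. ((\<lambda>i. series_coeff c i * basis_coeff s (frac_diffusion (2 * s) K (tilde (2 * s) (disk_basis s i))) j) has_sum basis_coeff s f j) basis_index"
      and j: "(l, n, \<mu>) \<in> basis_index"
    then have "((\<lambda>i. series_coeff c i * basis_coeff s (frac_diffusion (2 * s) K (tilde (2 * s) (disk_basis s i))) (l, n, \<mu>)) has_sum basis_coeff s f (l, n, \<mu>)) basis_index"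
      by blast
    then show "operator_coeff s k1 k2 (series_coeff c) l n \<mu> = basis_coeff s f (l, n, \<mu>)"
      by (rule has_sum_unique[OF has_sum_operator_coeff[OF s K j]])
  next
    fix j assume *: "\<forall>l n \<mu>. (l, n, \<mu>) \<in> basis_index \<longrightarrow> operator_coeff s k1 k2 (series_coeff c) l n \<mu> = basis_coeff s f (l, n, \<mu>)"
      and j: "j \<in> basis_index"
    obtain l n \<mu> where j_eq: "j = (l, n, \<mu>)" by (cases j)
    from * j have "operator_coeff s k1 k2 (series_coeff c) l n \<mu> = basis_coeff s f (l, n, \<mu>)" unfolding j_eq by blast
    then show "((\<lambda>i. series_coeff c i * basis_coeff s (frac_diffusion (2 * s) K (tilde (2 * s) (disk_basis s i))) j) has_sum basis_coeff s f j) basis_index"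
      using has_sum_operator_coeff[OF s K, of l n \<mu> "series_coeff c"] j unfolding j_eq by simp
  qed
qed

text \<open>Each matrix entry is, up to constants, the Gamma quotient at \<open>n\<close> of the
  source times the one at \<open>n + l\<close> of the target. The latter is divided out of the row
  here, the former is absorbed by \<open>scaled_unknown\<close>.\<close>

definition scaled_data :: "real \<Rightarrow> real \<Rightarrow> (nat \<times> nat \<times> int \<Rightarrow> real) \<Rightarrow> int \<Rightarrow> nat \<Rightarrow> nat \<Rightarrow> real" where
  "scaled_data s \<kappa> d \<mu> l n = d (l, n, \<mu>) / (4 powr (s - 1) * gamma_ratio s (n + l) * (if l = 0 then 1 / 2 else 1) * (2 * \<kappa>))"

definition scaled_unknown :: "real \<Rightarrow> (nat \<times> nat \<times> int \<Rightarrow> real) \<Rightarrow> int \<Rightarrow> nat \<Rightarrow> nat \<Rightarrow> real" where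
  "scaled_unknown s c \<mu> l n = gamma_ratio s n * c (l, n, \<mu>)"

lemma operator_equation_iff:
  fixes s k1 k2 :: real and c d :: "nat \<times> nat \<times> int \<Rightarrow> real" and l n :: nat and \<mu> :: int
  assumes s: "0 < s" and k: "k1 > 0" "k2 > 0" and j: "(l, n, \<mu>) \<in> basis_index"
  defines "X \<equiv> signed_family \<mu> (l + 2 * n) (scaled_unknown s c \<mu>)" and "p \<equiv> int (n + l)"
  shows "operator_coeff s k1 k2 (series_coeff c) l n \<mu> = d (l, n, \<mu>)
    \<longleftrightarrow> X p + (k1 - k2) / (2 * (k1 + k2)) * (X (p + 1) + X (p - 1)) = scaled_data s (k1 + k2) d \<mu> l n"
proof -
  define q where "q = 4 powr (s - 1) * gamma_ratio s (n + l) * (if l = 0 then 1 / 2 else 1 :: real)"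
  have q: "q > 0" using gamma_ratio_pos[OF s] by (simp add: q_def)
  define m Y where "m = 2 * (k1 + k2)" and "Y = X (p + 1) + X (p - 1)"
  have m: "m \<noteq> 0" using k by (simp add: m_def)
  have A: "operator_coeff s k1 k2 (series_coeff c) l n \<mu> = q * (m * X p + (k1 - k2) * Y)"
    unfolding operator_coeff_signed[OF j] q_def m_def Y_def X_def p_def scaled_unknown_def[abs_def] ..
  have B: "scaled_data s (k1 + k2) d \<mu> l n = d (l, n, \<mu>) / (q * m)"
    unfolding scaled_data_def q_def m_def ..
  have "q * (m * X p + (k1 - k2) * Y) = (X p + (k1 - k2) / m * Y) * (q * m)"
    using m by (simp add: field_simps)
  moreover have "X p + (k1 - k2) / m * Y = d (l, n, \<mu>) / (q * m) \<longleftrightarrow> (X p + (k1 - k2) / m * Y) * (q * m) = d (l, n, \<mu>)"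
    by (rule nonzero_eq_divide_eq) (use q m in simp)
  ultimately show ?thesis unfolding A B by (simp only: m_def Y_def)
qed

lemma signed_family_outside: "p \<notin> {0..int N} \<Longrightarrow> signed_family \<mu> N w p = 0"
  unfolding signed_family_def by (rule if_P)

text \<open>The coefficient equations only cover the positions with \<open>2 * p \<ge> N\<close>.
  The others are their mirror images, multiplied by \<open>parity \<mu>\<close> on both
  sides.\<close>

lemma solves_coeffs_imp_tridiagonal:
  assumes s: "0 < s" "s < 1" and kpos: "k1 > 0" "k2 > 0" and K: "K = vector [vector [k1, 0], vector [0, k2]]"
    and c: "solves_coeffs (2 * s) K f c" and \<mu>: "\<mu> \<in> {1, -1}"
  shows "tridiagonal_solution ((k1 - k2) / (2 * (k1 + k2))) (int N)
    (signed_family \<mu> N (scaled_data s (k1 + k2) (basis_coeff s f) \<mu>)) (signed_family \<mu> N (scaled_unknown s c \<mu>))"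
proof -
  let ?X = "signed_family \<mu> N (scaled_unknown s c \<mu>)" and ?G = "signed_family \<mu> N (scaled_data s (k1 + k2) (basis_coeff s f) \<mu>)"
  define k where "k = (k1 - k2) / (2 * (k1 + k2))"
  have upper: "?X p + k * (?X (p + 1) + ?X (p - 1)) = ?G p" if p: "p \<in> {0..int N}" "2 * p \<ge> int N" for p
  proof (cases "2 * p = int N \<and> \<mu> = -1")
    \<comment> \<open>The middle position carries no basis function for \<open>\<mu> = -1\<close>;
      by antisymmetry both sides of its equation vanish.\<close>
    case True
    have "?X (int N - (p + 1)) = parity \<mu> * ?X (p + 1)" by (rule signed_family_reflect)
    moreover have "int N - (p + 1) = p - 1" using True by simp
    ultimately have "?X (p + 1) + ?X (p - 1) = 0" using True by (simp add: parity_def)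
    then show ?thesis using True by (simp add: signed_family_def)
  next
    case False
    define l n where "l = nat (2 * p - int N)" and "n = nat (int N - p)"
    have N: "N = l + 2 * n" and pe: "p = int (n + l)" using p by (auto simp: l_def n_def)
    have j: "(l, n, \<mu>) \<in> basis_index" using False \<mu> p by (auto simp: basis_index_def l_def)
    have "operator_coeff s k1 k2 (series_coeff c) l n \<mu> = basis_coeff s f (l, n, \<mu>)"
      using c j unfolding solves_coeffs_iff[OF s K] by blast
    then show ?thesis
      unfolding operator_equation_iff[OF s(1) kpos j] k_def[symmetric] pe N signed_family_upper[OF j] .
  qed
  have "?X p + k * (?X (p + 1) + ?X (p - 1)) = ?G p" if p: "p \<in> {0..int N}" for p
  proof (cases "2 * p \<ge> int N")
    case False
    have reflect: "signed_family \<mu> N w (p + j) = parity \<mu> * signed_family \<mu> N w (int N - p - j)" for w j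
    proof -
      have "int N - (int N - p - j) = p + j" by simp
      then show ?thesis using signed_family_reflect[of \<mu> N w "int N - p - j"] by simp
    qed
    have r: "?X p = parity \<mu> * ?X (int N - p)" "?G p = parity \<mu> * ?G (int N - p)"
      "?X (p + 1) = parity \<mu> * ?X (int N - p - 1)" "?X (p - 1) = parity \<mu> * ?X (int N - p + 1)"
      using reflect[of _ 0] reflect[of _ 1] reflect[of _ "-1"] by simp_all
    have "?X (int N - p) + k * (?X (int N - p + 1) + ?X (int N - p - 1)) = ?G (int N - p)"
      using p False by (intro upper) auto
    then have "parity \<mu> * (?X (int N - p) + k * (?X (int N - p + 1) + ?X (int N - p - 1))) = parity \<mu> * ?G (int N - p)"
      by simp
    then show ?thesis unfolding r by (simp only: algebra_simps)
  qed (use upper p in auto)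
  then show ?thesis
    unfolding tridiagonal_solution_def k_def[symmetric] by (simp add: signed_family_outside)
qed

lemma solves_coeffs_unique:
  assumes s: "0 < s" "s < 1" and k: "k1 > 0" "k2 > 0" and K: "K = vector [vector [k1, 0], vector [0, k2]]"
    and c: "solves_coeffs (2 * s) K f c" "solves_coeffs (2 * s) K f c'" and i: "i \<in> basis_index"
  shows "c i = c' i"
proof -
  obtain l n \<mu> where i_eq: "i = (l, n, \<mu>)" by (cases i)
  have \<mu>: "\<mu> \<in> {1, -1}" using i by (auto simp: i_eq basis_index_def)
  have kk: "\<bar>(k1 - k2) / (2 * (k1 + k2))\<bar> < 1 / 2" using k by (simp add: field_simps abs_if)
  have "signed_family \<mu> (l + 2 * n) (scaled_unknown s c \<mu>) (int (n + l)) = signed_family \<mu> (l + 2 * n) (scaled_unknown s c' \<mu>) (int (n + l))"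
    by (rule tridiagonal_solution_unique[OF kk solves_coeffs_imp_tridiagonal[OF s k K c(1) \<mu>] solves_coeffs_imp_tridiagonal[OF s k K c(2) \<mu>] refl])
  then have "gamma_ratio s n * c i = gamma_ratio s n * c' i"
    using i unfolding i_eq by (simp only: signed_family_upper scaled_unknown_def)
  then show ?thesis using gamma_ratio_pos[OF s(1), of n] by simp
qed

text \<open>The blocks are solved independently on signed positions. The solution folds back to the
  real basis because uniqueness gives it the reflection symmetry of the data.\<close>

lemma solves_coeffs_exists:
  assumes s: "0 < s" "s < 1" and k: "k1 > 0" "k2 > 0" and K: "K = vector [vector [k1, 0], vector [0, k2]]"
  obtains c where "solves_coeffs (2 * s) K f c"
proof -
  define m where "m = (k1 - k2) / (2 * (k1 + k2))"
  let ?G = "\<lambda>\<mu> N. signed_family \<mu> N (scaled_data s (k1 + k2) (basis_coeff s f) \<mu>)"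
  have kk: "\<bar>m\<bar> < 1 / 2" using k by (simp add: m_def field_simps abs_if)
  define Xs where "Xs \<mu> N = (SOME X. tridiagonal_solution m (int N) (?G \<mu> N) X)" for \<mu> N
  have Xs: "tridiagonal_solution m (int N) (?G \<mu> N) (Xs \<mu> N)" for \<mu> N
  proof -
    obtain X where "tridiagonal_solution m (int N) (?G \<mu> N) X" by (rule tridiagonal_solution_exists[OF kk])
    then show ?thesis unfolding Xs_def using someI[of "tridiagonal_solution m (int N) (?G \<mu> N)" X] by simp
  qed
  have reflect: "Xs \<mu> N p = parity \<mu> * Xs \<mu> N (int N - p)" for \<mu> N p
  proof (rule tridiagonal_solution_unique[OF kk Xs _ refl])
    have "parity \<mu> * Xs \<mu> N (int N - q) + m * (parity \<mu> * Xs \<mu> N (int N - (q + 1)) + parity \<mu> * Xs \<mu> N (int N - (q - 1))) = ?G \<mu> N q"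
      if "q \<in> {0..int N}" for q
    proof -
      have "?G \<mu> N q = parity \<mu> * ?G \<mu> N (int N - q)" using signed_family_reflect[of \<mu> N _ "int N - q"] by simp
      also have "?G \<mu> N (int N - q) = Xs \<mu> N (int N - q) + m * (Xs \<mu> N (int N - q + 1) + Xs \<mu> N (int N - q - 1))"
        using Xs[of N \<mu>] that by (auto simp: tridiagonal_solution_def)
      finally show ?thesis by (simp add: algebra_simps)
    qed
    moreover have "Xs \<mu> N (int N - q) = 0" if "q \<notin> {0..int N}" for q
      using Xs[of N \<mu>] that by (auto simp: tridiagonal_solution_def)
    ultimately show "tridiagonal_solution m (int N) (?G \<mu> N) (\<lambda>p. parity \<mu> * Xs \<mu> N (int N - p))"
      by (simp add: tridiagonal_solution_def)
  qed
  define c where "c = (\<lambda>(l, n, \<mu>). Xs \<mu> (l + 2 * n) (int (n + l)) / gamma_ratio s n)"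
  have w: "scaled_unknown s c \<mu> l n = Xs \<mu> (l + 2 * n) (int (n + l))" for \<mu> l n
    using gamma_ratio_pos[OF s(1), of n] by (simp add: scaled_unknown_def c_def)
  have fam: "signed_family \<mu> N (scaled_unknown s c \<mu>) p = Xs \<mu> N p" if \<mu>: "\<mu> \<in> {1, -1}" for \<mu> N p
  proof -
    have "Xs \<mu> N p = 0" if "p \<notin> {0..int N}" using Xs[of N \<mu>] that by (auto simp: tridiagonal_solution_def)
    moreover have "Xs \<mu> N p = 0" if "2 * p = int N" "\<mu> \<noteq> 1"
    proof -
      have "int N - p = p" using that by simp
      with reflect[of \<mu> N p] have "Xs \<mu> N p = parity \<mu> * Xs \<mu> N p" by simp
      then show ?thesis using that by (simp add: parity_def)
    qed
    moreover have "scaled_unknown s c \<mu> (nat (2 * p - int N)) (nat (int N - p)) = Xs \<mu> N p" if "p \<in> {0..int N}" "2 * p \<ge> int N"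
    proof -
      have "nat (2 * p - int N) + 2 * nat (int N - p) = N" "int (nat (int N - p) + nat (2 * p - int N)) = p"
        using that by auto
      then show ?thesis unfolding w by simp
    qed
    moreover have "scaled_unknown s c \<mu> 0 (nat p) = Xs \<mu> N p" if "p \<in> {0..int N}" "2 * p = int N"
    proof -
      have "0 + 2 * nat p = N" "int (nat p + 0) = p" using that by auto
      then show ?thesis unfolding w by simp
    qed
    moreover have "parity \<mu> * scaled_unknown s c \<mu> (nat (int N - 2 * p)) (nat p) = Xs \<mu> N p" if "p \<in> {0..int N}" "2 * p < int N"
    proof -
      have "nat (int N - 2 * p) + 2 * nat p = N" "int (nat p + nat (int N - 2 * p)) = int N - p"
        using that by auto
      then show ?thesis unfolding w using reflect[of \<mu> N p] by simp
    qed
    ultimately show ?thesis by (auto simp: signed_family_def)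
  qed
  have "solves_coeffs (2 * s) K f c"
    unfolding solves_coeffs_iff[OF s K]
  proof (intro allI impI)
    fix l n \<mu> assume j: "(l, n, \<mu>) \<in> basis_index"
    then have \<mu>: "\<mu> \<in> {1, -1}" by (auto simp: basis_index_def)
    have "int (n + l) \<in> {0..int (l + 2 * n)}" by simp
    then have "Xs \<mu> (l + 2 * n) (int (n + l)) + m * (Xs \<mu> (l + 2 * n) (int (n + l) + 1) + Xs \<mu> (l + 2 * n) (int (n + l) - 1))
       = ?G \<mu> (l + 2 * n) (int (n + l))"
      using Xs[of "l + 2 * n" \<mu>] unfolding tridiagonal_solution_def by blast
    then show "operator_coeff s k1 k2 (series_coeff c) l n \<mu> = basis_coeff s f (l, n, \<mu>)"
      unfolding operator_equation_iff[OF s(1) k j] m_def[symmetric] fam[OF \<mu>] signed_family_upper[OF j] .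
  qed
  then show thesis by (rule that)
qed

section \<open>Weighted estimates\<close>

text \<open>The upper half and its mirror image cover the range, a middle position twice; by
  nonnegativity this still gives the bound.\<close>

lemma sum_reflect_le:
  fixes \<phi> :: "int \<Rightarrow> real"
  assumes nonneg: "\<And>p. p \<in> {0..N} \<Longrightarrow> 0 \<le> \<phi> p" and reflect: "\<And>p. p \<in> {0..N} \<Longrightarrow> \<phi> (N - p) = \<phi> p"
  shows "(\<Sum>p\<in>{0..N}. \<phi> p) \<le> 2 * (\<Sum>p\<in>{p\<in>{0..N}. N \<le> 2 * p}. \<phi> p)"
proof -
  let ?U = "{p\<in>{0..N}. N \<le> 2 * p}"
  have "{0..N} = ?U \<union> (\<lambda>p. N - p) ` ?U"
  proof (intro equalityI subsetI)
    fix p assume "p \<in> {0..N}"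
    then show "p \<in> ?U \<union> (\<lambda>p. N - p) ` ?U"
      by (cases "N \<le> 2 * p") (auto intro!: image_eqI[of _ _ "N - p"])
  qed auto
  then have "(\<Sum>p\<in>{0..N}. \<phi> p) = sum \<phi> (?U \<union> (\<lambda>p. N - p) ` ?U)" by (rule arg_cong)
  moreover have "sum \<phi> (?U \<union> (\<lambda>p. N - p) ` ?U) + sum \<phi> (?U \<inter> (\<lambda>p. N - p) ` ?U) = sum \<phi> ?U + sum \<phi> ((\<lambda>p. N - p) ` ?U)"
    by (rule sum.union_inter) (auto intro: finite_subset[of _ "{0..N}"])
  moreover have "0 \<le> sum \<phi> (?U \<inter> (\<lambda>p. N - p) ` ?U)" by (intro sum_nonneg nonneg) blast
  ultimately have "(\<Sum>p\<in>{0..N}. \<phi> p) \<le> (\<Sum>p\<in>?U. \<phi> p) + (\<Sum>p\<in>(\<lambda>p. N - p) ` ?U. \<phi> p)" by linarith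
  also have "(\<Sum>p\<in>(\<lambda>p. N - p) ` ?U. \<phi> p) = (\<Sum>p\<in>?U. \<phi> p)"
    by (subst sum.reindex) (auto simp: inj_on_def reflect)
  finally show ?thesis by simp
qed

text \<open>Both \<open>l\<close> and \<open>n\<close> are shifted by \<open>R\<close>, which makes the weight slowly varying; for \<open>N \<ge> 1\<close> this
  changes it by a bounded factor only.\<close>

definition shifted_weight :: "real \<Rightarrow> real \<Rightarrow> real \<Rightarrow> real \<Rightarrow> int \<Rightarrow> int \<Rightarrow> real" where
  "shifted_weight R s s1 s2 N p =
     ((real_of_int \<bar>2 * p - N\<bar> + R) powr (2 * s1) + (real_of_int (min p (N - p)) + R) powr (2 * s2))
      * ((real_of_int p + R) powr s * (real_of_int (N - p) + R) powr s)"

lemma shifted_weight_reflect: "shifted_weight R s s1 s2 N (N - p) = shifted_weight R s s1 s2 N p"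
proof -
  have "\<bar>2 * (N - p) - N\<bar> = \<bar>2 * p - N\<bar>" "min (N - p) (N - (N - p)) = min p (N - p)" by auto
  then show ?thesis unfolding shifted_weight_def by (simp add: mult_ac)
qed

lemma shifted_weight_nonneg: "0 \<le> shifted_weight R s s1 s2 N p"
  unfolding shifted_weight_def by simp

text \<open>One step changes \<open>\<bar>2 * p - N\<bar>\<close> by at most 2 and the other
  quantities by at most 1. With the shift \<open>2 / h\<close>, an increase by 2 is at most the
  fraction \<open>h\<close> of each shifted quantity. The sum of powers costs the exponent
  \<open>b\<close>, the two remaining factors cost \<open>s\<close> each.\<close>

lemma shifted_weight_slowly_varying:
  assumes h: "0 < h" and s: "0 \<le> s" "0 \<le> s1" "0 \<le> s2" "2 * s1 \<le> b" "2 * s2 \<le> b"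
    and p: "p \<in> {0..N}" "p' \<in> {0..N}" "\<bar>p - p'\<bar> \<le> 1"
  shows "shifted_weight (2 / h) s s1 s2 N p' \<le> (1 + h) powr (b + 2 * s) * shifted_weight (2 / h) s s1 s2 N p"
proof -
  define R where "R = 2 / h"
  have R: "R > 0" using h by (simp add: R_def)
  have slow: "(real_of_int y + R) powr a \<le> (1 + h) powr e * (real_of_int x + R) powr a"
    if "0 \<le> x" "0 \<le> y" "y \<le> x + 2" "0 \<le> a" "a \<le> e" for x y :: int and a e :: real
  proof (rule slowly_varying_powr)
    have "real_of_int y + R \<le> real_of_int x + R + 2" using that by linarith
    also have "\<dots> \<le> (1 + h) * (real_of_int x + R)"
    proof -
      have "h * R = 2" using h by (simp add: R_def)
      moreover have "0 \<le> h * real_of_int x" using h that by simp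
      ultimately show ?thesis by (simp add: algebra_simps)
    qed
    finally show "real_of_int y + R \<le> (1 + h) * (real_of_int x + R)" .
  qed (use R h that in auto)
  have A: "(real_of_int \<bar>2 * p' - N\<bar> + R) powr (2 * s1) + (real_of_int (min p' (N - p')) + R) powr (2 * s2)
     \<le> (1 + h) powr b * (real_of_int \<bar>2 * p - N\<bar> + R) powr (2 * s1) + (1 + h) powr b * (real_of_int (min p (N - p)) + R) powr (2 * s2)"
    using p s by (intro add_mono slow) auto
  have B: "(real_of_int p' + R) powr s * (real_of_int (N - p') + R) powr s
     \<le> ((1 + h) powr s * (real_of_int p + R) powr s) * ((1 + h) powr s * (real_of_int (N - p) + R) powr s)"
    using p s by (intro mult_mono slow) auto
  have "shifted_weight R s s1 s2 N p' \<le>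
     ((1 + h) powr b * (real_of_int \<bar>2 * p - N\<bar> + R) powr (2 * s1) + (1 + h) powr b * (real_of_int (min p (N - p)) + R) powr (2 * s2))
      * (((1 + h) powr s * (real_of_int p + R) powr s) * ((1 + h) powr s * (real_of_int (N - p) + R) powr s))"
    unfolding shifted_weight_def by (intro mult_mono A B) auto
  also have "\<dots> = ((1 + h) powr b * ((1 + h) powr s * (1 + h) powr s)) * shifted_weight R s s1 s2 N p"
    unfolding shifted_weight_def by (simp add: algebra_simps)
  also have "(1 + h) powr b * ((1 + h) powr s * (1 + h) powr s) = (1 + h) powr (b + 2 * s)"
    by (simp add: powr_add[symmetric] algebra_simps)
  finally show ?thesis unfolding R_def .
qed

lemma gamma_ratio_product_bound:
  assumes s: "0 < s" "s < 1"
  shows "(real m + 1) powr s * (real n + 1) powr s \<le> 4 * (gamma_ratio s n * gamma_ratio s m)"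
proof -
  have "(real m + 1) powr s * (real n + 1) powr s \<le> (2 * gamma_ratio s m) * (2 * gamma_ratio s n)"
    using gamma_ratio_bounds(2)[OF s] gamma_ratio_pos[OF s(1), of m] by (intro mult_mono) (auto intro: less_imp_le)
  then show ?thesis by (simp add: mult_ac)
qed

text \<open>This is the gain of regularity. The square of \<open>A\<close> dominates the additional
  powers \<open>l powr (2 * s)\<close> and \<open>n powr (4 * s)\<close>; one factor
  \<open>A\<close> is bounded by Gamma quotients, the other goes into the shifted weight.\<close>

lemma solution_weight_le_shifted:
  assumes s: "0 < s" "s < 1" "0 < s1" "0 < s2" and R: "R > 0"
  shows "real l powr (2 * (s1 + s)) + real n powr (2 * (s2 + 2 * s))
     \<le> 4 * (1 + 1 / R) powr (2 * s) * (gamma_ratio s n * gamma_ratio s (n + l)) * shifted_weight R s s1 s2 (int (l + 2 * n)) (int (n + l))"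
proof -
  define x y where "x = real (n + l)" and "y = real n"
  define W where "W = (real l + R) powr (2 * s1) + (real n + R) powr (2 * s2)"
  have xy: "0 \<le> x" "0 \<le> y" "y \<le> x" by (auto simp: x_def y_def)
  have sw: "shifted_weight R s s1 s2 (int (l + 2 * n)) (int (n + l)) = W * ((x + R) powr s * (y + R) powr s)"
  proof -
    have "\<bar>2 * int (n + l) - int (l + 2 * n)\<bar> = int l" "min (int (n + l)) (int (l + 2 * n) - int (n + l)) = int n"
      "int (l + 2 * n) - int (n + l) = int n" by auto
    then show ?thesis unfolding shifted_weight_def W_def x_def y_def by simp
  qed
  define A where "A = (x + 1) powr s * (y + 1) powr s"
  have A_sq: "A * A = (x + 1) powr (2 * s) * (y + 1) powr (2 * s)"
  proof -
    have "2 * s = s + s" by simp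
    then show ?thesis unfolding A_def by (simp only: powr_add mult_ac)
  qed
  have l1: "real l powr (2 * s) \<le> A * A"
  proof -
    have "real l powr (2 * s) * 1 \<le> (x + 1) powr (2 * s) * (y + 1) powr (2 * s)"
      using s xy by (intro mult_mono powr_mono2 ge_one_powr_ge_zero) (auto simp: x_def)
    then show ?thesis by (simp add: A_sq)
  qed
  have n1: "real n powr (4 * s) \<le> A * A"
  proof -
    have "real n powr (4 * s) = real n powr (2 * s) * real n powr (2 * s)" by (simp add: powr_add[symmetric])
    also have "\<dots> \<le> (x + 1) powr (2 * s) * (y + 1) powr (2 * s)"
      using s xy by (intro mult_mono powr_mono2) (auto simp: x_def y_def)
    finally show ?thesis by (simp add: A_sq)
  qed
  have "real l powr (2 * (s1 + s)) + real n powr (2 * (s2 + 2 * s)) = real l powr (2 * s1) * real l powr (2 * s) + real n powr (2 * s2) * real n powr (4 * s)"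
    by (simp add: powr_add[symmetric] algebra_simps)
  also have "\<dots> \<le> (real l + R) powr (2 * s1) * (A * A) + (real n + R) powr (2 * s2) * (A * A)"
    using s R l1 n1 by (intro add_mono mult_mono powr_mono2) auto
  also have "\<dots> = W * (A * A)" by (simp add: W_def algebra_simps)
  also have "\<dots> \<le> W * ((4 * (gamma_ratio s n * gamma_ratio s (n + l))) * ((1 + 1 / R) powr (2 * s) * ((x + R) powr s * (y + R) powr s)))"
  proof (intro mult_left_mono mult_mono)
    show "A \<le> 4 * (gamma_ratio s n * gamma_ratio s (n + l))"
      unfolding A_def x_def y_def by (rule gamma_ratio_product_bound[OF s(1,2)])
    have "z + 1 \<le> (1 + 1 / R) * (z + R)" if "0 \<le> z" for z using that R by (simp add: field_simps)
    then have "A \<le> ((1 + 1 / R) * (x + R)) powr s * ((1 + 1 / R) * (y + R)) powr s"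
      unfolding A_def using s xy R by (intro mult_mono powr_mono2) auto
    also have "\<dots> = (1 + 1 / R) powr (s + s) * ((x + R) powr s * (y + R) powr s)"
      unfolding powr_add using R xy by (simp add: powr_mult)
    finally show "A \<le> (1 + 1 / R) powr (2 * s) * ((x + R) powr s * (y + R) powr s)" by (simp only: mult_2[of s])
  qed (use gamma_ratio_pos[OF s(1)] in \<open>auto simp: A_def W_def intro!: mult_nonneg_nonneg less_imp_le\<close>)
  finally show ?thesis unfolding sw by (simp add: mult_ac)
qed

text \<open>Away from \<open>(0, 0)\<close> one of the two powers in \<open>W\<close> is at least 1,
  and this pays for the shift by \<open>R\<close>. At \<open>(0, 0)\<close> the right side would be
  0.\<close>

lemma shifted_weight_le_data:
  assumes s: "0 < s" "s < 1" "0 < s1" "0 < s2" "2 * s1 \<le> b" "2 * s2 \<le> b" and R: "R > 0" and ln: "l > 0 \<or> n > 0"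
  shows "shifted_weight R s s1 s2 (int (l + 2 * n)) (int (n + l))
     \<le> 8 * (1 + R) powr (b + 2 * s) * (gamma_ratio s n * gamma_ratio s (n + l)) * (real l powr (2 * s1) + real n powr (2 * s2))"
proof -
  define x y where "x = real (n + l)" and "y = real n"
  define W where "W = real l powr (2 * s1) + real n powr (2 * s2)"
  have xy: "0 \<le> x" "0 \<le> y" by (auto simp: x_def y_def)
  have sw: "shifted_weight R s s1 s2 (int (l + 2 * n)) (int (n + l)) = ((real l + R) powr (2 * s1) + (real n + R) powr (2 * s2)) * ((x + R) powr s * (y + R) powr s)"
  proof -
    have "\<bar>2 * int (n + l) - int (l + 2 * n)\<bar> = int l" "min (int (n + l)) (int (l + 2 * n) - int (n + l)) = int n"
      "int (l + 2 * n) - int (n + l) = int n" by auto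
    then show ?thesis unfolding shifted_weight_def x_def y_def by simp
  qed
  have W1: "1 \<le> W"
  proof -
    have "1 \<le> real l powr (2 * s1) \<or> 1 \<le> real n powr (2 * s2)"
      using ln s by (auto intro!: ge_one_powr_ge_zero)
    then show ?thesis unfolding W_def using powr_ge_zero[of "real l" "2 * s1"] powr_ge_zero[of "real n" "2 * s2"] by linarith
  qed
  have one: "(real m + R) powr a \<le> (1 + R) powr b * W" if a: "0 < a" "a \<le> b" and m: "real m powr a \<le> W" for m a
  proof (cases "m = 0")
    case True
    have "R powr a \<le> (1 + R) powr a" using R a by (intro powr_mono2) auto
    also have "\<dots> \<le> (1 + R) powr b" using R a by (intro powr_mono) auto
    also have "\<dots> \<le> (1 + R) powr b * W" using W1 mult_left_mono[of 1 W "(1 + R) powr b"] by simp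
    finally show ?thesis using True by simp
  next
    case False
    then have "1 \<le> real m" by simp
    then have "real m + R \<le> (1 + R) * real m" using R mult_left_mono[of 1 "real m" R] by (simp add: algebra_simps)
    then have "(real m + R) powr a \<le> ((1 + R) * real m) powr a" using R a by (intro powr_mono2) auto
    also have "\<dots> = (1 + R) powr a * real m powr a" using R by (intro powr_mult)
    also have "\<dots> \<le> (1 + R) powr b * W" using R a m by (intro mult_mono powr_mono) auto
    finally show ?thesis .
  qed
  have "(real l + R) powr (2 * s1) \<le> (1 + R) powr b * W" "(real n + R) powr (2 * s2) \<le> (1 + R) powr b * W"
    using s by (intro one; simp add: W_def)+
  then have A: "(real l + R) powr (2 * s1) + (real n + R) powr (2 * s2) \<le> 2 * (1 + R) powr b * W" by simp
  have "z + R \<le> (1 + R) * (z + 1)" if "0 \<le> z" for z using that R by (simp add: algebra_simps)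
  then have "(x + R) powr s * (y + R) powr s \<le> ((1 + R) * (x + 1)) powr s * ((1 + R) * (y + 1)) powr s"
    using s R xy by (intro mult_mono powr_mono2) auto
  also have "\<dots> = (1 + R) powr (s + s) * ((x + 1) powr s * (y + 1) powr s)"
    unfolding powr_add using R xy by (simp add: powr_mult)
  also have "\<dots> \<le> (1 + R) powr (s + s) * (4 * (gamma_ratio s n * gamma_ratio s (n + l)))"
    unfolding x_def y_def by (intro mult_left_mono gamma_ratio_product_bound s) auto
  finally have B: "(x + R) powr s * (y + R) powr s \<le> (1 + R) powr (2 * s) * (4 * (gamma_ratio s n * gamma_ratio s (n + l)))" by (simp only: mult_2[of s])
  have "shifted_weight R s s1 s2 (int (l + 2 * n)) (int (n + l)) \<le> (2 * (1 + R) powr b * W) * ((1 + R) powr (2 * s) * (4 * (gamma_ratio s n * gamma_ratio s (n + l))))"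
    unfolding sw using W1 by (intro mult_mono A B) auto
  then show ?thesis unfolding W_def by (simp add: powr_add mult_ac)
qed

text \<open>Every finite set is completed to a finite union of finite blocks, over which the
  estimate can be summed.\<close>

lemma summable_on_blocks:
  fixes f g :: "'a \<Rightarrow> real" and key :: "'a \<Rightarrow> 'b"
  assumes g: "g summable_on A" and nonneg: "\<And>x. x \<in> A \<Longrightarrow> 0 \<le> f x" "\<And>x. x \<in> A \<Longrightarrow> 0 \<le> g x" "0 \<le> C"
    and finite: "\<And>k. finite {x\<in>A. key x = k}"
    and le: "\<And>k. (\<Sum>x | x \<in> A \<and> key x = k. f x) \<le> C * (\<Sum>x | x \<in> A \<and> key x = k. g x)"
  shows "f summable_on A"
proof (rule nonneg_bdd_above_summable_on)
  have "sum f F \<le> C * infsum g A" if F: "F \<subseteq> A" "finite F" for F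
  proof -
    define D where "D = (\<Union>k\<in>key ` F. {x\<in>A. key x = k})"
    have D: "finite D" "D \<subseteq> A" "F \<subseteq> D" using F finite by (auto simp: D_def)
    have group: "sum h D = (\<Sum>k\<in>key ` F. \<Sum>x | x \<in> A \<and> key x = k. h x)" for h :: "'a \<Rightarrow> real"
      unfolding D_def using F finite by (intro sum.UNION_disjoint) auto
    have "sum f F \<le> sum f D" using D nonneg by (intro sum_mono2) auto
    also have "\<dots> \<le> (\<Sum>k\<in>key ` F. C * (\<Sum>x | x \<in> A \<and> key x = k. g x))" unfolding group by (intro sum_mono le)
    also have "\<dots> = C * sum g D" unfolding group by (rule sum_distrib_left[symmetric])
    also have "\<dots> \<le> C * infsum g A" using D nonneg g by (intro mult_left_mono finite_sum_le_infsum) auto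
    finally show ?thesis .
  qed
  then show "bdd_above (sum f ` {F. F \<subseteq> A \<and> finite F})" by (intro bdd_aboveI[of _ "C * infsum g A"]) auto
qed (rule nonneg)

section \<open>Blocks of fixed degree and parity\<close>

definition degree_parity :: "nat \<times> nat \<times> int \<Rightarrow> nat \<times> int" where
  "degree_parity = (\<lambda>(l, n, \<mu>). (l + 2 * n, \<mu>))"

abbreviation degree_block :: "nat \<Rightarrow> int \<Rightarrow> (nat \<times> nat \<times> int) set" where
  "degree_block N \<mu> \<equiv> {j \<in> basis_index. degree_parity j = (N, \<mu>)}"

lemma finite_degree_block: "finite (degree_block N \<mu>)"
  by (rule finite_subset[of _ "{..N} \<times> {..N} \<times> {\<mu>}"]) (auto simp: degree_parity_def)

text \<open>The position \<open>n + l\<close> maps the block injectively into the upper half of the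
  range. It misses at most the middle position, for \<open>\<mu> = -1\<close>, and there the signed
  family is 0.\<close>

lemma sum_degree_block:
  assumes "\<mu> \<in> {1, -1}"
  shows "(\<Sum>p\<in>{p\<in>{0..int N}. int N \<le> 2 * p}. a p * (signed_family \<mu> N w p)\<^sup>2)
    = (\<Sum>j\<in>degree_block N \<mu>. (case j of (l, n, _) \<Rightarrow> a (int (n + l)) * (w l n)\<^sup>2))"
proof -
  let ?U = "{p\<in>{0..int N}. int N \<le> 2 * p}" and ?pos = "\<lambda>(l, n, _ :: int). int (n + l)"
  have "(\<Sum>j\<in>degree_block N \<mu>. (case j of (l, n, _) \<Rightarrow> a (int (n + l)) * (w l n)\<^sup>2))
      = (\<Sum>j\<in>degree_block N \<mu>. a (?pos j) * (signed_family \<mu> N w (?pos j))\<^sup>2)"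
    by (intro sum.cong refl) (auto simp: degree_parity_def signed_family_upper simp del: of_nat_add)
  also have "\<dots> = (\<Sum>p\<in>?pos ` degree_block N \<mu>. a p * (signed_family \<mu> N w p)\<^sup>2)"
    by (subst sum.reindex) (auto simp: inj_on_def degree_parity_def)
  also have "\<dots> = (\<Sum>p\<in>?U. a p * (signed_family \<mu> N w p)\<^sup>2)"
  proof (rule sum.mono_neutral_left)
    show "\<forall>p\<in>?U - ?pos ` degree_block N \<mu>. a p * (signed_family \<mu> N w p)\<^sup>2 = 0"
    proof
      fix p assume p: "p \<in> ?U - ?pos ` degree_block N \<mu>"
      have "p = ?pos (nat (2 * p - int N), nat (int N - p), \<mu>)" using p by simp
      then have "(nat (2 * p - int N), nat (int N - p), \<mu>) \<notin> degree_block N \<mu>" using p by blast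
      then have "2 * p = int N" "\<mu> \<noteq> 1" using p assms by (auto simp: degree_parity_def basis_index_def)
      then show "a p * (signed_family \<mu> N w p)\<^sup>2 = 0" by (simp add: signed_family_def)
    qed
  qed (auto simp: degree_parity_def intro: finite_subset[of _ "{0..int N}"])
  finally show ?thesis ..
qed

text \<open>The last factor of the denominator depends on the degree only, so it is constant on a
  block.\<close>

lemma basis_norm2_gamma_ratio:
  assumes s: "0 < s"
  shows "basis_norm2 s (l, n, \<mu>) = (if l = 0 then 1 else 1 / 2) * pi * (gamma_ratio s n / (gamma_ratio s (n + l) * (real (l + 2 * n) + s + 1)))"
proof -
  have "real n + real l + s + 1 = s + real (n + l) + 1" "real n + s + 1 = s + real n + 1" by simp_all
  then have "jacobi_norm2 s l n = gamma_ratio s n / (gamma_ratio s (n + l) * (real (l + 2 * n) + s + 1))"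
    unfolding jacobi_norm2_def gamma_ratio_def by (simp add: field_simps)
  then show ?thesis unfolding basis_norm2_def by simp
qed

text \<open>The coefficient is the scaled unknown divided by \<open>gamma_ratio s n\<close>.
  Together with the norm of the basis function, the squared unknown is divided by
  \<open>gamma_ratio s n * gamma_ratio s (n + l)\<close>, which the bound on \<open>W\<close> makes
  up for.\<close>

lemma solution_term_le:
  assumes s: "0 < s" and W: "W \<le> C * (gamma_ratio s n * gamma_ratio s (n + l)) * \<omega>" and pos: "0 \<le> C" "0 \<le> \<omega>"
  shows "W * ((series_coeff c (l, n, \<mu>))\<^sup>2 * basis_norm2 s (l, n, \<mu>))
     \<le> pi / 2 * C / (real (l + 2 * n) + s + 1) * (\<omega> * (scaled_unknown s c \<mu> l n)\<^sup>2)"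
proof -
  define g h D x where "g = gamma_ratio s n" and "h = gamma_ratio s (n + l)" and "D = real (l + 2 * n) + s + 1" and "x = c (l, n, \<mu>)"
  \<comment> \<open>For \<open>l = 0\<close> this is the square of the halving; for
    \<open>l > 0\<close> it is the mean square of the harmonic.\<close>
  define r where "r = (if l = 0 then 1 / 4 else 1 / 2 :: real)"
  have gh: "g > 0" "h > 0" "D > 0" using gamma_ratio_pos[OF s] s by (auto simp: g_def h_def D_def)
  have "W * ((series_coeff c (l, n, \<mu>))\<^sup>2 * basis_norm2 s (l, n, \<mu>)) = W * (r * pi * (x\<^sup>2 * g / (h * D)))"
    unfolding basis_norm2_gamma_ratio[OF s] g_def h_def D_def x_def r_def
    by (simp add: series_coeff_def power_divide)
  also have "\<dots> \<le> (C * (g * h) * \<omega>) * (1 / 2 * pi * (x\<^sup>2 * g / (h * D)))"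
    using W gh pos unfolding g_def[symmetric] h_def[symmetric]
    by (intro mult_mono) (auto simp: r_def intro!: mult_nonneg_nonneg divide_nonneg_nonneg)
  also have "\<dots> = pi / 2 * C / D * (\<omega> * (g * x)\<^sup>2)" using gh by (simp add: power2_eq_square)
  finally show ?thesis unfolding g_def D_def x_def scaled_unknown_def .
qed

text \<open>Here the product of Gamma quotients multiplies, whereas it divides for the solution. Up
  to constants, the same \<open>\<omega>\<close> lies between the solution weight over this product
  and the data weight times this product; the square of the product is the gain.\<close>

lemma data_term_ge:
  assumes s: "0 < s" and W: "\<omega> \<le> C * (gamma_ratio s n * gamma_ratio s (n + l)) * W" and pos: "0 \<le> C" "0 \<le> W" and \<kappa>: "0 < \<kappa>"
  shows "1 / (real (l + 2 * n) + s + 1) * (\<omega> * (scaled_data s \<kappa> d \<mu> l n)\<^sup>2)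
     \<le> C / (pi * (4 powr (s - 1) * \<kappa>)\<^sup>2) * (W * ((d (l, n, \<mu>))\<^sup>2 * basis_norm2 s (l, n, \<mu>)))"
proof -
  define g h D x y where "g = gamma_ratio s n" and "h = gamma_ratio s (n + l)" and "D = real (l + 2 * n) + s + 1" and "x = d (l, n, \<mu>)"
    and "y = 4 powr (s - 1) * \<kappa>"
  define r where "r = (if l = 0 then 1 / 2 else 1 :: real)"
  have gh: "g > 0" "h > 0" "D > 0" "y > 0" "0 < r" using gamma_ratio_pos[OF s] s \<kappa> by (auto simp: g_def h_def D_def y_def r_def)
  have G: "scaled_data s \<kappa> d \<mu> l n = x / (2 * (y * h * r))"
    unfolding scaled_data_def x_def y_def h_def r_def by (simp add: mult_ac)
  have H: "basis_norm2 s (l, n, \<mu>) = (1 / 2) / r * pi * (g / (h * D))"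
    unfolding basis_norm2_gamma_ratio[OF s] g_def h_def D_def r_def by simp
  have "1 / D * (\<omega> * (x / (2 * (y * h * r)))\<^sup>2) \<le> 1 / D * ((C * (g * h) * W) * (x / (2 * (y * h * r)))\<^sup>2)"
    using W gh unfolding g_def[symmetric] h_def[symmetric] by (intro mult_left_mono mult_right_mono) auto
  also have "\<dots> = C * W * x\<^sup>2 * g / (D * y\<^sup>2 * h) * (1 / (4 * r\<^sup>2))" using gh by (simp add: power2_eq_square field_simps)
  also have "\<dots> \<le> C * W * x\<^sup>2 * g / (D * y\<^sup>2 * h) * (1 / (2 * r))"
    using gh pos by (intro mult_left_mono) (auto simp: r_def power2_eq_square intro!: mult_nonneg_nonneg divide_nonneg_nonneg)
  also have "\<dots> = C / (pi * y\<^sup>2) * (W * (x\<^sup>2 * ((1 / 2) / r * pi * (g / (h * D)))))"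
    using gh by (simp add: field_simps)
  finally show ?thesis unfolding G H D_def[symmetric] x_def[symmetric] y_def[symmetric] .
qed

text \<open>The shifted weight mediates between the weights of solution and data, and the
  tridiagonal estimate applies to it on the unfolded block. The constants involve \<open>s\<close>,
  \<open>s1\<close>, \<open>s2\<close>, \<open>k1\<close>, \<open>k2\<close> but not
  \<open>N\<close>; the degree-dependent factor \<open>D\<close> occurs on both sides and
  cancels.\<close>

lemma degree_block_estimate:
  fixes f :: "real^2 \<Rightarrow> real"
  assumes s: "0 < s" "s < 1" and k: "k1 > 0" "k2 > 0" and K: "K = vector [vector [k1, 0], vector [0, k2]]"
    and s12: "0 < s1" "0 < s2" and c: "solves_coeffs (2 * s) K f c"
  defines "L \<equiv> \<lambda>(l, n, \<mu>). (real l powr (2 * (s1 + s)) + real n powr (2 * (s2 + 2 * s))) * ((series_coeff c (l, n, \<mu>))\<^sup>2 * basis_norm2 s (l, n, \<mu>))"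
    and "R \<equiv> \<lambda>(l, n, \<mu>). (real l powr (2 * s1) + real n powr (2 * s2)) * ((basis_coeff s f (l, n, \<mu>))\<^sup>2 * basis_norm2 s (l, n, \<mu>))"
  shows "\<exists>C\<ge>0. \<forall>N \<mu>. sum L (degree_block N \<mu>) \<le> C * sum R (degree_block N \<mu>)"
proof -
  define m where "m = (k1 - k2) / (2 * (k1 + k2))"
  \<comment> \<open>With this choice \<open>(1 + \<delta>) * (2 * \<bar>m\<bar>) < 1\<close> is
    equivalent to \<open>0 < (1 - 2 * \<bar>m\<bar>) * (1 - \<bar>m\<bar>)\<close>; squared, it
    gives \<open>q < 1\<close>.\<close>
  define \<delta> where "\<delta> = (1 - 2 * \<bar>m\<bar>) / 2"
  have m: "\<bar>m\<bar> < 1 / 2" using k by (simp add: m_def field_simps abs_if)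
  then have \<delta>: "0 < \<delta>" by (simp add: \<delta>_def)
  define q where "q = (1 + \<delta>)\<^sup>2 * (4 * m\<^sup>2)"
  have q: "q < 1"
  proof -
    have "0 < (1 - 2 * \<bar>m\<bar>) * (1 - \<bar>m\<bar>)" using m by (intro mult_pos_pos) auto
    then have "(1 + \<delta>) * (2 * \<bar>m\<bar>) < 1" by (simp add: \<delta>_def field_simps)
    then have "((1 + \<delta>) * (2 * \<bar>m\<bar>))\<^sup>2 < 1" using \<delta> by (simp add: abs_square_less_1)
    then show ?thesis by (simp add: q_def power_mult_distrib)
  qed
  define b where "b = max (2 * s1) (2 * s2)"
  \<comment> \<open>The solution of \<open>(1 + h) powr (b + 2 * s) = 1 + \<delta>\<close>, so that
    neighbouring shifted weights differ by at most the factor allowed in the tridiagonal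
    estimate.\<close>
  define h where "h = (1 + \<delta>) powr (1 / (b + 2 * s)) - 1"
  have b: "2 * s1 \<le> b" "2 * s2 \<le> b" "0 < b" using s12 by (auto simp: b_def)
  have h: "0 < h"
  proof -
    have "1 < (1 + \<delta>) powr (1 / (b + 2 * s))" using \<delta> b s by (intro gr_one_powr) auto
    then show ?thesis by (simp add: h_def)
  qed
  have h_powr: "(1 + h) powr (b + 2 * s) = 1 + \<delta>" using \<delta> b s by (simp add: h_def powr_powr)
  define \<rho> where "\<rho> = 2 / h"
  have \<rho>: "0 < \<rho>" using h by (simp add: \<rho>_def)
  define \<kappa> where "\<kappa> = k1 + k2"
  have \<kappa>: "0 < \<kappa>" using k by (simp add: \<kappa>_def)
  define C1 where "C1 = 4 * (1 + 1 / \<rho>) powr (2 * s)"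
  define C2 where "C2 = (1 + 1 / \<delta>) / (1 - q)"
  define C3 where "C3 = 8 * (1 + \<rho>) powr (b + 2 * s)"
  define C4 where "C4 = C3 / (pi * (4 powr (s - 1) * \<kappa>)\<^sup>2)"
  have C: "0 \<le> C1" "0 \<le> C2" "0 \<le> C3" "0 \<le> C4" using \<delta> q by (auto simp: C1_def C2_def C3_def C4_def)
  have "sum L (degree_block N \<mu>) \<le> (pi / 2 * C1 * C2 * 2 * C4) * sum R (degree_block N \<mu>)" for N \<mu>
  \<comment> \<open>For \<open>N = 0\<close> both sides are 0, as a positive power of 0 is 0; other
    values of \<open>\<mu>\<close> give empty blocks.\<close>
  proof (cases "N = 0 \<or> \<mu> \<notin> {1, -1}")
    case True
    then have "L j = 0" "R j = 0" if "j \<in> degree_block N \<mu>" for j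
      using that by (auto simp: degree_parity_def basis_index_def L_def R_def)
    then show ?thesis by simp
  next
    case False
    then have \<mu>: "\<mu> \<in> {1, -1}" by blast
    let ?\<omega> = "shifted_weight \<rho> s s1 s2 (int N)"
    let ?X = "signed_family \<mu> N (scaled_unknown s c \<mu>)" and ?G = "signed_family \<mu> N (scaled_data s \<kappa> (basis_coeff s f) \<mu>)"
    let ?U = "{p\<in>{0..int N}. int N \<le> 2 * p}"
    define D where "D = real N + s + 1"
    have D: "0 < D" using s by (simp add: D_def)
    have L_le: "L j \<le> pi / 2 * C1 / D * (case j of (l, n, _) \<Rightarrow> ?\<omega> (int (n + l)) * (scaled_unknown s c \<mu> l n)\<^sup>2)"
      if block: "j \<in> degree_block N \<mu>" for j
    proof -
      obtain l n where j: "j = (l, n, \<mu>)" and N: "l + 2 * n = N" using block by (cases j) (auto simp: degree_parity_def)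
      show ?thesis
        unfolding j L_def prod.case D_def N[symmetric]
        by (rule solution_term_le[OF s(1) _ C(1) shifted_weight_nonneg])
          (unfold C1_def, rule solution_weight_le_shifted[OF s s12 \<rho>])
    qed
    have R_ge: "1 / D * (case j of (l, n, _) \<Rightarrow> ?\<omega> (int (n + l)) * (scaled_data s \<kappa> (basis_coeff s f) \<mu> l n)\<^sup>2) \<le> C4 * R j"
      if block: "j \<in> degree_block N \<mu>" for j
    proof -
      obtain l n where j: "j = (l, n, \<mu>)" and N: "l + 2 * n = N" using block by (cases j) (auto simp: degree_parity_def)
      have ln: "l > 0 \<or> n > 0" using N False by auto
      show ?thesis
        unfolding j R_def prod.case D_def N[symmetric] C4_def
        by (rule data_term_ge[OF s(1) _ C(3) _ \<kappa>])
          (unfold C3_def, rule shifted_weight_le_data[OF s s12 b(1,2) \<rho> ln], simp)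
    qed
    have "sum L (degree_block N \<mu>) \<le> pi / 2 * C1 / D * (\<Sum>p\<in>?U. ?\<omega> p * (?X p)\<^sup>2)"
      unfolding sum_degree_block[OF \<mu>] sum_distrib_left by (intro sum_mono L_le)
    also have "\<dots> \<le> pi / 2 * C1 / D * (\<Sum>p\<in>{0..int N}. ?\<omega> p * (?X p)\<^sup>2)"
      using C D by (intro mult_left_mono sum_mono2) (auto simp: shifted_weight_nonneg)
    also have "\<dots> \<le> pi / 2 * C1 / D * (C2 * (\<Sum>p\<in>{0..int N}. ?\<omega> p * (?G p)\<^sup>2))"
    proof (rule mult_left_mono)
      have slow: "?\<omega> p' \<le> (1 + \<delta>) * ?\<omega> p" if "p \<in> {0..int N}" "p' \<in> {0..int N}" "\<bar>p - p'\<bar> \<le> 1" for p p'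
        using shifted_weight_slowly_varying[OF h _ _ _ b(1,2) that, of s] s s12 unfolding h_powr \<rho>_def by simp
      show "(\<Sum>p\<in>{0..int N}. ?\<omega> p * (?X p)\<^sup>2) \<le> C2 * (\<Sum>p\<in>{0..int N}. ?\<omega> p * (?G p)\<^sup>2)"
        unfolding C2_def
      proof (rule tridiagonal_solution_estimate)
        show "tridiagonal_solution m (int N) ?G ?X"
          unfolding m_def \<kappa>_def by (rule solves_coeffs_imp_tridiagonal[OF s k K c \<mu>])
        show "?\<omega> p \<le> (1 + \<delta>) * ?\<omega> (p + 1)" "?\<omega> (p + 1) \<le> (1 + \<delta>) * ?\<omega> p"
          if "p \<in> {0..int N}" "p + 1 \<in> {0..int N}" for p
          using that by (auto intro!: slow)
      qed (use \<delta> q in \<open>auto simp: shifted_weight_nonneg q_def\<close>)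
    qed (use C D in auto)
    also have "\<dots> \<le> pi / 2 * C1 / D * (C2 * (2 * (\<Sum>p\<in>?U. ?\<omega> p * (?G p)\<^sup>2)))"
    proof (intro mult_left_mono sum_reflect_le)
      show "?\<omega> (int N - p) * (?G (int N - p))\<^sup>2 = ?\<omega> p * (?G p)\<^sup>2" for p
        unfolding shifted_weight_reflect signed_family_reflect by (simp add: parity_def)
    qed (use C D in \<open>auto simp: shifted_weight_nonneg\<close>)
    also have "\<dots> = pi / 2 * C1 * C2 * 2 * (1 / D * (\<Sum>p\<in>?U. ?\<omega> p * (?G p)\<^sup>2))" by simp
    also have "\<dots> \<le> pi / 2 * C1 * C2 * 2 * (C4 * sum R (degree_block N \<mu>))"
    proof (rule mult_left_mono)
      show "1 / D * (\<Sum>p\<in>?U. ?\<omega> p * (?G p)\<^sup>2) \<le> C4 * sum R (degree_block N \<mu>)"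
        unfolding sum_degree_block[OF \<mu>] sum_distrib_left by (intro sum_mono R_ge)
    qed (use C in simp)
    finally show ?thesis by (simp only: mult.assoc)
  qed
  moreover have "0 \<le> pi / 2 * C1 * C2 * 2 * C4" using C by simp
  ultimately show ?thesis by blast
qed

theorem theorem5p1:
  fixes \<alpha> k1 k2 s1 s2 :: real and K :: "real^2^2" and f :: "real^2 \<Rightarrow> real"
  assumes "0 < \<alpha>" "\<alpha> < 2"
    and "k1 > 0" "k2 > 0"
    and "K = vector [vector [k1, 0], vector [0, k2]]"
    and "s1 > 0" "s2 > 0"
    and "f \<in> B_space (\<alpha> / 2) s1 s2"
  shows "\<exists>c u. solves_coeffs \<alpha> K f c
      \<and> has_expansion (\<alpha> / 2) (series_coeff c) u
      \<and> u \<in> B_space (\<alpha> / 2) (s1 + \<alpha> / 2) (s2 + \<alpha>)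
      \<and> (\<forall>c'. solves_coeffs \<alpha> K f c' \<longrightarrow>
            (\<forall>i\<in>basis_index. c' i = c i)
          \<and> (\<forall>u'. has_expansion (\<alpha> / 2) (series_coeff c') u' \<longrightarrow>
                (AE x in lebesgue. tilde \<alpha> u' x = tilde \<alpha> u x)))"
proof -
  define s where "s = \<alpha> / 2"
  have \<alpha>: "\<alpha> = 2 * s" and s: "0 < s" "s < 1" "-1 < s" using assms by (auto simp: s_def)
  let ?W = "\<lambda>l n. real l powr (2 * (s1 + s)) + real n powr (2 * (s2 + 2 * s))"
  obtain c where c: "solves_coeffs (2 * s) K f c" by (rule solves_coeffs_exists[OF s(1,2) assms(3-5)])
  have summable: "(\<lambda>(l, n, \<mu>). ?W l n * ((series_coeff c (l, n, \<mu>))\<^sup>2 * basis_norm2 s (l, n, \<mu>))) summable_on basis_index"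
  proof -
    have "\<exists>C\<ge>0. \<forall>N \<mu>.
       (\<Sum>(l, n, \<mu>)\<in>degree_block N \<mu>. ?W l n * ((series_coeff c (l, n, \<mu>))\<^sup>2 * basis_norm2 s (l, n, \<mu>)))
         \<le> C * (\<Sum>(l, n, \<mu>)\<in>degree_block N \<mu>. (real l powr (2 * s1) + real n powr (2 * s2)) * ((basis_coeff s f (l, n, \<mu>))\<^sup>2 * basis_norm2 s (l, n, \<mu>)))"
      by (rule degree_block_estimate[OF s(1,2) assms(3-7) c])
    then obtain C where C: "0 \<le> C" "\<forall>N \<mu>.
       (\<Sum>(l, n, \<mu>)\<in>degree_block N \<mu>. ?W l n * ((series_coeff c (l, n, \<mu>))\<^sup>2 * basis_norm2 s (l, n, \<mu>)))
         \<le> C * (\<Sum>(l, n, \<mu>)\<in>degree_block N \<mu>. (real l powr (2 * s1) + real n powr (2 * s2)) * ((basis_coeff s f (l, n, \<mu>))\<^sup>2 * basis_norm2 s (l, n, \<mu>)))"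
      by blast
    have "(\<lambda>(l, n, \<mu>). (real l powr (2 * s1) + real n powr (2 * s2)) * ((basis_coeff s f (l, n, \<mu>))\<^sup>2 * basis_norm2 s (l, n, \<mu>)))
       summable_on basis_index"
      using assms(8) unfolding s_def[symmetric] B_space_iff[OF s(3)] by blast
    then show ?thesis
    proof (rule summable_on_blocks[where key = degree_parity and C = C])
      show "finite {x \<in> basis_index. degree_parity x = k}" for k
        using finite_degree_block[of "fst k" "snd k"] by simp
      show "(\<Sum>(l, n, \<mu>) \<in> {j \<in> basis_index. degree_parity j = k}. ?W l n * ((series_coeff c (l, n, \<mu>))\<^sup>2 * basis_norm2 s (l, n, \<mu>)))
         \<le> C * (\<Sum>(l, n, \<mu>) \<in> {j \<in> basis_index. degree_parity j = k}. (real l powr (2 * s1) + real n powr (2 * s2)) * ((basis_coeff s f (l, n, \<mu>))\<^sup>2 * basis_norm2 s (l, n, \<mu>)))" for k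
        using C(2)[rule_format, of "fst k" "snd k"] by simp
    qed (use C(1) less_imp_le[OF basis_norm2_pos[OF s(3)]] in auto)
  qed
  \<comment> \<open>The weight vanishes at \<open>(0, 0, 1)\<close> and is at least 1 at all other
    indices. That index is removed for the comparison and put back afterwards; the square
    summability obtained is what makes the series converge in the weighted space.\<close>
  have "(\<lambda>i. (series_coeff c i)\<^sup>2 * basis_norm2 s i) summable_on basis_index"
  proof -
    let ?h = "\<lambda>i. (series_coeff c i)\<^sup>2 * basis_norm2 s i" and ?A = "basis_index - {(0, 0, 1)}"
    have "(\<lambda>(l, n, \<mu>). ?W l n * ?h (l, n, \<mu>)) summable_on ?A"
      using summable by (rule summable_on_subset_banach) auto
    then have "?h summable_on ?A"
    proof (rule summable_on_comparison_test)
      fix i assume i: "i \<in> ?A"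
      obtain l n \<mu> where i_eq: "i = (l, n, \<mu>)" by (cases i)
      have "l > 0 \<or> n > 0" using i by (auto simp: i_eq basis_index_def)
      then have "1 \<le> real l powr (2 * (s1 + s)) \<or> 1 \<le> real n powr (2 * (s2 + 2 * s))"
        using assms(6,7) s by (auto intro!: ge_one_powr_ge_zero)
      then have "1 \<le> ?W l n"
        using powr_ge_zero[of "real l" "2 * (s1 + s)"] powr_ge_zero[of "real n" "2 * (s2 + 2 * s)"] by linarith
      then show "?h i \<le> (case i of (l, n, \<mu>) \<Rightarrow> ?W l n * ?h (l, n, \<mu>))"
        using basis_norm2_pos[OF s(3), of i] mult_right_mono[of 1 "?W l n" "?h i"] by (simp add: i_eq)
      show "0 \<le> ?h i" using basis_norm2_pos[OF s(3), of i] by simp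
    qed
    then have "?h summable_on insert (0, 0, 1) ?A" by (simp only: summable_on_insert_iff)
    moreover have "insert (0, 0, 1) ?A = basis_index" by (auto simp: basis_index_def)
    ultimately show ?thesis by simp
  qed
  then obtain u where u: "has_expansion s (series_coeff c) u" by (rule has_expansion_exists[OF s(3)])
  have "u \<in> B_space s (s1 + s) (s2 + 2 * s)"
  proof -
    have "(\<lambda>(l, n, \<mu>). ?W l n * ((basis_coeff s u (l, n, \<mu>))\<^sup>2 * basis_norm2 s (l, n, \<mu>))) summable_on basis_index
      \<longleftrightarrow> (\<lambda>(l, n, \<mu>). ?W l n * ((series_coeff c (l, n, \<mu>))\<^sup>2 * basis_norm2 s (l, n, \<mu>))) summable_on basis_index"
      by (rule summable_on_cong) (auto simp: has_expansion_coeff[OF s(3) u])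
    then show ?thesis using summable u unfolding B_space_iff[OF s(3)] has_expansion_iff[OF s(3)] by blast
  qed
  moreover have "(\<forall>i\<in>basis_index. c' i = c i) \<and> (\<forall>u'. has_expansion s (series_coeff c') u' \<longrightarrow>
      (AE x in lebesgue. tilde (2 * s) u' x = tilde (2 * s) u x))" if c': "solves_coeffs (2 * s) K f c'" for c'
  proof (intro conjI ballI allI impI)
    show eq: "c' i = c i" if "i \<in> basis_index" for i
      by (rule solves_coeffs_unique[OF s(1,2) assms(3-5) c' c that])
    fix u' assume u': "has_expansion s (series_coeff c') u'"
    have "AE x in lebesgue. x \<in> unit_disk \<longrightarrow> u' x = u x"
      by (rule has_expansion_unique[OF s(3) u' u]) (auto simp: series_coeff_def eq)
    then show "AE x in lebesgue. tilde (2 * s) u' x = tilde (2 * s) u x"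
      by eventually_elim (simp add: tilde_def)
  qed
  ultimately show ?thesis using c u unfolding s_def[symmetric] unfolding \<alpha> by blast
qed

end
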